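(* Let $1\le p_0<\infty$ and let $\mathcal F$ be a collection of pairs $(f,g)$ of nonnegative measurable functions on $\mathbb R^n$. Assume that for every $(f,g)\in\mathcal F$ and every $w\in A_{p_0}$ we have $$\|g|L_{p_0,w}(\mathbb R^n)\|\le c_1\|f|L_{p_0,w}(\mathbb R^n)\|,\qquad(\mathrm H)$$ where $c_1$ does not depend on the pair $(f,g)$ and depends on $w$ only in terms of $[w]_{A_{p_0}}$. Then for every $(f,g)\in\mathcal F$, every $1<p<\infty$ (and also for $p=1$ if $p_0=1$), every $-n/p\le r<0$ and every $w\in A_p$ we have $$\|g|L^r_p(w,\mathbb R^n)\|\le c_2\|f|L^r_p(w,\mathbb R^n)\|.\qquad(1)$$ Furthermore, for every $(f,g)\in\mathcal F$, every $1<p<\infty$ (and also for $p=1$ if $p_0=1$) and every $w\in A_p\cap RH_\sigma$ (with $1<\sigma<\infty$), if $-n/p\le r\le -n/(p\sigma)$ we have $$\|g|L^r_p(\lambda,w,\mathbb R^n)\|\le c_3\|f|L^r_p(\lambda,w,\mathbb R^n)\|.\qquad(2)$$ The constants $c_2$ and $c_3$ do not depend on the pair $(f,g)$ but may depend on $w$ and the involved parameters. If (H) is assumed to hold only when its left-hand side is finite, then (1) and (2) still hold assuming that their left-hand side is finite.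
   Context: Norm inequalities are understood in $[0,\infty]$: in the first part they carry content whenever the right-hand side is finite (then the left-hand side must be finite as well). Cubes in $\mathbb R^n$ have sides parallel to the axes. A weight is a nonnegative locally integrable function; $w(E)=\int_E w$, $|E|$ is Lebesgue measure, $p'$ is the conjugate exponent. For $0<p<\infty$, $\|f|L_{p,w}(E)\|=(\int_E|f|^pw)^{1/p}$. Muckenhoupt classes: for $1<p<\infty$ and $w>0$ a.e. locally integrable, $w\in A_p$ iff $[w]_{A_p}=\sup_Q\frac{w(Q)}{|Q|}\big(\frac{w^{1-p'}(Q)}{|Q|}\big)^{p-1}<\infty$; $w\in A_1$ iff there is $c$ with $w(Q)/|Q|\le c\,w(x)$ for a.e. $x\in Q$ and every cube $Q$ ($[w]_{A_1}$ is the least such $c$). Reverse Hölder class: for $1<\sigma<\infty$, $w\in RH_\sigma$ iff there is $c$ with $\big(|Q|^{-1}\int_Q w^\sigma\big)^{1/\sigma}\le c\,|Q|^{-1}\int_Q w$ for all cubes $Q$. Morrey spaces: for $0<p<\infty$, $-n/p\le r<0$ and a weight $w$, the spaces $L^r_p(w,\mathbb R^n)$ and $L^r_p(\lambda,w,\mathbb R^n)$ consist of the (classes of) measurable complex functions $f$ on $\mathbb R^n$ for which, respectively, the following quasinorms are finite (suprema over all cubes; here $\lambda$ is just a label for the second type of space): $$\|f|L^r_p(w,\mathbb R^n)\|=\sup_Q w(Q)^{-(1/p+r/n)}\|f|L_{p,w}(Q)\|,\qquad \|f|L^r_p(\lambda,w,\mathbb R^n)\|=\sup_Q |Q|^{-(1/p+r/n)}\|f|L_{p,w}(Q)\|.$$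 *)

theory Defs
  imports "HOL-Analysis.Analysis"
begin

(* Powers x^a in [0,\<infinity>] for arbitrary real exponents; unlike powr, x^0 = 1 also for x = 0. *)
definition ennreal_power :: "ennreal \<Rightarrow> real \<Rightarrow> ennreal" where
  "ennreal_power x a =
     (if a = 0 then 1
      else if x = 0 then (if a > 0 then 0 else \<infinity>)
      else if x = \<infinity> then (if a > 0 then \<infinity> else 0)
      else ennreal (enn2real x powr a))"

(* All nondegenerate closed cubes; the boundary is a null set, so all norms and constants
   below are the same for open cubes. *)
definition cubes :: "(real ^ 'n) set set" where
  "cubes = {cbox a (\<chi> i. a $ i + l) | a l. 0 < l}"

definition weight :: "(real ^ 'n \<Rightarrow> real) \<Rightarrow> bool" where
  "weight w \<longleftrightarrow> w \<in> borel_measurable lebesgue \<and> (\<forall>x. 0 \<le> w x) \<and>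
     (\<forall>K. compact K \<longrightarrow> set_integrable lebesgue K w)"

definition weight_of :: "(real ^ 'n \<Rightarrow> real) \<Rightarrow> (real ^ 'n) set \<Rightarrow> ennreal" where
  "weight_of w E = (\<integral>\<^sup>+x\<in>E. ennreal (w x) \<partial>lebesgue)"

definition cube_average :: "(real ^ 'n \<Rightarrow> real) \<Rightarrow> (real ^ 'n) set \<Rightarrow> ennreal" where
  "cube_average w Q = weight_of w Q / emeasure lebesgue Q"

(* [w]_{A_p} in [0,\<infinity>]; the exponent of the dual weight is 1 - p' = 1 - p / (p - 1). *)
definition muckenhoupt_const :: "real \<Rightarrow> (real ^ 'n \<Rightarrow> real) \<Rightarrow> ennreal" where
  "muckenhoupt_const p w =
     (if p = 1
      then Inf {c. \<forall>Q\<in>cubes. AE x in lebesgue. x \<in> Q \<longrightarrow> cube_average w Q \<le> c * ennreal (w x)}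
      else (SUP Q\<in>cubes. cube_average w Q *
              ennreal_power (cube_average (\<lambda>x. w x powr (1 - p / (p - 1))) Q) (p - 1)))"

(* For p = 1 the positivity clause only excludes the weight that vanishes a.e. *)
definition muckenhoupt :: "real \<Rightarrow> (real ^ 'n \<Rightarrow> real) set" where
  "muckenhoupt p =
     {w. weight w \<and> (AE x in lebesgue. 0 < w x) \<and> muckenhoupt_const p w < \<infinity>}"

definition reverse_holder :: "real \<Rightarrow> (real ^ 'n \<Rightarrow> real) set" where
  "reverse_holder \<sigma> =
     {w. weight w \<and> (\<exists>c::real. \<forall>Q\<in>cubes.
        ennreal_power (cube_average (\<lambda>x. w x powr \<sigma>) Q) (1 / \<sigma>) \<le> ennreal c * cube_average w Q)}"

definition Lp_norm ::
  "real \<Rightarrow> (real ^ 'n \<Rightarrow> real) \<Rightarrow> (real ^ 'n) set \<Rightarrow> (real ^ 'n \<Rightarrow> 'b::real_normed_vector) \<Rightarrow> ennreal" where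
  "Lp_norm p w E f =
     ennreal_power (\<integral>\<^sup>+x\<in>E. ennreal (norm (f x) powr p * w x) \<partial>lebesgue) (1 / p)"

(* Quasinorm of L^r_p(w, R^n), where n = CARD('n). *)
definition morrey_norm ::
  "real \<Rightarrow> real \<Rightarrow> (real ^ 'n \<Rightarrow> real) \<Rightarrow> (real ^ 'n \<Rightarrow> 'b::real_normed_vector) \<Rightarrow> ennreal" where
  "morrey_norm r p w f =
     (SUP Q\<in>cubes. ennreal_power (weight_of w Q) (- (1 / p + r / real CARD('n))) * Lp_norm p w Q f)"

(* Quasinorm of L^r_p(\<lambda>, w, R^n), normalised by Lebesgue measure. *)
definition morrey_norm_leb ::
  "real \<Rightarrow> real \<Rightarrow> (real ^ 'n \<Rightarrow> real) \<Rightarrow> (real ^ 'n \<Rightarrow> 'b::real_normed_vector) \<Rightarrow> ennreal" where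
  "morrey_norm_leb r p w f =
     (SUP Q\<in>cubes. ennreal_power (emeasure lebesgue Q) (- (1 / p + r / real CARD('n))) * Lp_norm p w Q f)"

end

theory Submission
  imports Defs
begin

text \<open>
  By Rubio de Francia extrapolation the hypothesis holds in \<open>L\<^sub>p(w)\<close> for all \<open>1 < p\<close> and \<open>w \<in> A\<^sub>p\<close>, with
  constants that are bounded as long as \<open>[w]\<close> is. The maximal operator used there is the
  dyadic one over finitely many shifted grids, which is bounded on \<open>L\<^sub>p(w)\<close> by comparing it with the
  maximal functions for the measures \<open>w dx\<close> and \<open>w\<^bsup>1-p'\<^esup> dx\<close> (Lerner's argument).

  For Morrey norms, fix a cube \<open>Q\<close> and apply the weighted inequality with the weight \<open>w v\<close>,
  where \<open>v = a\<^sub>j\<close> on \<open>2\<^sup>j Q - 2\<^bsup>j-1\<^esup> Q\<close>, \<open>a\<^sub>0 = 1\<close>, and \<open>a\<^sub>j\<close> decays so slowly that \<open>v\<close> is an \<open>A\<^sub>1\<close> weight with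
  respect to \<open>w dx\<close>, whence \<open>w v \<in> A\<^sub>p\<close> uniformly in \<open>Q\<close>, but so fast that the integral of \<open>f\<^sup>p w v\<close> is controlled
  by the Morrey norm of \<open>f\<close>. With \<open>W = w\<^sup>\<sigma>\<close> (\<open>\<sigma> = 1\<close> for the first type of space) the choice
  \<open>a\<^sub>j = (|Q| / |2\<^sup>j Q|)\<^bsup>1-1/\<sigma>\<^esup> (W(Q) / W(2\<^sup>j Q))\<^bsup>\<theta>\<^esup>\<close> with \<open>\<theta> < 1/\<sigma>\<close> works because \<open>W\<close> satisfies reverse doubling; in
  particular the endpoint \<open>r = -n/(p\<sigma>)\<close> needs no self-improvement of the reverse Hoelder inequality.
\<close>

section \<open>Powers of extended nonnegative reals\<close>

text \<open>The weights to which the hypothesis is applied depend on the pair (f, g) in the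
  extrapolation step and on the cube in the Morrey step, so the constant must be uniform over all
  weights of bounded characteristic. The hypothesis supplies only some function of the
  characteristic, with no monotonicity or local boundedness; uniformity needs its own argument. The
  second obstacle is the version restricted to finite left-hand sides, where an inequality may be
  invoked only once its left-hand side is known to be finite. The extrapolation weight is therefore
  built from a majorant of g itself, which makes the integral of g finite automatically, and a
  finite Morrey norm of g has to give a finite norm for the layered weight. For extrapolation the
  unrestricted version is then deduced from the restricted one. Where Hoelder's or Minkowski's
  inequality would be customary, a pointwise case distinction with a free parameter is integrated;
  this costs harmless factors such as 2.\<close>

lemma ennreal_power_ennreal: "0 < a \<Longrightarrow> 0 \<le> x \<Longrightarrow> ennreal_power (ennreal x) a = ennreal (x powr a)"
  by (auto simp: ennreal_power_def)

lemma ennreal_power_ennreal_pos: "0 < x \<Longrightarrow> ennreal_power (ennreal x) a = ennreal (x powr a)"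
  by (auto simp: ennreal_power_def)

lemma ennreal_power_top: "0 < a \<Longrightarrow> ennreal_power top a = top"
  by (auto simp: ennreal_power_def)

lemma ennreal_power_base_0 [simp]: "0 < a \<Longrightarrow> ennreal_power 0 a = 0"
  by (auto simp: ennreal_power_def)

lemma ennreal_power_base_1 [simp]: "ennreal_power 1 a = 1"
  by (auto simp: ennreal_power_def)

lemma ennreal_power_0 [simp]: "ennreal_power x 0 = 1"
  by (auto simp: ennreal_power_def)

lemma ennreal_power_1 [simp]: "ennreal_power x 1 = x"
  by (cases x) (auto simp: ennreal_power_def)

lemma ennreal_power_mono:
  assumes "0 \<le> a" "x \<le> y"
  shows "ennreal_power x a \<le> ennreal_power y a"
proof (cases "a = 0 \<or> y = top")
  case True
  then show ?thesis using assms by (cases "a = 0") (auto simp: ennreal_power_top)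
next
  case False
  then obtain s where s: "0 \<le> s" "y = ennreal s" by (cases y) auto
  obtain r where r: "0 \<le> r" "x = ennreal r" using assms s by (cases x) (auto simp: top_unique)
  have "r \<le> s" using assms s r by simp
  then show ?thesis using assms False s r by (auto simp: ennreal_power_ennreal intro!: ennreal_leI powr_mono2)
qed

text \<open>Negative exponents have to be excluded: since 0 times infinity is 0, the identity fails
  there for \<open>x = 0\<close> and \<open>y = top\<close>.\<close>

lemma ennreal_power_mult:
  assumes "0 \<le> a"
  shows "ennreal_power (x * y) a = ennreal_power x a * ennreal_power y a"
proof (cases "a = 0 \<or> x = 0 \<or> y = 0")
  case True
  then show ?thesis using assms by (cases "a = 0") auto
next
  case False
  then have n: "ennreal_power x a \<noteq> 0" "ennreal_power y a \<noteq> 0" and a: "0 < a"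
    using assms by (cases x; cases y; auto simp: ennreal_power_ennreal ennreal_power_top)+
  show ?thesis
  proof (cases "x = top \<or> y = top")
    case True
    then show ?thesis using False n a by (auto simp: ennreal_power_top ennreal_mult_eq_top_iff ennreal_top_mult ennreal_mult_top)
  next
    case False
    then obtain r s where "0 \<le> r" "0 \<le> s" "x = ennreal r" "y = ennreal s" by (cases x; cases y) auto
    then show ?thesis using a by (simp add: ennreal_power_ennreal powr_mult flip: ennreal_mult)
  qed
qed

lemma ennreal_power_power:
  assumes "0 < a" "0 < b"
  shows "ennreal_power (ennreal_power x a) b = ennreal_power x (a * b)"
  using assms by (cases x) (auto simp: ennreal_power_ennreal ennreal_power_top powr_powr)

lemma ennreal_power_le_iff: "0 < a \<Longrightarrow> ennreal_power x a \<le> y \<longleftrightarrow> x \<le> ennreal_power y (1 / a)"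
proof
  assume a: "0 < a" "ennreal_power x a \<le> y"
  have "ennreal_power (ennreal_power x a) (1/a) \<le> ennreal_power y (1 / a)"
    using a by (intro ennreal_power_mono) auto
  thus "x \<le> ennreal_power y (1 / a)" using a by (simp add: ennreal_power_power)
next
  assume a: "0 < a" "x \<le> ennreal_power y (1 / a)"
  have "ennreal_power x a \<le> ennreal_power (ennreal_power y (1 / a)) a"
    using a by (intro ennreal_power_mono) auto
  thus "ennreal_power x a \<le> y" using a by (simp add: ennreal_power_power)
qed

lemma ennreal_power_measurable [measurable]: "(\<lambda>x. ennreal_power x a) \<in> borel_measurable borel"
  unfolding ennreal_power_def by measurable

text \<open>Both inequalities come from the Galois connection \<open>ennreal_power_le_iff\<close>
  and monotonicity, without any continuity argument.\<close>

lemma ennreal_power_SUP: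
  assumes a: "0 < a"
  shows "ennreal_power (SUP i\<in>I. f i) a = (SUP i\<in>I. ennreal_power (f i) a)"
proof (rule antisym)
  have "(SUP i\<in>I. f i) \<le> ennreal_power (SUP i\<in>I. ennreal_power (f i) a) (1 / a)"
    using a by (intro SUP_least, subst ennreal_power_le_iff[symmetric]) (auto intro: SUP_upper)
  thus "ennreal_power (SUP i\<in>I. f i) a \<le> (SUP i\<in>I. ennreal_power (f i) a)"
    using a by (simp add: ennreal_power_le_iff)
  show "(SUP i\<in>I. ennreal_power (f i) a) \<le> ennreal_power (SUP i\<in>I. f i) a"
    using a by (intro SUP_least ennreal_power_mono SUP_upper) auto
qed

lemma ennreal_power_eq_0: "0 < a \<Longrightarrow> ennreal_power x a = 0 \<longleftrightarrow> x = 0"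
  by (cases x) (auto simp: ennreal_power_ennreal ennreal_power_top)

lemma ennreal_power_lt_top: "0 \<le> a \<Longrightarrow> ennreal_power x a < top \<longleftrightarrow> x < top \<or> a = 0"
  by (cases "a = 0"; cases x) (auto simp: ennreal_power_ennreal ennreal_power_top)

section \<open>Maximal functions over nested families of sets\<close>

definition nested :: "'a set set \<Rightarrow> bool" where
  "nested D \<longleftrightarrow> (\<forall>P\<in>D. \<forall>Q\<in>D. P \<inter> Q = {} \<or> P \<subseteq> Q \<or> Q \<subseteq> P)"

lemma nested_subset: "nested D \<Longrightarrow> E \<subseteq> D \<Longrightarrow> nested E"
  unfolding nested_def by blast

text \<open>The inclusion-maximal members do it: two of them can only be disjoint or equal, and
  finiteness puts every member below a maximal one.\<close>

lemma nested_disjoint_cover: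
  assumes "finite D" "nested D"
  obtains E where "E \<subseteq> D" "disjoint E" "\<Union>E = \<Union>D"
proof
  let ?E = "{P\<in>D. \<forall>Q\<in>D. \<not> P \<subset> Q}"
  show "?E \<subseteq> D" by auto
  show "disjoint ?E"
  proof (rule disjointI)
    fix P Q assume PQ: "P \<in> ?E" "Q \<in> ?E" "P \<noteq> Q"
    then have "P \<inter> Q = {} \<or> P \<subseteq> Q \<or> Q \<subseteq> P" using assms(2) unfolding nested_def by simp
    then show "P \<inter> Q = {}" using PQ by auto
  qed
  show "\<Union>?E = \<Union>D"
  proof (intro equalityI Union_least)
    fix P assume "P \<in> D"
    then obtain Q where "Q \<in> D" "P \<subseteq> Q" "\<forall>R\<in>D. Q \<subseteq> R \<longrightarrow> Q = R"
      using finite_has_maximal2[OF assms(1) \<open>P \<in> D\<close>] by blast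
    thus "P \<subseteq> \<Union>?E" by blast
  qed auto
qed

definition set_average :: "'a measure \<Rightarrow> ('a \<Rightarrow> ennreal) \<Rightarrow> 'a set \<Rightarrow> ennreal" where
  "set_average M f Q = (\<integral>\<^sup>+x\<in>Q. f x \<partial>M) / emeasure M Q"

definition maximal :: "'a measure \<Rightarrow> 'a set set \<Rightarrow> ('a \<Rightarrow> ennreal) \<Rightarrow> 'a \<Rightarrow> ennreal" where
  "maximal M D f x = (SUP Q\<in>D. set_average M f Q * indicator Q x)"

lemma maximal_measurable [measurable]:
  assumes "countable D" "D \<subseteq> sets M"
  shows "maximal M D f \<in> borel_measurable M"
proof -
  have "\<And>Q. Q \<in> D \<Longrightarrow> (\<lambda>x. set_average M f Q * indicator Q x) \<in> borel_measurable M"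
    using assms(2) by auto
  then show ?thesis using assms(1) unfolding maximal_def by (intro borel_measurable_SUP) auto
qed

lemma maximal_upper: "Q \<in> D \<Longrightarrow> x \<in> Q \<Longrightarrow> set_average M f Q \<le> maximal M D f x"
  unfolding maximal_def by (rule SUP_upper2) auto

text \<open>The level set is the union of the members whose average exceeds t. Nestedness lets a
  disjoint subfamily cover the same union, so no covering constant appears.\<close>

lemma maximal_weak_type:
  assumes fin: "finite D" and D: "nested D" "D \<subseteq> sets M"
    and f [measurable]: "f \<in> borel_measurable M"
  shows "t * emeasure M {x\<in>space M. t < maximal M D f x}
    \<le> (\<integral>\<^sup>+x\<in>{x\<in>space M. t < maximal M D f x}. f x \<partial>M)"
proof -
  let ?D = "{Q\<in>D. t < set_average M f Q}"
  have eq: "{x\<in>space M. t < maximal M D f x} = \<Union>?D"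
  proof (intro equalityI subsetI)
    fix x assume "x \<in> {x\<in>space M. t < maximal M D f x}"
    then obtain Q where "Q \<in> D" "t < set_average M f Q * indicator Q x"
      unfolding maximal_def by (auto simp: less_SUP_iff)
    then show "x \<in> \<Union>?D" by (cases "x \<in> Q") auto
  next
    fix x assume "x \<in> \<Union>?D"
    then obtain Q where Q: "Q \<in> D" "t < set_average M f Q" "x \<in> Q" by auto
    moreover have "x \<in> space M" using Q D(2) sets.sets_into_space by blast
    ultimately show "x \<in> {x\<in>space M. t < maximal M D f x}"
      using maximal_upper[of Q D x M f] by auto
  qed
  obtain E where E: "E \<subseteq> ?D" "disjoint E" "\<Union>E = \<Union>?D"
    using nested_disjoint_cover[of ?D] fin nested_subset[OF D(1), of ?D] by auto
  have finE: "finite E" using E(1) fin by (auto intro: finite_subset)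
  have ES: "E \<subseteq> sets M" using E D by auto
  have disj: "disjoint_family_on (\<lambda>Q. Q) E"
    using E(2) by (auto simp: disjoint_family_on_def disjoint_def)
  have "t * emeasure M (\<Union>E) = (\<Sum>Q\<in>E. t * emeasure M Q)"
    using sum_emeasure[of "\<lambda>Q. Q" E M] disj finE ES by (simp flip: sum_distrib_left)
  also have "\<dots> \<le> (\<Sum>Q\<in>E. \<integral>\<^sup>+x\<in>Q. f x \<partial>M)"
  proof (rule sum_mono)
    fix Q assume "Q \<in> E"
    then have a: "t < set_average M f Q" using E by auto
    show "t * emeasure M Q \<le> (\<integral>\<^sup>+x\<in>Q. f x \<partial>M)"
    \<comment> \<open>A set of infinite measure has average 0 by the division convention and cannot
      have been selected; for a null set the left-hand side is 0.\<close>
    proof (cases "emeasure M Q = 0 \<or> emeasure M Q = top")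
      case True
      then show ?thesis
        using a unfolding set_average_def by (auto simp: ennreal_divide_top)
    next
      case False
      have "t * emeasure M Q \<le> set_average M f Q * emeasure M Q"
        using a by (intro mult_right_mono) auto
      also have "\<dots> = (\<integral>\<^sup>+x\<in>Q. f x \<partial>M)"
        using False unfolding set_average_def
        by (simp add: ennreal_divide_times ennreal_divide_self less_top)
      finally show ?thesis .
    qed
  qed
  also have "\<dots> = (\<integral>\<^sup>+x. (\<Sum>Q\<in>E. f x * indicator Q x) \<partial>M)"
    using ES by (intro nn_integral_sum[symmetric]) auto
  also have "\<dots> = (\<integral>\<^sup>+x\<in>(\<Union>E). f x \<partial>M)"
  proof (rule nn_integral_cong)
    fix x
    show "(\<Sum>Q\<in>E. f x * indicator Q x) = f x * indicator (\<Union>E) x"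
    proof (cases "x \<in> \<Union>E")
      case True
      then obtain P where P: "P \<in> E" "x \<in> P" by auto
      have "(\<Sum>Q\<in>E. f x * indicator Q x) = (\<Sum>Q\<in>E. if Q = P then f x else 0)"
        using P E(2) by (intro sum.cong) (auto simp: disjoint_def indicator_def)
      then show ?thesis using P finE True by simp
    qed (auto simp: indicator_def intro!: sum.neutral)
  qed
  finally show ?thesis using E(3) eq by simp
qed

section \<open>From weak type to strong type by summing over dyadic levels\<close>

lemma sum_levels_le:
  fixes a s y :: real
  assumes a: "0 < a" and s: "0 < s" and y: "0 \<le> y"
  defines "C \<equiv> 1 / (1 - 2 powr (- s))"
  shows "(\<Sum>j<n. if a * 2 ^ j < y then (a * 2 ^ j) powr s else 0) \<le> C * y powr s"
proof -
  have q: "2 powr (-s) < (1::real)" using s by (simp add: powr_less_one)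
  have C: "0 < C" "C * 2 powr (-s) + 1 = C" using q s unfolding C_def by (simp_all add: divide_simps)
  \<comment> \<open>The bound is strengthened for the induction: a * 2 ^ n / 2 is the highest level
    summed so far. The constant is the fixed point of C * 2 powr (-s) + 1 = C, so a new level is
    absorbed exactly.\<close>
  have "(\<Sum>j<n. if a * 2 ^ j < y then (a * 2 ^ j) powr s else 0) \<le> C * min y (a * 2 ^ n / 2) powr s"
  proof (induction n)
    case 0
    then show ?case using C by simp
  next
    case (Suc n)
    show ?case
    proof (cases "a * 2 ^ n < y")
      case True
      have "(\<Sum>j<Suc n. if a * 2 ^ j < y then (a * 2 ^ j) powr s else 0)
        \<le> C * (a * 2 ^ n / 2) powr s + (a * 2 ^ n) powr s"
      proof -
        have "C * min y (a * 2 ^ n / 2) powr s \<le> C * (a * 2 ^ n / 2) powr s"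
          using C y a s by (intro mult_left_mono powr_mono2) auto
        then show ?thesis using Suc True by simp
      qed
      also have "\<dots> = (C * 2 powr (-s) + 1) * (a * 2 ^ n) powr s"
        using a by (simp add: powr_divide powr_minus field_simps)
      also have "\<dots> = C * min y (a * 2 ^ Suc n / 2) powr s" using C(2) True by simp
      finally show ?thesis .
    next
      case False
      have "0 < a * 2 ^ n" using a by simp
      then have "C * min y (a * 2 ^ n / 2) powr s \<le> C * min y (a * 2 ^ Suc n / 2) powr s"
        using C y a s by (intro mult_left_mono powr_mono2) (auto simp: min_le_iff_disj)
      then show ?thesis using Suc False by simp
    qed
  qed
  also have "\<dots> \<le> C * y powr s"
    using C y a s by (intro mult_left_mono powr_mono2) auto
  finally show ?thesis .
qed

text \<open>The part of f below t / 2 contributes at most half of the left-hand side and is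
  subtracted. The subtraction needs a level set of finite measure, which holds because it is covered
  by finitely many sets of finite measure.\<close>

lemma maximal_weak_type_truncated:
  assumes fin: "finite D" and D: "nested D" "D \<subseteq> sets M" "\<And>Q. Q \<in> D \<Longrightarrow> emeasure M Q < top"
    and f [measurable]: "f \<in> borel_measurable M" and t: "0 < t"
  shows "ennreal t * emeasure M {x\<in>space M. ennreal t < maximal M D f x}
    \<le> 2 * (\<integral>\<^sup>+x\<in>{x\<in>space M. ennreal t < 2 * f x}. f x \<partial>M)"
proof -
  let ?E = "{x\<in>space M. ennreal t < maximal M D f x}"
  let ?A = "\<integral>\<^sup>+x\<in>{x\<in>space M. ennreal t < 2 * f x}. f x \<partial>M"
  note [measurable] = maximal_measurable[OF countable_finite[OF fin] D(2)]
  have E: "?E \<in> sets M" by measurable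
  have "?E \<subseteq> \<Union>D"
  proof
    fix x assume "x \<in> ?E"
    then obtain Q where "Q \<in> D" "ennreal t < set_average M f Q * indicator Q x"
      unfolding maximal_def by (auto simp: less_SUP_iff)
    then show "x \<in> \<Union>D" by (cases "x \<in> Q") auto
  qed
  then have "emeasure M ?E \<le> emeasure M (\<Union>D)"
    using D(2) fin by (intro emeasure_mono sets.finite_Union) auto
  also have "\<dots> = emeasure M (\<Union>Q\<in>D. Q)" by simp
  also have "\<dots> \<le> (\<Sum>Q\<in>D. emeasure M Q)"
    using D(2) fin by (intro emeasure_subadditive_finite) auto
  also have "\<dots> < top" using D(3) fin by simp
  finally have Efin: "emeasure M ?E < top" .
  have "ennreal t * emeasure M ?E \<le> (\<integral>\<^sup>+x\<in>?E. f x \<partial>M)"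
    by (rule maximal_weak_type[OF fin D(1,2) f])
  also have "\<dots> \<le> (\<integral>\<^sup>+x. f x * indicator {x\<in>space M. ennreal t < 2 * f x} x + ennreal (t / 2) * indicator ?E x \<partial>M)"
  proof (rule nn_integral_mono)
    fix x assume x: "x \<in> space M"
    show "f x * indicator ?E x \<le> f x * indicator {x\<in>space M. ennreal t < 2 * f x} x + ennreal (t / 2) * indicator ?E x"
    proof (cases "x \<in> ?E \<and> \<not> ennreal t < 2 * f x")
      case True
      then have "f x \<le> ennreal (t / 2)"
        using t by (cases "f x") (auto simp: not_less ennreal_mult[symmetric] ennreal_mult_top simp flip: ennreal_numeral)
      then show ?thesis using True by auto
    qed (use x in \<open>auto simp: indicator_def\<close>)
  qed
  also have "\<dots> = ?A + ennreal (t / 2) * emeasure M ?E"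
    using E by (simp add: nn_integral_add nn_integral_cmult)
  finally have le: "ennreal t * emeasure M ?E \<le> ?A + ennreal (t / 2) * emeasure M ?E" .
  obtain e where e: "0 \<le> e" "emeasure M ?E = ennreal e" using Efin by (cases "emeasure M ?E") auto
  show ?thesis
  proof (cases "?A = top")
    case False
    then obtain A where A: "0 \<le> A" "?A = ennreal A" by (cases ?A) auto
    have "ennreal (t * e) \<le> ennreal (A + t / 2 * e)"
      using le e A t by (simp flip: ennreal_mult ennreal_plus)
    then have "t * e \<le> A + t / 2 * e" using A e t by (subst (asm) ennreal_le_iff) auto
    then have "t * e \<le> 2 * A" by (simp add: field_simps)
    then show ?thesis using e A t by (simp flip: ennreal_mult ennreal_numeral)
  qed (simp add: ennreal_mult_top)
qed

text \<open>The numerator collects 2 from the truncated weak type bound, 2 powr q from rounding to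
  dyadic levels and 2 powr (q - 1) from the threshold t < 2 f; the denominator is the geometric sum
  of \<open>sum_levels_le\<close> with exponent q - 1. For nested families the inequality is Doob's
  maximal inequality.\<close>

definition doob_const :: "real \<Rightarrow> real" where
  "doob_const q = 4 powr q / (1 - 2 powr (1 - q))"

lemma doob_const_pos: "1 < q \<Longrightarrow> 0 < doob_const q"
  unfolding doob_const_def by (simp add: powr_less_one)

lemma ennreal_le_suminf: "f i \<le> (\<Sum>j. f j :: ennreal)"
  using sum_le_suminf[of f "{i}"] by simp

text \<open>A discrete layer-cake argument: the truncated weak type bound is multiplied by the (q -
  1)-st power of the level and summed over the levels a * 2 ^ j.\<close>

lemma maximal_strong_finite:
  assumes fin: "finite D" and D: "nested D" "D \<subseteq> sets M" "\<And>Q. Q \<in> D \<Longrightarrow> emeasure M Q < top"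
    and f [measurable]: "f \<in> borel_measurable M" and q: "1 < q"
  shows "(\<integral>\<^sup>+x. ennreal_power (maximal M D f x) q \<partial>M)
    \<le> ennreal (doob_const q) * (\<integral>\<^sup>+x. ennreal_power (f x) q \<partial>M)"
proof -
  let ?M = "maximal M D f"
  let ?R = "ennreal (doob_const q) * (\<integral>\<^sup>+x. ennreal_power (f x) q \<partial>M)"
  note [measurable] = maximal_measurable[OF countable_finite[OF fin] D(2)]
  \<comment> \<open>Cutting off at the height a gives the levels a lowest member, so that they are
    indexed by natural numbers; afterwards a runs through 1 / (m + 1) and monotone convergence
    removes the cut.\<close>
  have *: "(\<integral>\<^sup>+x. ennreal_power (?M x) q * indicator {x. ennreal a < ?M x} x \<partial>M) \<le> ?R" if a: "0 < a" for a
  proof -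
    define t where "t j = a * 2 ^ j" for j :: nat
    have t: "0 < t j" for j using a by (simp add: t_def)
    let ?E = "\<lambda>j. {x\<in>space M. ennreal (t j) < ?M x}"
    let ?G = "\<lambda>j. {x\<in>space M. ennreal (t j) < 2 * f x}"
    have "(\<integral>\<^sup>+x. ennreal_power (?M x) q * indicator {x. ennreal a < ?M x} x \<partial>M)
      \<le> (\<integral>\<^sup>+x. (\<Sum>j. ennreal (2 powr q * t j powr q) * indicator (?E j) x) \<partial>M)"
    proof (rule nn_integral_mono)
      fix x assume x: "x \<in> space M"
      show "ennreal_power (?M x) q * indicator {x. ennreal a < ?M x} x
        \<le> (\<Sum>j. ennreal (2 powr q * t j powr q) * indicator (?E j) x)"
      proof (cases "?M x")
        case top
        have "ennreal b \<le> (\<Sum>j. ennreal (2 powr q * t j powr q) * indicator (?E j) x)" for b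
        proof -
          obtain j where "max b 1 / a < 2 ^ j" using real_arch_pow[of 2 "max b 1 / a"] by auto
          then have j: "max b 1 \<le> t j" using a by (simp add: t_def field_simps)
          have "b \<le> t j powr 1" using j by simp
          also have "\<dots> \<le> t j powr q" using j q by (intro powr_mono) auto
          also have "\<dots> \<le> 2 powr q * t j powr q" using q by (simp add: ge_one_powr_ge_zero mult_le_cancel_right1)
          finally have "ennreal b \<le> ennreal (2 powr q * t j powr q) * indicator (?E j) x"
            using top x by (simp add: ennreal_leI)
          also have "\<dots> \<le> (\<Sum>j. ennreal (2 powr q * t j powr q) * indicator (?E j) x)"
            by (rule ennreal_le_suminf)
          finally show ?thesis .
        qed
        note le = this
        have "(\<Sum>j. ennreal (2 powr q * t j powr q) * indicator (?E j) x) = top"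
        proof (cases "\<Sum>j. ennreal (2 powr q * t j powr q) * indicator (?E j) x")
          case (real c)
          then show ?thesis using le[of "c + 1"] by simp
        qed
        then show ?thesis by simp
      next
        case (real m)
        show ?thesis
        proof (cases "a < m")
          case False
          then show ?thesis using real by (simp add: indicator_def ennreal_less_iff less_imp_le[OF a])
        next
          case True
          obtain j where "m / a < 2 ^ j" using real_arch_pow[of 2 "m / a"] by auto
          then have ex: "\<exists>j. m \<le> t j" using a by (intro exI[of _ j]) (simp add: t_def field_simps)
          \<comment> \<open>The predecessor of this least index is the level just below m, whence t
            j < m and m \<le> 2 * t j.\<close>
          define k where "k = (LEAST j. m \<le> t j)"
          have k: "m \<le> t k" unfolding k_def using ex by (rule LeastI_ex)
          have "k \<noteq> 0" using k True by (cases k) (auto simp: t_def)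
          then obtain j where j: "k = Suc j" by (cases k) auto
          have mj: "t j < m" using not_less_Least[of j "\<lambda>j. m \<le> t j"] j unfolding k_def by simp
          have "m powr q \<le> (2 * t j) powr q" using k j real q by (intro powr_mono2) (auto simp: t_def)
          also have "\<dots> = 2 powr q * t j powr q" using t[of j] by (simp add: powr_mult)
          finally have "ennreal_power (?M x) q \<le> ennreal (2 powr q * t j powr q) * indicator (?E j) x"
            using real mj x q by (simp add: ennreal_power_ennreal ennreal_less_iff less_imp_le[OF t])
          also have "\<dots> \<le> (\<Sum>j. ennreal (2 powr q * t j powr q) * indicator (?E j) x)"
            by (rule ennreal_le_suminf)
          finally show ?thesis by (auto simp: indicator_def)
        qed
      qed
    qed
    also have "\<dots> = (\<Sum>j. ennreal (2 powr q * t j powr q) * emeasure M (?E j))"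
      by (subst nn_integral_suminf) (auto simp: nn_integral_cmult_indicator)
    also have "\<dots> \<le> (\<Sum>j. ennreal (2 * 2 powr q * t j powr (q - 1)) * (\<integral>\<^sup>+x\<in>?G j. f x \<partial>M))"
    proof (intro suminf_le allI)
      fix j
      have "t j powr q = t j powr (q - 1) * t j" using t[of j] by (simp add: powr_diff)
      then have "ennreal (2 powr q * t j powr q) = ennreal (2 powr q * t j powr (q - 1)) * ennreal (t j)"
        using t[of j] by (simp flip: ennreal_mult)
      then have "ennreal (2 powr q * t j powr q) * emeasure M (?E j)
        = ennreal (2 powr q * t j powr (q - 1)) * (ennreal (t j) * emeasure M (?E j))"
        by (simp only: mult.assoc)
      also have "\<dots> \<le> ennreal (2 powr q * t j powr (q - 1)) * (2 * (\<integral>\<^sup>+x\<in>?G j. f x \<partial>M))"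
        by (intro mult_left_mono maximal_weak_type_truncated fin D f t) auto
      also have "\<dots> = ennreal (2 * 2 powr q * t j powr (q - 1)) * (\<integral>\<^sup>+x\<in>?G j. f x \<partial>M)"
        by (simp add: ennreal_mult mult_ac)
      finally show "ennreal (2 powr q * t j powr q) * emeasure M (?E j) \<le> \<dots>" .
    qed auto
    also have "\<dots> = (\<integral>\<^sup>+x. (\<Sum>j. ennreal (2 * 2 powr q * t j powr (q - 1)) * (f x * indicator (?G j) x)) \<partial>M)"
      by (subst nn_integral_suminf) (auto simp: nn_integral_cmult)
    also have "\<dots> \<le> (\<integral>\<^sup>+x. ennreal (doob_const q) * ennreal_power (f x) q \<partial>M)"
    proof (rule nn_integral_mono)
      fix x assume x: "x \<in> space M"
      show "(\<Sum>j. ennreal (2 * 2 powr q * t j powr (q - 1)) * (f x * indicator (?G j) x))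
        \<le> ennreal (doob_const q) * ennreal_power (f x) q"
      proof (cases "f x")
        case top
        then show ?thesis using doob_const_pos[OF q] q by (simp add: ennreal_power_top ennreal_mult_top)
      next
        case (real y)
        have "(\<Sum>j<n. ennreal (2 * 2 powr q * t j powr (q - 1)) * (f x * indicator (?G j) x))
          \<le> ennreal (doob_const q) * ennreal_power (f x) q" for n
        proof -
          have "(\<Sum>j<n. ennreal (2 * 2 powr q * t j powr (q - 1)) * (f x * indicator (?G j) x))
            = (\<Sum>j<n. ennreal (2 * 2 powr q * y * (if t j < 2 * y then t j powr (q - 1) else 0)))"
          proof (rule sum.cong[OF refl])
            fix j
            have "2 * ennreal y = ennreal (2 * y)" using real by (simp add: ennreal_mult)
            then show "ennreal (2 * 2 powr q * t j powr (q - 1)) * (f x * indicator (?G j) x)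
              = ennreal (2 * 2 powr q * y * (if t j < 2 * y then t j powr (q - 1) else 0))"
              using real x t[of j] by (auto simp: indicator_def ennreal_less_iff mult_ac simp flip: ennreal_mult)
          qed
          also have "\<dots> = ennreal (2 * 2 powr q * y * (\<Sum>j<n. if t j < 2 * y then t j powr (q - 1) else 0))"
            using real by (subst sum_ennreal) (auto simp: sum_distrib_left)
          also have "\<dots> \<le> ennreal (2 * 2 powr q * y * (1 / (1 - 2 powr (- (q - 1))) * (2 * y) powr (q - 1)))"
            unfolding t_def using real a q by (intro ennreal_leI mult_left_mono sum_levels_le) auto
          also have "2 * 2 powr q * y * (1 / (1 - 2 powr (- (q - 1))) * (2 * y) powr (q - 1)) = doob_const q * y powr q"
          proof (cases "y = 0")
            case False
            have "4 powr q = (2::real) powr q * 2 powr q" by (simp flip: powr_mult)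
            moreover have "2 * y * (2 * y) powr (q - 1) = 2 powr q * y powr q"
              using real False by (simp add: powr_mult powr_diff)
            ultimately show ?thesis unfolding doob_const_def
              by (simp add: mult_ac)
          qed simp
          also have "ennreal \<dots> = ennreal (doob_const q) * ennreal_power (f x) q"
            using real q doob_const_pos[OF q] by (simp add: ennreal_power_ennreal ennreal_mult)
          finally show ?thesis .
        qed
        then show ?thesis by (intro suminf_le_const) auto
      qed
    qed
    also have "\<dots> = ?R" by (rule nn_integral_cmult) measurable
    finally show ?thesis .
  qed
  have "(\<integral>\<^sup>+x. ennreal_power (?M x) q \<partial>M)
    = (\<integral>\<^sup>+x. (SUP m. ennreal_power (?M x) q * indicator {x. ennreal (1 / real (Suc m)) < ?M x} x) \<partial>M)"
  proof (rule nn_integral_cong)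
    fix x
    show "ennreal_power (?M x) q = (SUP m. ennreal_power (?M x) q * indicator {x. ennreal (1 / real (Suc m)) < ?M x} x)"
    proof (cases "?M x = 0")
      case True
      then show ?thesis using q by simp
    next
      case False
      obtain m where "ennreal (1 / real (Suc m)) < ?M x"
      proof (cases "?M x")
        case (real r)
        then obtain m where "1 / real (Suc m) < r"
          using False nat_approx_posE[of r] by (auto simp: less_le)
        then show ?thesis using real that[of m] by (simp add: ennreal_less_iff)
      qed (use that[of 0] in auto)
      then have "ennreal_power (?M x) q \<le> (SUP m. ennreal_power (?M x) q * indicator {x. ennreal (1 / real (Suc m)) < ?M x} x)"
        by (intro SUP_upper2[of m]) auto
      then show ?thesis
        by (intro antisym SUP_least) (auto simp: indicator_def)
    qed
  qed
  also have "\<dots> = (SUP m. \<integral>\<^sup>+x. ennreal_power (?M x) q * indicator {x. ennreal (1 / real (Suc m)) < ?M x} x \<partial>M)"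
  proof (rule nn_integral_monotone_convergence_SUP)
    show "incseq (\<lambda>m x. ennreal_power (?M x) q * indicator {x. ennreal (1 / real (Suc m)) < ?M x} x)"
    proof (intro incseq_SucI le_funI mult_left_mono)
      fix m x
      have "ennreal (1 / real (Suc (Suc m))) \<le> ennreal (1 / real (Suc m))"
        by (intro ennreal_leI) (simp add: field_simps)
      from le_less_trans[OF this, of "?M x"]
      show "indicator {x. ennreal (1 / real (Suc m)) < ?M x} x \<le> (indicator {x. ennreal (1 / real (Suc (Suc m))) < ?M x} x :: ennreal)"
        by (auto simp: indicator_def)
    qed auto
  qed measurable
  also have "\<dots> \<le> ?R" by (intro SUP_least *) auto
  finally show ?thesis .
qed

lemma maximal_mono_family: "D \<subseteq> E \<Longrightarrow> maximal M D f x \<le> maximal M E f x"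
  unfolding maximal_def by (rule SUP_subset_mono) auto

text \<open>The constant for finite families does not depend on the family, so a countable family is
  exhausted by finite ones.\<close>

theorem maximal_strong:
  assumes D: "countable D" "nested D" "D \<subseteq> sets M" "\<And>Q. Q \<in> D \<Longrightarrow> emeasure M Q < top"
    and f [measurable]: "f \<in> borel_measurable M" and q: "1 < q"
  shows "(\<integral>\<^sup>+x. ennreal_power (maximal M D f x) q \<partial>M)
    \<le> ennreal (doob_const q) * (\<integral>\<^sup>+x. ennreal_power (f x) q \<partial>M)"
proof (cases "D = {}")
  case True
  then show ?thesis using q by (simp add: maximal_def bot_ennreal)
next
  case False
  define E where "E n = from_nat_into D ` {..n}" for n
  have E: "finite (E n)" "E n \<subseteq> D" for n
    using from_nat_into[OF False] by (auto simp: E_def)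
  have U: "D = (\<Union>n. E n)"
  proof -
    have "(\<Union>n. E n) = range (from_nat_into D)" unfolding E_def by auto
    then show ?thesis using range_from_nat_into[OF False D(1)] by simp
  qed
  have "maximal M D f x = (SUP n. maximal M (E n) f x)" for x
    unfolding maximal_def U by (rule SUP_UNION)
  then have "(\<integral>\<^sup>+x. ennreal_power (maximal M D f x) q \<partial>M)
    = (\<integral>\<^sup>+x. (SUP n. ennreal_power (maximal M (E n) f x) q) \<partial>M)"
    using q by (simp add: ennreal_power_SUP)
  also have "\<dots> = (SUP n. \<integral>\<^sup>+x. ennreal_power (maximal M (E n) f x) q \<partial>M)"
  proof (rule nn_integral_monotone_convergence_SUP)
    show "incseq (\<lambda>n x. ennreal_power (maximal M (E n) f x) q)"
      using q by (intro incseq_SucI le_funI ennreal_power_mono maximal_mono_family) (auto simp: E_def)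
    show "(\<lambda>x. ennreal_power (maximal M (E n) f x) q) \<in> borel_measurable M" for n
      using E[of n] D
      by (intro measurable_compose[OF maximal_measurable ennreal_power_measurable] countable_finite) auto
  qed
  also have "\<dots> \<le> ennreal (doob_const q) * (\<integral>\<^sup>+x. ennreal_power (f x) q \<partial>M)"
  proof (rule SUP_least)
    fix n
    show "(\<integral>\<^sup>+x. ennreal_power (maximal M (E n) f x) q \<partial>M)
      \<le> ennreal (doob_const q) * (\<integral>\<^sup>+x. ennreal_power (f x) q \<partial>M)"
      by (rule maximal_strong_finite[OF E(1) nested_subset[OF D(2) E(2)]]) (use E(2) D f q in blast)+
  qed
  finally show ?thesis .
qed

section \<open>Weighted bounds and the Rubio de Francia algorithm\<close>

lemma set_average_mono:
  "(\<And>x. x \<in> Q \<Longrightarrow> f x \<le> g x) \<Longrightarrow> set_average M f Q \<le> set_average M g Q"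
  unfolding set_average_def
  by (intro divide_right_mono_ennreal nn_integral_mono) (auto simp: indicator_def)

text \<open>With s = w^(1-p'), the A_p condition bounds the (p-1)-st power of the average of f over
  Q by K times the w-average over Q of k = G^(p-1) / w, where G is the maximal function of f / s for
  s dx. So the maximal function is dominated pointwise by a composition of maximal functions for w
  dx and s dx, and their constants do not see the measure. The identities (p - 1) p' = p and w
  w^(-p') = s make the exponents match.\<close>

theorem maximal_weighted_strong:
  fixes w s :: "'a \<Rightarrow> ennreal"
  assumes D: "countable D" "nested D" "D \<subseteq> sets M" "\<And>Q. Q \<in> D \<Longrightarrow> 0 < emeasure M Q \<and> emeasure M Q < top"
    and w [measurable]: "w \<in> borel_measurable M" and s [measurable]: "s \<in> borel_measurable M"
    and ws: "AE x in M. 0 < w x \<and> w x < top \<and> s x = ennreal_power (w x) (- 1 / (p - 1))"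
    and p: "1 < p" and K: "0 < K"
    and Ap: "\<And>Q. Q \<in> D \<Longrightarrow>
      (\<integral>\<^sup>+x\<in>Q. w x \<partial>M) * ennreal_power (\<integral>\<^sup>+x\<in>Q. s x \<partial>M) (p - 1) \<le> ennreal K * ennreal_power (emeasure M Q) p"
    and f [measurable]: "f \<in> borel_measurable M"
  shows "(\<integral>\<^sup>+x. ennreal_power (maximal M D f x) p * w x \<partial>M)
    \<le> ennreal (K powr (p / (p - 1)) * doob_const (p / (p - 1)) * doob_const p) * (\<integral>\<^sup>+x. ennreal_power (f x) p * w x \<partial>M)"
proof -
  define p' where "p' = p / (p - 1)"
  have p': "1 < p'" "(p - 1) * p' = p" "1 - p' = - 1 / (p - 1)" using p by (auto simp: p'_def field_simps)
  let ?Mw = "density M w" and ?Ms = "density M s"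
  define h where "h x = f x / s x" for x
  define G where "G = maximal ?Ms D h"
  define k where "k x = ennreal_power (G x) (p - 1) / w x" for x
  define N where "N = maximal ?Mw D k"
  have [measurable]: "h \<in> borel_measurable M" unfolding h_def by measurable
  have [measurable]: "G \<in> borel_measurable M"
    using maximal_measurable[of D ?Ms h] D unfolding G_def by simp
  have [measurable]: "k \<in> borel_measurable M" unfolding k_def by measurable
  have [measurable]: "N \<in> borel_measurable M"
    using maximal_measurable[of D ?Mw k] D unfolding N_def by simp
  have [measurable]: "maximal M D f \<in> borel_measurable M" using D by measurable
  have pos: "AE x in M. 0 < s x \<and> s x < top"
    using ws
  proof eventually_elim
    fix x assume x: "0 < w x \<and> w x < top \<and> s x = ennreal_power (w x) (- 1 / (p - 1))"
    then obtain r where "0 < r" "w x = ennreal r" by (cases "w x") auto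
    then show "0 < s x \<and> s x < top" using x by (simp add: ennreal_power_ennreal_pos)
  qed
  have fin: "0 < (\<integral>\<^sup>+x\<in>Q. w x \<partial>M)" "0 < (\<integral>\<^sup>+x\<in>Q. s x \<partial>M)"
    "(\<integral>\<^sup>+x\<in>Q. w x \<partial>M) < top" "(\<integral>\<^sup>+x\<in>Q. s x \<partial>M) < top" if Q: "Q \<in> D" for Q
  proof -
    have [measurable]: "Q \<in> sets M" using Q D by auto
    have *: "0 < (\<integral>\<^sup>+x\<in>Q. u x \<partial>M)" if [measurable]: "u \<in> borel_measurable M" and "AE x in M. 0 < u x" for u :: "'a \<Rightarrow> ennreal"
    proof (rule ccontr)
      assume "\<not> 0 < (\<integral>\<^sup>+x\<in>Q. u x \<partial>M)"
      then have "AE x in M. u x * indicator Q x = 0" by (simp add: nn_integral_0_iff_AE)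
      then have "AE x in M. x \<notin> Q" using that(2) by eventually_elim (auto simp: indicator_def split: if_splits)
      then have "emeasure M Q = 0" by (subst (asm) AE_iff_measurable[of Q]) (use sets.sets_into_space[of Q M] in auto)
      then show False using D(4)[OF Q] by simp
    qed
    show w0: "0 < (\<integral>\<^sup>+x\<in>Q. w x \<partial>M)" using ws by (intro * w) auto
    show s0: "0 < (\<integral>\<^sup>+x\<in>Q. s x \<partial>M)" using pos by (intro * s) auto
    \<comment> \<open>The product in the A_p condition is finite and both factors are positive,
      hence both are finite.\<close>
    have "ennreal K * ennreal_power (emeasure M Q) p < top"
      using D(4)[OF Q] p by (auto simp: ennreal_mult_less_top ennreal_power_lt_top)
    then have "(\<integral>\<^sup>+x\<in>Q. w x \<partial>M) * ennreal_power (\<integral>\<^sup>+x\<in>Q. s x \<partial>M) (p - 1) < top"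
      using Ap[OF Q] by (rule le_less_trans[rotated])
    then show "(\<integral>\<^sup>+x\<in>Q. w x \<partial>M) < top" "(\<integral>\<^sup>+x\<in>Q. s x \<partial>M) < top"
      using w0 s0 p by (auto simp: ennreal_mult_less_top ennreal_power_lt_top ennreal_power_eq_0)
  qed
  have fh: "AE x in M. f x = s x * h x"
    using pos by eventually_elim (simp add: h_def ennreal_times_divide mult_divide_eq_ennreal zero_less_iff_neq_zero less_top mult.commute[of "s _"])
  have kG: "AE x in M. w x * k x = ennreal_power (G x) (p - 1)"
    using ws by eventually_elim (simp add: k_def ennreal_times_divide mult_divide_eq_ennreal zero_less_iff_neq_zero less_top mult.commute[of "w _"])
  \<comment> \<open>On Q the function G is at least the s-average of f / s, which is the integral of
    f over Q divided by s(Q); integrating its (p-1)-st power over Q and inserting the A_p condition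
    gives the claim.\<close>
  have step: "ennreal_power (set_average M f Q) (p - 1) \<le> ennreal K * set_average ?Mw k Q" if Q: "Q \<in> D" for Q
  proof -
    have [measurable]: "Q \<in> sets M" using Q D by auto
    define a where "a = (\<integral>\<^sup>+x\<in>Q. f x \<partial>M)"
    define W where "W = enn2real (\<integral>\<^sup>+x\<in>Q. w x \<partial>M)"
    define S where "S = enn2real (\<integral>\<^sup>+x\<in>Q. s x \<partial>M)"
    define m where "m = enn2real (emeasure M Q)"
    have m: "emeasure M Q = ennreal m" "0 < m" using D(4)[OF Q] by (auto simp: m_def enn2real_positive_iff)
    have W: "emeasure ?Mw Q = ennreal W" "(\<integral>\<^sup>+x\<in>Q. w x \<partial>M) = ennreal W" "0 < W"
      using fin[OF Q] by (auto simp: W_def enn2real_positive_iff emeasure_density)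
    have S: "emeasure ?Ms Q = ennreal S" "(\<integral>\<^sup>+x\<in>Q. s x \<partial>M) = ennreal S" "0 < S"
      using fin[OF Q] by (auto simp: S_def enn2real_positive_iff emeasure_density)
    have "a = (\<integral>\<^sup>+x. s x * (h x * indicator Q x) \<partial>M)"
      unfolding a_def by (intro nn_integral_cong_AE, use fh in eventually_elim) (simp add: mult.assoc)
    also have "\<dots> = (\<integral>\<^sup>+x\<in>Q. h x \<partial>?Ms)" by (simp add: nn_integral_density)
    finally have "set_average ?Ms h Q = a / ennreal S" unfolding set_average_def using S by simp
    then have GS: "a / ennreal S \<le> G x" if "x \<in> Q" for x
      using maximal_upper[OF Q that, of ?Ms h] unfolding G_def by simp
    have "(\<integral>\<^sup>+x\<in>Q. k x \<partial>?Mw) = (\<integral>\<^sup>+x\<in>Q. ennreal_power (G x) (p - 1) \<partial>M)"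
      using kG by (subst nn_integral_density) (auto intro!: nn_integral_cong_AE simp: mult.assoc[symmetric])
    also have "\<dots> \<ge> (\<integral>\<^sup>+x\<in>Q. ennreal_power (a / ennreal S) (p - 1) \<partial>M)"
      using GS p by (intro nn_integral_mono) (auto simp: indicator_def intro!: ennreal_power_mono)
    finally have "ennreal_power (a / ennreal S) (p - 1) * ennreal m \<le> (\<integral>\<^sup>+x\<in>Q. k x \<partial>?Mw)"
      using m by (simp add: nn_integral_cmult_indicator)
    then have "ennreal_power (a / ennreal S) (p - 1) * ennreal m / ennreal W \<le> set_average ?Mw k Q"
      unfolding set_average_def W(1) by (rule divide_right_mono_ennreal)
    then have le: "ennreal K * (ennreal_power (a / ennreal S) (p - 1) * ennreal m / ennreal W) \<le> ennreal K * set_average ?Mw k Q"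
      by (rule mult_left_mono) auto
    have "ennreal_power (set_average M f Q) (p - 1) \<le> ennreal K * (ennreal_power (a / ennreal S) (p - 1) * ennreal m / ennreal W)"
    proof (cases a)
      case top
      then show ?thesis using p K m W S by (simp add: ennreal_top_divide ennreal_power_top ennreal_top_mult ennreal_mult_top)
    next
      case (real r)
      have "ennreal (W * S powr (p - 1)) \<le> ennreal (K * m powr p)"
        using Ap[OF Q] m W S p K by (simp add: ennreal_power_ennreal ennreal_mult)
      then have "W * S powr (p - 1) \<le> K * m powr p" using K by (subst (asm) ennreal_le_iff) auto
      moreover have "m powr p = m * m powr (p - 1)" using m by (simp add: powr_diff)
      ultimately have "W * S powr (p - 1) \<le> K * (m * m powr (p - 1))" by simp
      then have "1 / m powr (p - 1) \<le> K * m / (W * S powr (p - 1))"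
        using m W S by (simp add: field_simps)
      then have "r powr (p - 1) * (1 / m powr (p - 1)) \<le> r powr (p - 1) * (K * m / (W * S powr (p - 1)))"
        by (rule mult_left_mono) simp
      then have "(r / m) powr (p - 1) \<le> K * ((r / S) powr (p - 1) * m / W)"
        using m W S real by (simp add: powr_divide field_simps)
      then have "ennreal ((r / m) powr (p - 1)) \<le> ennreal (K * ((r / S) powr (p - 1) * m / W))"
        by (rule ennreal_leI)
      then show ?thesis using m W S K p real unfolding set_average_def a_def[symmetric]
        by (simp add: divide_ennreal ennreal_power_ennreal flip: ennreal_mult)
    qed
    also note le
    finally show ?thesis .
  qed
  have ptw: "ennreal_power (maximal M D f x) p \<le> ennreal (K powr p') * ennreal_power (N x) p'" for x
  proof -
    have "ennreal_power (maximal M D f x) (p - 1) \<le> ennreal K * N x"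
      unfolding maximal_def
    proof (subst ennreal_power_SUP, use p in simp, intro SUP_least)
      fix Q assume Q: "Q \<in> D"
      show "ennreal_power (set_average M f Q * indicator Q x) (p - 1) \<le> ennreal K * N x"
      proof (cases "x \<in> Q")
        case True
        have "ennreal_power (set_average M f Q * indicator Q x) (p - 1) \<le> ennreal K * set_average ?Mw k Q"
          using step[OF Q] True by simp
        also have "\<dots> \<le> ennreal K * N x"
          using maximal_upper[OF Q True] unfolding N_def by (intro mult_left_mono) auto
        finally show ?thesis .
      qed (use p in simp)
    qed
    then have "ennreal_power (ennreal_power (maximal M D f x) (p - 1)) p' \<le> ennreal_power (ennreal K * N x) p'"
      using p' by (intro ennreal_power_mono) auto
    then show ?thesis using p p' K by (simp add: ennreal_power_power ennreal_power_mult ennreal_power_ennreal)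
  qed
  have "(\<integral>\<^sup>+x. ennreal_power (maximal M D f x) p * w x \<partial>M)
    \<le> (\<integral>\<^sup>+x. ennreal (K powr p') * (w x * ennreal_power (N x) p') \<partial>M)"
    using ptw by (intro nn_integral_mono) (auto simp: mult_ac intro!: mult_left_mono order.trans[OF mult_left_mono])
  also have "\<dots> = ennreal (K powr p') * (\<integral>\<^sup>+x. ennreal_power (N x) p' \<partial>?Mw)"
    by (simp add: nn_integral_cmult nn_integral_density)
  also have "\<dots> \<le> ennreal (K powr p') * (ennreal (doob_const p') * (\<integral>\<^sup>+x. ennreal_power (k x) p' \<partial>?Mw))"
    unfolding N_def using D fin p'
    by (intro mult_left_mono maximal_strong) (auto simp: emeasure_density subset_iff)
  also have "(\<integral>\<^sup>+x. ennreal_power (k x) p' \<partial>?Mw) = (\<integral>\<^sup>+x. w x * ennreal_power (k x) p' \<partial>M)"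
    by (simp add: nn_integral_density)
  also have "\<dots> = (\<integral>\<^sup>+x. s x * ennreal_power (G x) p \<partial>M)"
  proof (rule nn_integral_cong_AE, use ws in eventually_elim)
    fix x assume x: "0 < w x \<and> w x < top \<and> s x = ennreal_power (w x) (- 1 / (p - 1))"
    then obtain r where r: "0 < r" "w x = ennreal r" by (cases "w x") auto
    have "k x = ennreal_power (G x) (p - 1) * ennreal (1 / r)"
      using r unfolding k_def by (simp add: divide_ennreal_def inverse_ennreal field_simps)
    then have "w x * ennreal_power (k x) p' = ennreal r * ennreal ((1 / r) powr p') * ennreal_power (G x) p"
      using r p p' by (simp add: ennreal_power_mult ennreal_power_power ennreal_power_ennreal mult_ac)
    also have "ennreal r * ennreal ((1 / r) powr p') = ennreal (r powr (1 - p'))"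
      using r by (simp add: powr_diff powr_divide flip: ennreal_mult)
    also have "\<dots> = s x" using x r p'(3) by (simp add: ennreal_power_ennreal_pos)
    finally show "w x * ennreal_power (k x) p' = s x * ennreal_power (G x) p" .
  qed
  also have "\<dots> = (\<integral>\<^sup>+x. ennreal_power (G x) p \<partial>?Ms)" by (simp add: nn_integral_density)
  also have "ennreal (K powr p') * (ennreal (doob_const p') * \<dots>) \<le>
    ennreal (K powr p') * (ennreal (doob_const p') * (ennreal (doob_const p) * (\<integral>\<^sup>+x. ennreal_power (h x) p \<partial>?Ms)))"
    unfolding G_def using D fin p
    by (intro mult_left_mono maximal_strong) (auto simp: emeasure_density subset_iff)
  also have "(\<integral>\<^sup>+x. ennreal_power (h x) p \<partial>?Ms) = (\<integral>\<^sup>+x. s x * ennreal_power (h x) p \<partial>M)"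
    by (simp add: nn_integral_density)
  also have "\<dots> = (\<integral>\<^sup>+x. ennreal_power (f x) p * w x \<partial>M)"
  proof (rule nn_integral_cong_AE, use ws in eventually_elim)
    fix x assume x: "0 < w x \<and> w x < top \<and> s x = ennreal_power (w x) (- 1 / (p - 1))"
    then obtain r where r: "0 < r" "w x = ennreal r" by (cases "w x") auto
    let ?t = "r powr (- 1 / (p - 1))"
    have t: "s x = ennreal ?t" "0 < ?t" using x r by (auto simp: ennreal_power_ennreal_pos)
    have "h x = f x * ennreal (1 / ?t)"
      using t unfolding h_def by (simp add: divide_ennreal_def inverse_ennreal field_simps)
    then have "s x * ennreal_power (h x) p = ennreal_power (f x) p * (ennreal ?t * ennreal ((1 / ?t) powr p))"
      using r t p by (simp add: ennreal_power_mult ennreal_power_ennreal mult_ac)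
    also have "ennreal ?t * ennreal ((1 / ?t) powr p) = ennreal (?t powr (1 - p))"
      using t by (simp add: powr_diff powr_divide flip: ennreal_mult)
    also have "?t powr (1 - p) = r"
    proof -
      have "- 1 / (p - 1) * (1 - p) = 1" using p by (simp add: divide_simps)
      then show ?thesis using r by (simp only: powr_powr powr_one)
    qed
    finally show "s x * ennreal_power (h x) p = ennreal_power (f x) p * w x" using r by simp
  qed
  finally show ?thesis using doob_const_pos[OF p'(1)] doob_const_pos[OF p]
    by (simp add: ennreal_mult mult.assoc flip: p'_def)
qed

section \<open>The Rubio de Francia iteration\<close>

lemma ennreal_suminf_Suc_le: "(\<Sum>k. f (Suc k)) \<le> (\<Sum>k. f k :: ennreal)"
proof (rule suminf_le_const)
  fix n
  have "(\<Sum>k<n. f (Suc k)) = sum f (Suc ` {..<n})" by (simp add: sum.reindex)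
  also have "\<dots> \<le> (\<Sum>k. f k)" by (rule sum_le_suminf) auto
  finally show "(\<Sum>k<n. f (Suc k)) \<le> (\<Sum>k. f k)" .
qed simp

text \<open>H is the sum of the iterates M^k f damped by (2 B1)^(-k); applying M shifts the index
  and costs the factor 2 B1. The norm bound avoids the triangle inequality: H is at most twice the
  supremum of v k = B1^(-k) M^k f, and the p-th power of a supremum is at most the sum of the p-th
  powers. This works for every p > 0.\<close>

lemma rubio_de_francia:
  fixes w :: "'a \<Rightarrow> ennreal"
  assumes D: "countable D" "D \<subseteq> sets M"
    and w [measurable]: "w \<in> borel_measurable M" and p: "0 < p" and A: "0 < A"
    and bd: "\<And>h. h \<in> borel_measurable M \<Longrightarrow>
      (\<integral>\<^sup>+x. ennreal_power (maximal M D h x) p * w x \<partial>M) \<le> ennreal A * (\<integral>\<^sup>+x. ennreal_power (h x) p * w x \<partial>M)"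
    and f [measurable]: "f \<in> borel_measurable M"
  obtains H where "H \<in> borel_measurable M" "\<And>x. f x \<le> H x"
    "(\<integral>\<^sup>+x. ennreal_power (H x) p * w x \<partial>M) \<le> ennreal (2 * 2 powr p) * (\<integral>\<^sup>+x. ennreal_power (f x) p * w x \<partial>M)"
    "\<And>x. maximal M D H x \<le> ennreal (2 * (2 * A) powr (1 / p)) * H x"
proof
  \<comment> \<open>The factor 2 inside the root makes the integrals of the p-th powers of
    \<open>v k\<close> decay like 2^(-k), so that their sum converges.\<close>
  define B1 where "B1 = (2 * A) powr (1 / p)"
  have B1: "0 < B1" "B1 powr p = 2 * A" using A p by (auto simp: B1_def powr_powr)
  define u where "u k = (maximal M D ^^ k) f" for k
  have u0: "u 0 = f" and uS: "u (Suc k) = maximal M D (u k)" for k by (auto simp: u_def)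
  have [measurable]: "u k \<in> borel_measurable M" for k
    by (cases k) (use D in \<open>auto simp: u0 uS\<close>)
  let ?I = "\<integral>\<^sup>+x. ennreal_power (f x) p * w x \<partial>M"
  define v where "v k x = ennreal ((1 / B1) ^ k) * u k x" for k x
  define H where "H x = (\<Sum>k. ennreal ((1 / (2 * B1)) ^ k) * u k x)" for x
  have [measurable]: "v k \<in> borel_measurable M" for k unfolding v_def by measurable
  show [measurable]: "H \<in> borel_measurable M" unfolding H_def by measurable
  show "f x \<le> H x" for x
    using ennreal_le_suminf[of "\<lambda>k. ennreal ((1 / (2 * B1)) ^ k) * u k x" 0] by (simp add: H_def u0)
  have Iu: "(\<integral>\<^sup>+x. ennreal_power (u k x) p * w x \<partial>M) \<le> ennreal (A ^ k) * ?I" for k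
  proof (induction k)
    case (Suc k)
    have "(\<integral>\<^sup>+x. ennreal_power (u (Suc k) x) p * w x \<partial>M) \<le> ennreal A * (\<integral>\<^sup>+x. ennreal_power (u k x) p * w x \<partial>M)"
      unfolding uS by (rule bd) measurable
    also have "\<dots> \<le> ennreal A * (ennreal (A ^ k) * ?I)" by (intro mult_left_mono Suc) auto
    finally show ?case using A by (simp add: ennreal_mult mult_ac)
  qed (simp add: u0)
  have Iv: "(\<integral>\<^sup>+x. ennreal_power (v k x) p * w x \<partial>M) \<le> ennreal ((1 / 2) ^ k) * ?I" for k
  proof -
    have "((1 / B1) ^ k) powr p = ((1 / B1) powr p) ^ k"
      using B1 by (simp add: powr_powr mult.commute flip: powr_realpow)
    also have "(1 / B1) powr p = 1 / (2 * A)" using B1 by (simp add: powr_divide)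
    finally have "(\<integral>\<^sup>+x. ennreal_power (v k x) p * w x \<partial>M) = ennreal ((1 / (2 * A)) ^ k) * (\<integral>\<^sup>+x. ennreal_power (u k x) p * w x \<partial>M)"
      unfolding v_def using p B1 by (simp add: ennreal_power_mult ennreal_power_ennreal mult.assoc nn_integral_cmult)
    also have "\<dots> \<le> ennreal ((1 / (2 * A)) ^ k) * (ennreal (A ^ k) * ?I)" by (intro mult_left_mono Iu) auto
    also have "\<dots> = ennreal ((1 / (2 * A)) ^ k * A ^ k) * ?I" using A by (simp add: ennreal_mult mult.assoc)
    also have "(1 / (2 * A)) ^ k * A ^ k = (1 / 2) ^ k" using A by (simp add: power_mult_distrib[symmetric])
    finally show ?thesis .
  qed
  have half: "(\<Sum>k. ennreal ((1 / 2) ^ k)) = 2"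
    by (subst suminf_ennreal_eq[of _ 2]) (use geometric_sums[of "1/2::real"] in auto)
  have Hv: "ennreal_power (H x) p \<le> ennreal (2 powr p) * (\<Sum>k. ennreal_power (v k x) p)" for x
  proof -
    have "H x = (\<Sum>k. ennreal ((1 / 2) ^ k) * v k x)"
      unfolding H_def v_def using B1
      by (intro suminf_cong) (simp add: power_divide power_mult_distrib mult.assoc[symmetric] flip: ennreal_mult)
    also have "\<dots> \<le> (\<Sum>k. ennreal ((1 / 2) ^ k) * (SUP j. v j x))"
      by (intro suminf_le allI mult_left_mono SUP_upper) auto
    also have "\<dots> = 2 * (SUP j. v j x)" using half by (simp add: ennreal_suminf_multc)
    finally have "ennreal_power (H x) p \<le> ennreal_power (ennreal 2 * (SUP j. v j x)) p"
      using p by (intro ennreal_power_mono) auto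
    also have "\<dots> = ennreal (2 powr p) * (SUP j. ennreal_power (v j x) p)"
      using p by (subst ennreal_power_mult) (auto simp: ennreal_power_ennreal ennreal_power_SUP simp del: ennreal_numeral)
    also have "\<dots> \<le> ennreal (2 powr p) * (\<Sum>k. ennreal_power (v k x) p)"
      by (intro mult_left_mono SUP_least ennreal_le_suminf) auto
    finally show ?thesis .
  qed
  have "(\<integral>\<^sup>+x. ennreal_power (H x) p * w x \<partial>M) \<le> (\<integral>\<^sup>+x. ennreal (2 powr p) * (\<Sum>k. ennreal_power (v k x) p) * w x \<partial>M)"
    by (intro nn_integral_mono mult_right_mono Hv) auto
  also have "\<dots> = (\<integral>\<^sup>+x. ennreal (2 powr p) * (\<Sum>k. ennreal_power (v k x) p * w x) \<partial>M)"
    by (simp add: ennreal_suminf_multc mult.assoc)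
  also have "\<dots> = ennreal (2 powr p) * (\<Sum>k. \<integral>\<^sup>+x. ennreal_power (v k x) p * w x \<partial>M)"
    by (simp add: nn_integral_cmult nn_integral_suminf[symmetric] del: ennreal_suminf_multc)
  also have "\<dots> \<le> ennreal (2 powr p) * (\<Sum>k. ennreal ((1 / 2) ^ k) * ?I)"
    by (intro mult_left_mono suminf_le allI Iv) auto
  also have "\<dots> = ennreal (2 * 2 powr p) * ?I"
    using half by (simp add: ennreal_suminf_multc ennreal_mult mult_ac)
  finally show "(\<integral>\<^sup>+x. ennreal_power (H x) p * w x \<partial>M) \<le> ennreal (2 * 2 powr p) * ?I" .
  show "maximal M D H x \<le> ennreal (2 * (2 * A) powr (1 / p)) * H x" for x
    unfolding maximal_def[of M D H]
  proof (rule SUP_least)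
    fix Q assume Q: "Q \<in> D"
    then have [measurable]: "Q \<in> sets M" using D by auto
    show "set_average M H Q * indicator Q x \<le> ennreal (2 * (2 * A) powr (1 / p)) * H x"
    proof (cases "x \<in> Q")
      case True
      let ?c = "\<lambda>k. ennreal ((1 / (2 * B1)) ^ k)"
      have "set_average M H Q = (\<Sum>k. ?c k * set_average M (u k) Q)"
        unfolding set_average_def H_def divide_ennreal_def
        by (simp add: nn_integral_suminf nn_integral_cmult mult.assoc flip: ennreal_suminf_multc)
      also have "\<dots> \<le> (\<Sum>k. ?c k * u (Suc k) x)"
        unfolding uS by (intro suminf_le allI mult_left_mono maximal_upper Q True) auto
      also have "\<dots> = (\<Sum>k. ennreal (2 * B1) * (?c (Suc k) * u (Suc k) x))"
      proof (intro suminf_cong)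
        fix k
        have "(1 / (2 * B1)) ^ k = 2 * B1 * (1 / (2 * B1)) ^ Suc k" using B1 by simp
        then have "?c k = ennreal (2 * B1 * (1 / (2 * B1)) ^ Suc k)" by (rule arg_cong)
        also have "\<dots> = ennreal (2 * B1) * ?c (Suc k)" by (rule ennreal_mult) (use B1 in auto)
        finally have "?c k = ennreal (2 * B1) * ?c (Suc k)" .
        then show "?c k * u (Suc k) x = ennreal (2 * B1) * (?c (Suc k) * u (Suc k) x)" by (simp only: mult.assoc)
      qed
      also have "\<dots> = ennreal (2 * B1) * (\<Sum>k. ?c (Suc k) * u (Suc k) x)"
        by (rule ennreal_suminf_cmult)
      also have "\<dots> \<le> ennreal (2 * B1) * H x"
      proof (intro mult_left_mono)
        show "(\<Sum>k. ?c (Suc k) * u (Suc k) x) \<le> H x"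
          unfolding H_def by (rule ennreal_suminf_Suc_le)
      qed auto
      finally show ?thesis using True by (simp add: B1_def)
    qed simp
  qed
qed

section \<open>Shifted dyadic grids\<close>

text \<open>The one-third shift. Its sign alternates with the scale because 2 / 3 = 1 - 1 / 3 and -2
  / 3 = -1 + 1 / 3; thus endpoints of one generation are again endpoints of the next finer one. A
  constant shift of the unit grid would not have this property on all scales.\<close>

definition grid_shift :: "bool \<Rightarrow> int \<Rightarrow> real" where
  "grid_shift b k = (if b then if even k then 1 / 3 else - 1 / 3 else 0)"

lemma grid_refine_step:
  "\<exists>M::int. 2 powr (- real_of_int k) * (real_of_int m + grid_shift b k)
    = 2 powr (- real_of_int (k + 1)) * (real_of_int M + grid_shift b (k + 1))"
proof -
  have 2: "2 powr (- real_of_int k) = 2 * (2::real) powr (- real_of_int (k + 1))"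
    by (simp add: powr_diff)
  define M where "M = 2 * m + (if b then if even k then 1 else -1 else 0)"
  have "2 * (real_of_int m + grid_shift b k) = real_of_int M + grid_shift b (k + 1)"
    by (simp add: grid_shift_def M_def field_simps)
  then show ?thesis unfolding 2 by (intro exI[of _ M]) (simp add: mult_ac)
qed

lemma grid_refine:
  "\<exists>M::int. 2 powr (- real_of_int k) * (real_of_int m + grid_shift b k)
    = 2 powr (- real_of_int (k + int n)) * (real_of_int M + grid_shift b (k + int n))"
proof (induction n)
  case (Suc n)
  then obtain M :: int where M: "2 powr (- real_of_int k) * (real_of_int m + grid_shift b k)
    = 2 powr (- real_of_int (k + int n)) * (real_of_int M + grid_shift b (k + int n))" by blast
  have "k + int (Suc n) = k + int n + 1" by simp
  with grid_refine_step[of "k + int n" M b] show ?case unfolding M by (simp only:)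
qed auto

definition grid_interval :: "bool \<Rightarrow> int \<Rightarrow> int \<Rightarrow> real set" where
  "grid_interval b k m = {2 powr (- real_of_int k) * (real_of_int m + grid_shift b k)..<
     2 powr (- real_of_int k) * (real_of_int m + grid_shift b k + 1)}"

text \<open>Both endpoints of the coarser interval are lattice points N * (A + c), N * (B + c) of
  the finer generation, so a half-open cell of that generation cannot straddle them.\<close>

lemma grid_interval_nested:
  assumes "k \<le> k'"
  shows "grid_interval b k' m' \<subseteq> grid_interval b k m \<or> grid_interval b k' m' \<inter> grid_interval b k m = {}"
proof -
  define n where "n = nat (k' - k)"
  have k': "k' = k + int n" using assms by (simp add: n_def)
  define N where "N = (2::real) powr (- real_of_int k')"
  define c where "c = grid_shift b k'"
  have N: "0 < N" by (simp add: N_def)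
  obtain A :: int where A: "2 powr (- real_of_int k) * (real_of_int m + grid_shift b k) = N * (A + c)"
    using grid_refine[of k m b n] unfolding N_def c_def k' by blast
  obtain B :: int where "2 powr (- real_of_int k) * (real_of_int (m + 1) + grid_shift b k) = N * (B + c)"
    using grid_refine[of k "m + 1" b n] unfolding N_def c_def k' by blast
  then have B: "2 powr (- real_of_int k) * (real_of_int m + grid_shift b k + 1) = N * (B + c)"
    by (simp add: add_ac)
  have P: "grid_interval b k m = {N * (A + c)..<N * (B + c)}"
    unfolding grid_interval_def A B ..
  have Q: "grid_interval b k' m' = {N * (m' + c)..<N * (m' + c + 1)}"
    unfolding grid_interval_def N_def c_def ..
  show ?thesis
  proof (cases "A \<le> m' \<and> m' < B")
    case True
    then have "real_of_int A \<le> m'" "real_of_int m' + 1 \<le> B" by linarith+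
    then have "N * (A + c) \<le> N * (m' + c)" "N * (m' + c + 1) \<le> N * (B + c)"
      using N by (auto intro!: mult_left_mono)
    then show ?thesis unfolding P Q by auto
  next
    case False
    then have "real_of_int m' + 1 \<le> A \<or> real_of_int B \<le> m'" by linarith
    then have "N * (m' + c + 1) \<le> N * (A + c) \<or> N * (B + c) \<le> N * (m' + c)"
      using N by (auto intro!: mult_left_mono)
    then show ?thesis unfolding P Q by fastforce
  qed
qed

text \<open>An interval of length at most a third of the cell size cannot cross both an endpoint of
  the plain grid and one of the shifted grid, since these are a third of a cell apart.\<close>

lemma grid_interval_cover:
  assumes "0 < l" "3 * l \<le> 2 powr (- real_of_int k)"
  shows "\<exists>b m. {a..a + l} \<subseteq> grid_interval b k m"
proof -
  define N where "N = (2::real) powr (- real_of_int k)"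
  have N: "0 < N" "3 * l \<le> N" using assms by (auto simp: N_def)
  define m where "m = \<lfloor>a / N\<rfloor>"
  have m: "m \<le> a / N" "a / N < m + 1" unfolding m_def by linarith+
  define t where "t = a / N"
  have t: "a = N * t" using N by (simp add: t_def)
  have l: "l \<le> N * (1 / 3)" using N by simp
  have *: "{a..a + l} \<subseteq> grid_interval b k j" if "real_of_int j + grid_shift b k \<le> t" "t + 1 / 3 < j + grid_shift b k + 1" for b j
  proof -
    have "N * (j + grid_shift b k) \<le> a" using that N unfolding t by (intro mult_left_mono) auto
    moreover have "N * (t + 1 / 3) < N * (j + grid_shift b k + 1)" using that N by (intro mult_strict_left_mono) auto
    then have "a + l < N * (j + grid_shift b k + 1)" using l unfolding t by (simp add: distrib_left)
    ultimately show ?thesis unfolding grid_interval_def N_def[symmetric] by auto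
  qed
  \<comment> \<open>The plain cell works unless the left end lies in its last third. Then the
    shifted cell is used; for odd k the shift is negative, which is why its index is m + 1.\<close>
  consider "t < m + 2 / 3" | "m + 2 / 3 \<le> t" "even k" | "m + 2 / 3 \<le> t" "odd k" by linarith
  then show ?thesis
  proof cases
    case 1
    then show ?thesis using *[of m False] m by (auto simp: t_def grid_shift_def)
  next
    case 2
    then show ?thesis using *[of m True] m by (auto simp: t_def grid_shift_def)
  next
    case 3
    then show ?thesis using *[of "m + 1" True] m by (auto simp: t_def grid_shift_def)
  qed
qed

text \<open>The choice between plain and shifted intervals is made per coordinate, so there are 2^n
  grids; each side of a given cube may ask for a different choice.\<close>

definition dyadic_cube :: "('n::finite \<Rightarrow> bool) \<Rightarrow> int \<Rightarrow> ('n \<Rightarrow> int) \<Rightarrow> (real ^ 'n) set" where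
  "dyadic_cube \<alpha> k m = {x. \<forall>i. x $ i \<in> grid_interval (\<alpha> i) k (m i)}"

definition dyadic_grid :: "('n::finite \<Rightarrow> bool) \<Rightarrow> (real ^ 'n) set set" where
  "dyadic_grid \<alpha> = {dyadic_cube \<alpha> k m | k m. True}"

definition dyadic_cubes :: "(real ^ 'n) set set" where
  "dyadic_cubes = (\<Union>\<alpha>. dyadic_grid \<alpha>)"

lemma nested_dyadic_grid: "nested (dyadic_grid \<alpha>)"
proof -
  have *: "dyadic_cube \<alpha> k' m' \<subseteq> dyadic_cube \<alpha> k m \<or> dyadic_cube \<alpha> k' m' \<inter> dyadic_cube \<alpha> k m = {}"
    if "k \<le> k'" for k k' m m'
  proof (cases "\<forall>i. grid_interval (\<alpha> i) k' (m' i) \<subseteq> grid_interval (\<alpha> i) k (m i)")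
    case False
    then obtain i where "grid_interval (\<alpha> i) k' (m' i) \<inter> grid_interval (\<alpha> i) k (m i) = {}"
      using grid_interval_nested[OF \<open>k \<le> k'\<close>] by blast
    then show ?thesis unfolding dyadic_cube_def by blast
  qed (auto simp: dyadic_cube_def)
  show ?thesis unfolding nested_def
  proof (intro ballI)
    fix P Q assume "P \<in> dyadic_grid \<alpha>" "Q \<in> dyadic_grid \<alpha>"
    then obtain k m k' m' where "P = dyadic_cube \<alpha> k m" "Q = dyadic_cube \<alpha> k' m'"
      unfolding dyadic_grid_def by blast
    then show "P \<inter> Q = {} \<or> P \<subseteq> Q \<or> Q \<subseteq> P"
      using *[of k k' m' m] *[of k' k m m'] by (cases "k \<le> k'") auto
  qed
qed

lemma countable_dyadic_grid: "countable (dyadic_grid \<alpha>)"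
proof -
  have "dyadic_grid \<alpha> = (\<lambda>(k, m). dyadic_cube \<alpha> k m) ` UNIV" by (auto simp: dyadic_grid_def)
  then show ?thesis by simp
qed

lemma countable_dyadic_cubes: "countable dyadic_cubes"
  unfolding dyadic_cubes_def by (simp add: countable_dyadic_grid)

lemma emeasure_box_cube:
  fixes a :: "real ^ 'n"
  assumes "0 \<le> l"
  shows "emeasure lebesgue (box a (\<chi> i. a $ i + l)) = ennreal (l ^ CARD('n))"
    and emeasure_cbox_cube: "emeasure lebesgue (cbox a (\<chi> i. a $ i + l)) = ennreal (l ^ CARD('n))"
proof -
  have *: "((\<chi> i. a $ i + l) - a) \<bullet> b = l" if "b \<in> Basis" for b :: "real ^ 'n"
    using that by (auto simp: Basis_vec_def inner_axis)
  then have le: "a \<bullet> b \<le> (\<chi> i. a $ i + l) \<bullet> b" if "b \<in> Basis" for b :: "real ^ 'n"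
    using assms *[OF that] unfolding inner_diff_left by linarith
  have "(\<Prod>b\<in>(Basis :: (real ^ 'n) set). ((\<chi> i. a $ i + l) - a) \<bullet> b) = (\<Prod>b\<in>(Basis :: (real ^ 'n) set). l)"
    by (intro prod.cong refl *)
  also have "\<dots> = l ^ CARD('n)" by simp
  finally have "(\<Prod>b\<in>(Basis :: (real ^ 'n) set). ((\<chi> i. a $ i + l) - a) \<bullet> b) = l ^ CARD('n)" .
  then show "emeasure lebesgue (box a (\<chi> i. a $ i + l)) = ennreal (l ^ CARD('n))"
     "emeasure lebesgue (cbox a (\<chi> i. a $ i + l)) = ennreal (l ^ CARD('n))"
    using le by (simp_all add: emeasure_lborel_box_eq emeasure_lborel_cbox_eq)
qed

lemma dyadic_cube_measurable: "dyadic_cube \<alpha> k m \<in> sets lebesgue"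
proof -
  have "dyadic_cube \<alpha> k m \<in> sets borel"
    unfolding dyadic_cube_def grid_interval_def by (simp add: Collect_all_eq)
  then show ?thesis by simp
qed

text \<open>Half-open cubes are nested but do not belong to \<open>cubes\<close>. The sandwich
  between an open and a closed cube gives their measure and transfers conditions stated for closed
  cubes.\<close>

lemma dyadic_cube_between:
  fixes \<alpha> :: "'n::finite \<Rightarrow> bool"
  obtains a :: "real ^ 'n" where
    "box a (\<chi> i. a $ i + 2 powr (- real_of_int k)) \<subseteq> dyadic_cube \<alpha> k m"
    "dyadic_cube \<alpha> k m \<subseteq> cbox a (\<chi> i. a $ i + 2 powr (- real_of_int k))"
    "emeasure lebesgue (dyadic_cube \<alpha> k m) = emeasure lebesgue (cbox a (\<chi> i. a $ i + 2 powr (- real_of_int k)))"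
proof
  let ?a = "\<chi> i. 2 powr (- real_of_int k) * (real_of_int (m i) + grid_shift (\<alpha> i) k) :: real ^ 'n"
  let ?b = "\<chi> i. ?a $ i + 2 powr (- real_of_int k)"
  have eq: "2 powr (- real_of_int k) * (real_of_int (m i) + grid_shift (\<alpha> i) k + 1) = ?b $ i" for i
    by (simp add: distrib_left)
  show 1: "box ?a ?b \<subseteq> dyadic_cube \<alpha> k m"
    unfolding dyadic_cube_def grid_interval_def eq by (auto simp: mem_box_cart less_imp_le)
  show 2: "dyadic_cube \<alpha> k m \<subseteq> cbox ?a ?b"
    unfolding dyadic_cube_def grid_interval_def eq by (auto simp: mem_box_cart less_imp_le)
  have "emeasure lebesgue (box ?a ?b) \<le> emeasure lebesgue (dyadic_cube \<alpha> k m)"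
    using 1 by (intro emeasure_mono dyadic_cube_measurable)
  moreover have "emeasure lebesgue (dyadic_cube \<alpha> k m) \<le> emeasure lebesgue (cbox ?a ?b)"
    using 2 by (intro emeasure_mono) auto
  ultimately show "emeasure lebesgue (dyadic_cube \<alpha> k m) = emeasure lebesgue (cbox ?a ?b)"
    using emeasure_box_cube[of "2 powr (- real_of_int k)" ?a] emeasure_cbox_cube[of "2 powr (- real_of_int k)" ?a]
    by (intro antisym) auto
qed

lemma dyadic_cubes_sets: "dyadic_cubes \<subseteq> sets lebesgue"
  unfolding dyadic_cubes_def dyadic_grid_def using dyadic_cube_measurable by blast

lemma dyadic_in_cube:
  assumes "P \<in> dyadic_cubes"
  obtains Q where "Q \<in> cubes" "P \<subseteq> Q" "emeasure lebesgue P = emeasure lebesgue Q"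
proof -
  obtain \<alpha> k m where P: "P = dyadic_cube \<alpha> k m"
    using assms by (auto simp: dyadic_cubes_def dyadic_grid_def)
  obtain a where "P \<subseteq> cbox a (\<chi> i. a $ i + 2 powr (- real_of_int k))"
    "emeasure lebesgue P = emeasure lebesgue (cbox a (\<chi> i. a $ i + 2 powr (- real_of_int k)))"
    unfolding P by (rule dyadic_cube_between)
  moreover have "cbox a (\<chi> i. a $ i + 2 powr (- real_of_int k)) \<in> cubes"
    unfolding cubes_def by (intro CollectI exI[of _ a] exI[of _ "2 powr (- real_of_int k)"]) simp
  ultimately show ?thesis using that by blast
qed

lemma cube_emeasure:
  fixes Q :: "(real ^ 'n) set"
  assumes "Q \<in> cubes"
  shows "0 < emeasure lebesgue Q" "emeasure lebesgue Q < top" "Q \<in> sets lebesgue"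
proof -
  obtain a :: "real ^ 'n" and l where Q: "Q = cbox a (\<chi> i. a $ i + l)" "0 < l" using assms by (auto simp: cubes_def)
  then have "emeasure lebesgue Q = ennreal (l ^ CARD('n))" using emeasure_cbox_cube[of l a] by simp
  then show "0 < emeasure lebesgue Q" "emeasure lebesgue Q < top" using Q(2) by auto
  show "Q \<in> sets lebesgue" using Q(1) by simp
qed

lemma cube_in_dyadic:
  fixes Q :: "(real ^ 'n) set"
  assumes "Q \<in> cubes"
  obtains P where "P \<in> dyadic_cubes" "Q \<subseteq> P" "emeasure lebesgue P \<le> ennreal (6 ^ CARD('n)) * emeasure lebesgue Q"
proof -
  obtain a :: "real ^ 'n" and l where Q: "Q = cbox a (\<chi> i. a $ i + l)" "0 < l" using assms by (auto simp: cubes_def)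
  \<comment> \<open>The scale 2^(-k) is the least power of two not below 3 l, hence at most 6 l. The
    lower bound is what the one-third trick requires, the upper one produces the constant 6 ^
    n.\<close>
  define k where "k = - \<lceil>log 2 (3 * l)\<rceil>"
  have k1: "3 * l \<le> 2 powr (- real_of_int k)"
  proof -
    have "3 * l = 2 powr (log 2 (3 * l))" using Q by simp
    also have "\<dots> \<le> 2 powr (- real_of_int k)" unfolding k_def by (intro powr_mono) auto
    finally show ?thesis .
  qed
  have k2: "2 powr (- real_of_int k) \<le> 6 * l"
  proof -
    have "2 powr (- real_of_int k) \<le> 2 powr (log 2 (3 * l) + 1)"
      unfolding k_def by (intro powr_mono) linarith+
    also have "\<dots> = 6 * l" using Q by (simp add: powr_add)
    finally show ?thesis .
  qed
  have "\<forall>i. \<exists>b m. {a $ i..a $ i + l} \<subseteq> grid_interval b k m"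
    using grid_interval_cover[OF Q(2) k1] by blast
  then obtain \<alpha> m where \<alpha>m: "\<And>i. {a $ i..a $ i + l} \<subseteq> grid_interval (\<alpha> i) k (m i)" by metis
  have sub: "Q \<subseteq> dyadic_cube \<alpha> k m"
    unfolding Q dyadic_cube_def using \<alpha>m by (fastforce simp: mem_box_cart)
  have "dyadic_cube \<alpha> k m \<in> dyadic_cubes" by (auto simp: dyadic_cubes_def dyadic_grid_def)
  moreover have "emeasure lebesgue (dyadic_cube \<alpha> k m) \<le> ennreal (6 ^ CARD('n)) * emeasure lebesgue Q"
  proof -
    obtain c :: "real ^ 'n" where "emeasure lebesgue (dyadic_cube \<alpha> k m) = emeasure lebesgue (cbox c (\<chi> i. c $ i + 2 powr (- real_of_int k)))"
      by (rule dyadic_cube_between)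
    also have "\<dots> = ennreal ((2 powr (- real_of_int k)) ^ CARD('n))" by (rule emeasure_cbox_cube) simp
    also have "\<dots> \<le> ennreal ((6 * l) ^ CARD('n))" using k2 by (intro ennreal_leI power_mono) auto
    also have "\<dots> = ennreal (6 ^ CARD('n)) * emeasure lebesgue Q"
      using Q emeasure_cbox_cube[of l a] by (simp add: power_mult_distrib ennreal_mult)
    finally show ?thesis .
  qed
  ultimately show ?thesis using that sub by blast
qed

section \<open>Cubes, weights and the dyadic maximal operator\<close>

definition ccube :: "real ^ 'n \<Rightarrow> real \<Rightarrow> (real ^ 'n) set" where
  "ccube x r = cbox (\<chi> i. x $ i - r) (\<chi> i. x $ i + r)"

lemma mem_ccube: "y \<in> ccube x r \<longleftrightarrow> (\<forall>i. \<bar>y $ i - x $ i\<bar> \<le> r)"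
  unfolding ccube_def mem_box_cart by (auto simp: abs_le_iff algebra_simps)

lemma ccube_eq: "ccube x r = cbox (\<chi> i. x $ i - r) (\<chi> i. (\<chi> i. x $ i - r) $ i + 2 * r)"
  unfolding ccube_def by (intro arg_cong2[of _ _ _ _ cbox] refl) (simp add: vec_eq_iff)

lemma ccube_in_cubes: "0 < r \<Longrightarrow> ccube x r \<in> cubes"
  unfolding cubes_def ccube_eq by (intro CollectI exI[of _ "\<chi> i. x $ i - r"] exI[of _ "2 * r"]) auto

lemma emeasure_ccube:
  fixes x :: "real ^ 'n"
  assumes "0 \<le> r"
  shows "emeasure lebesgue (ccube x r) = ennreal ((2 * r) ^ CARD('n))"
  unfolding ccube_eq using assms by (intro emeasure_cbox_cube) simp

lemma cubes_ccube:
  assumes "Q \<in> cubes"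
  obtains x r where "0 < r" "Q = ccube x r"
proof -
  obtain a l where Q: "Q = cbox a (\<chi> i. a $ i + l)" "0 < l" using assms by (auto simp: cubes_def)
  have "Q = ccube (\<chi> i. a $ i + l / 2) (l / 2)"
    unfolding Q ccube_def by (intro arg_cong2[of _ _ _ _ cbox]) (auto simp: vec_eq_iff)
  then show ?thesis using that[of "l / 2"] Q by simp
qed

lemma cube_emeasure_real:
  fixes Q :: "(real ^ 'n) set"
  assumes "Q \<in> cubes"
  obtains m where "emeasure lebesgue Q = ennreal m" "0 < m"
proof -
  obtain x r where "0 < r" "Q = ccube x r" using assms by (rule cubes_ccube)
  then show ?thesis using that[of "(2 * r) ^ CARD('n)"] emeasure_ccube[of r x] by simp
qed

lemma bounded_subset_ccube:
  assumes "bounded S"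
  obtains r where "0 < r" "S \<subseteq> ccube x r"
proof -
  obtain r where r: "0 < r" "\<And>y. y \<in> S \<Longrightarrow> dist x y \<le> r"
    using assms bounded_any_center[of S x] by (metis less_le_trans linorder_le_cases zero_less_one order.trans)
  have "S \<subseteq> ccube x r"
  proof
    fix y assume "y \<in> S"
    then have "norm (y - x) \<le> r" using r(2)[OF \<open>y \<in> S\<close>] by (simp add: dist_norm norm_minus_commute)
    then have "\<bar>y $ i - x $ i\<bar> \<le> r" for i using component_le_norm_cart[of "y - x" i] by simp
    then show "y \<in> ccube x r" by (simp add: mem_ccube)
  qed
  then show ?thesis using that r by blast
qed

lemma UN_ccube: "(\<Union>j. ccube x (real (Suc j))) = UNIV"
proof -
  have "y \<in> (\<Union>j. ccube x (real (Suc j)))" for y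
  proof -
    obtain r where r: "0 < r" "{y} \<subseteq> ccube x r" by (rule bounded_subset_ccube[of "{y}" x]) auto
    obtain j where "r \<le> real j" using real_arch_simple by blast
    then have "r \<le> real (Suc j)" by simp
    moreover have "\<bar>y $ i - x $ i\<bar> \<le> r" for i using r(2) by (simp add: mem_ccube)
    ultimately have "y \<in> ccube x (real (Suc j))" unfolding mem_ccube by (meson order_trans)
    then show ?thesis by blast
  qed
  then show ?thesis by blast
qed

lemma set_nn_integral_lt_top:
  assumes "w \<in> borel_measurable M" "\<And>x. 0 \<le> w x" "S \<in> sets M"
  shows "set_integrable M S w \<longleftrightarrow> (\<integral>\<^sup>+x\<in>S. ennreal (w x) \<partial>M) < top"
proof -
  have "(\<integral>\<^sup>+x. ennreal (norm (indicator S x *\<^sub>R w x)) \<partial>M) = (\<integral>\<^sup>+x\<in>S. ennreal (w x) \<partial>M)"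
    using assms(2) by (intro nn_integral_cong) (auto simp: indicator_def)
  then show ?thesis
    using assms unfolding set_integrable_def integrable_iff_bounded by (auto simp: infinity_ennreal_def)
qed

lemma weight_iff:
  fixes w :: "real ^ 'n \<Rightarrow> real"
  shows "weight w \<longleftrightarrow> w \<in> borel_measurable lebesgue \<and> (\<forall>x. 0 \<le> w x) \<and> (\<forall>Q\<in>cubes. weight_of w Q < top)"
proof (intro iffI conjI ballI)
  assume w: "weight w"
  then show "w \<in> borel_measurable lebesgue" "\<forall>x. 0 \<le> w x" by (auto simp: weight_def)
  fix Q :: "(real ^ 'n) set" assume Q: "Q \<in> cubes"
  then have "compact Q" by (auto simp: cubes_def)
  then have "set_integrable lebesgue Q w" using w by (auto simp: weight_def)
  then show "weight_of w Q < top"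
    unfolding weight_of_def using w cube_emeasure(3)[OF Q]
    by (subst (asm) set_nn_integral_lt_top) (auto simp: weight_def)
next
  assume w: "w \<in> borel_measurable lebesgue \<and> (\<forall>x. 0 \<le> w x) \<and> (\<forall>Q\<in>cubes. weight_of w Q < top)"
  have "set_integrable lebesgue K w" if "compact K" for K :: "(real ^ 'n) set"
  proof -
    obtain r where r: "0 < r" "K \<subseteq> ccube 0 r" using bounded_subset_ccube compact_imp_bounded[OF \<open>compact K\<close>] by blast
    have "set_integrable lebesgue (ccube 0 r) w"
      using w ccube_in_cubes[OF r(1), of 0] cube_emeasure(3)[of "ccube 0 r"]
      by (subst set_nn_integral_lt_top) (auto simp: weight_of_def)
    then show ?thesis using r compact_imp_closed[OF that]
      by (elim set_integrable_subset) auto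
  qed
  then show "weight w" using w by (simp add: weight_def)
qed

lemma ennreal_mult_inverse_le_iff:
  assumes "0 < c"
  shows "x * ennreal (1 / c) \<le> y \<longleftrightarrow> x \<le> y * ennreal c"
proof
  have 1: "ennreal (1 / c) * ennreal c = 1" "ennreal c * ennreal (1 / c) = 1"
    using assms by (auto simp flip: ennreal_mult)
  show "x \<le> y * ennreal c" if "x * ennreal (1 / c) \<le> y"
    using mult_right_mono[OF that, of "ennreal c"] 1 by (simp add: mult.assoc)
  show "x * ennreal (1 / c) \<le> y" if "x \<le> y * ennreal c"
    using mult_right_mono[OF that, of "ennreal (1 / c)"] 1 by (simp add: mult.assoc)
qed

lemma ennreal_divide_real: "0 < m \<Longrightarrow> x / ennreal m = x * ennreal (1 / m)"
  by (simp add: divide_ennreal_def inverse_ennreal field_simps)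

text \<open>The averages contribute |Q|^(-1) and |Q|^(-(p-1)), in total |Q|^(-p). In this
  division-free form the condition remains meaningful for infinite values.\<close>

lemma muckenhoupt_const_le_iff:
  assumes p: "1 < p"
  shows "muckenhoupt_const p w \<le> C \<longleftrightarrow> (\<forall>Q\<in>cubes.
    weight_of w Q * ennreal_power (weight_of (\<lambda>x. w x powr (1 - p / (p - 1))) Q) (p - 1) \<le> C * ennreal_power (emeasure lebesgue Q) p)"
proof -
  have "cube_average w Q * ennreal_power (cube_average v Q) (p - 1) \<le> C \<longleftrightarrow>
    weight_of w Q * ennreal_power (weight_of v Q) (p - 1) \<le> C * ennreal_power (emeasure lebesgue Q) p"
    if Q: "Q \<in> cubes" for Q v
  proof -
    obtain m where m: "emeasure lebesgue Q = ennreal m" "0 < m"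
      using Q by (rule cube_emeasure_real)
    have "cube_average w Q * ennreal_power (cube_average v Q) (p - 1)
      = weight_of w Q * ennreal_power (weight_of v Q) (p - 1) * (ennreal (1 / m) * ennreal ((1 / m) powr (p - 1)))"
      unfolding cube_average_def m(1) using m(2) p
      by (simp add: ennreal_divide_real ennreal_power_mult ennreal_power_ennreal mult_ac)
    also have "ennreal (1 / m) * ennreal ((1 / m) powr (p - 1)) = ennreal (1 / m powr p)"
      using m(2) by (simp add: powr_diff powr_divide flip: ennreal_mult)
    finally show ?thesis using m p by (simp add: ennreal_mult_inverse_le_iff ennreal_power_ennreal)
  qed
  then show ?thesis using p unfolding muckenhoupt_const_def by (simp add: SUP_le_iff)
qed

lemma maximal_UN_power_le:
  assumes "finite I" "0 < p"
  shows "ennreal_power (maximal M (\<Union>i\<in>I. D i) f x) p \<le> (\<Sum>i\<in>I. ennreal_power (maximal M (D i) f x) p)"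
proof -
  have "maximal M (\<Union>i\<in>I. D i) f x = (SUP i\<in>I. maximal M (D i) f x)"
    unfolding maximal_def by (rule SUP_UNION)
  then have "ennreal_power (maximal M (\<Union>i\<in>I. D i) f x) p = (SUP i\<in>I. ennreal_power (maximal M (D i) f x) p)"
    using assms by (simp add: ennreal_power_SUP)
  also have "\<dots> \<le> (\<Sum>i\<in>I. ennreal_power (maximal M (D i) f x) p)"
    using assms by (intro SUP_least member_le_sum) auto
  finally show ?thesis .
qed

section \<open>The dyadic maximal operator on weighted spaces\<close>

abbreviation dyadic_maximal :: "(real ^ 'n \<Rightarrow> ennreal) \<Rightarrow> real ^ 'n \<Rightarrow> ennreal" where
  "dyadic_maximal \<equiv> maximal lebesgue dyadic_cubes"

text \<open>The cardinality counts the grids; the rest is the constant for a single grid.\<close>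

definition maximal_const :: "'n::finite itself \<Rightarrow> real \<Rightarrow> real \<Rightarrow> real" where
  "maximal_const _ p K = real CARD('n \<Rightarrow> bool) * (K powr (p / (p - 1)) * doob_const (p / (p - 1)) * doob_const p)"

lemma maximal_const_pos: "1 < p \<Longrightarrow> 0 < K \<Longrightarrow> 0 < maximal_const TYPE('n::finite) p K"
  unfolding maximal_const_def by (simp add: doob_const_pos zero_less_card_finite)

text \<open>The supremum over the grids is at most the sum. Each dyadic cube lies in a closed cube
  of the same measure and so inherits the A_p condition with the same K.\<close>

theorem dyadic_maximal_weighted:
  fixes w s :: "real ^ 'n \<Rightarrow> ennreal"
  assumes w [measurable]: "w \<in> borel_measurable lebesgue" and s [measurable]: "s \<in> borel_measurable lebesgue"
    and ws: "AE x in lebesgue. 0 < w x \<and> w x < top \<and> s x = ennreal_power (w x) (- 1 / (p - 1))"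
    and p: "1 < p" and K: "0 < K"
    and Ap: "\<And>Q. Q \<in> cubes \<Longrightarrow> (\<integral>\<^sup>+x\<in>Q. w x \<partial>lebesgue) * ennreal_power (\<integral>\<^sup>+x\<in>Q. s x \<partial>lebesgue) (p - 1)
      \<le> ennreal K * ennreal_power (emeasure lebesgue Q) p"
    and f [measurable]: "f \<in> borel_measurable lebesgue"
  shows "(\<integral>\<^sup>+x. ennreal_power (dyadic_maximal f x) p * w x \<partial>lebesgue)
    \<le> ennreal (maximal_const TYPE('n) p K) * (\<integral>\<^sup>+x. ennreal_power (f x) p * w x \<partial>lebesgue)"
proof -
  let ?C = "K powr (p / (p - 1)) * doob_const (p / (p - 1)) * doob_const p"
  let ?I = "\<integral>\<^sup>+x. ennreal_power (f x) p * w x \<partial>lebesgue"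
  have C: "0 \<le> ?C" using p K by (simp add: doob_const_pos less_imp_le)
  have D: "dyadic_grid \<alpha> \<subseteq> dyadic_cubes" for \<alpha> :: "'n \<Rightarrow> bool" by (auto simp: dyadic_cubes_def)
  have [measurable]: "maximal lebesgue (dyadic_grid \<alpha>) f \<in> borel_measurable lebesgue" for \<alpha> :: "'n \<Rightarrow> bool"
    using D dyadic_cubes_sets by (intro maximal_measurable countable_dyadic_grid) blast
  have "(\<integral>\<^sup>+x. ennreal_power (dyadic_maximal f x) p * w x \<partial>lebesgue)
    \<le> (\<integral>\<^sup>+x. (\<Sum>\<alpha>\<in>UNIV. ennreal_power (maximal lebesgue (dyadic_grid \<alpha>) f x) p * w x) \<partial>lebesgue)"
    unfolding dyadic_cubes_def sum_distrib_right[symmetric] using p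
    by (intro nn_integral_mono mult_right_mono maximal_UN_power_le) auto
  also have "\<dots> = (\<Sum>\<alpha>\<in>UNIV. \<integral>\<^sup>+x. ennreal_power (maximal lebesgue (dyadic_grid \<alpha>) f x) p * w x \<partial>lebesgue)"
    by (intro nn_integral_sum) measurable
  also have "\<dots> \<le> (\<Sum>\<alpha>\<in>(UNIV :: ('n \<Rightarrow> bool) set). ennreal ?C * ?I)"
  proof (intro sum_mono maximal_weighted_strong[OF countable_dyadic_grid nested_dyadic_grid _ _ w s ws p K _ f])
    fix \<alpha> :: "'n \<Rightarrow> bool" and Q assume "Q \<in> dyadic_grid \<alpha>"
    then have Q: "Q \<in> dyadic_cubes" using D by blast
    then obtain R where R: "R \<in> cubes" "Q \<subseteq> R" "emeasure lebesgue Q = emeasure lebesgue R"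
      by (rule dyadic_in_cube)
    show "0 < emeasure lebesgue Q \<and> emeasure lebesgue Q < top" using cube_emeasure[OF R(1)] R(3) by simp
    have "(\<integral>\<^sup>+x\<in>Q. w x \<partial>lebesgue) * ennreal_power (\<integral>\<^sup>+x\<in>Q. s x \<partial>lebesgue) (p - 1)
      \<le> (\<integral>\<^sup>+x\<in>R. w x \<partial>lebesgue) * ennreal_power (\<integral>\<^sup>+x\<in>R. s x \<partial>lebesgue) (p - 1)"
      using R(2) p by (intro mult_mono ennreal_power_mono nn_set_integral_set_mono) auto
    also have "\<dots> \<le> ennreal K * ennreal_power (emeasure lebesgue Q) p" using Ap[OF R(1)] R(3) by simp
    finally show "(\<integral>\<^sup>+x\<in>Q. w x \<partial>lebesgue) * ennreal_power (\<integral>\<^sup>+x\<in>Q. s x \<partial>lebesgue) (p - 1)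
      \<le> ennreal K * ennreal_power (emeasure lebesgue Q) p" .
  next
    fix \<alpha> :: "'n \<Rightarrow> bool"
    show "dyadic_grid \<alpha> \<subseteq> sets lebesgue" using D dyadic_cubes_sets by blast
  qed
  also have "\<dots> = ennreal (maximal_const TYPE('n) p K) * ?I"
    using C by (simp add: maximal_const_def ennreal_mult mult.assoc ennreal_of_nat_eq_real_of_nat)
  finally show ?thesis .
qed

text \<open>An A_1 condition at every point instead of almost every point. The iteration provides it
  in this form, and it can therefore be evaluated at a single chosen point.\<close>

definition A1_majorant :: "real \<Rightarrow> (real ^ 'n \<Rightarrow> ennreal) \<Rightarrow> bool" where
  "A1_majorant B H \<longleftrightarrow> (\<forall>Q\<in>cubes. \<forall>x\<in>Q. set_average lebesgue H Q \<le> ennreal B * H x)"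

lemma A1_majorant_mono: "A1_majorant B H \<Longrightarrow> B \<le> C \<Longrightarrow> A1_majorant C H"
  unfolding A1_majorant_def by (meson ennreal_leI mult_right_mono order_trans zero_le)

text \<open>Every cube lies in a dyadic one that is at most 6 ^ n times larger, so the dyadic
  maximal function controls averages over all cubes.\<close>

lemma A1_majorantI:
  fixes H :: "real ^ 'n \<Rightarrow> ennreal"
  assumes "\<And>x. dyadic_maximal H x \<le> ennreal B * H x" "0 \<le> B"
  shows "A1_majorant (6 ^ CARD('n) * B) H"
  unfolding A1_majorant_def
proof (intro ballI)
  fix Q :: "(real ^ 'n) set" and x assume Q: "Q \<in> cubes" and x: "x \<in> Q"
  obtain P where P: "P \<in> dyadic_cubes" "Q \<subseteq> P" "emeasure lebesgue P \<le> ennreal (6 ^ CARD('n)) * emeasure lebesgue Q"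
    using Q by (rule cube_in_dyadic)
  let ?c = "6 ^ CARD('n) :: real"
  obtain m where m: "emeasure lebesgue Q = ennreal m" "0 < m"
    using Q by (rule cube_emeasure_real)
  obtain R where "R \<in> cubes" "P \<subseteq> R" "emeasure lebesgue P = emeasure lebesgue R" using P(1) by (rule dyadic_in_cube)
  then obtain m' where m': "emeasure lebesgue P = ennreal m'" "0 < m'"
    using cube_emeasure_real[of R] by metis
  have "ennreal m' \<le> ennreal (?c * m)" using P(3) m m' by (simp add: ennreal_mult)
  then have "m' \<le> ?c * m" using m by (subst (asm) ennreal_le_iff) auto
  then have mm: "1 / m \<le> ?c * (1 / m')" using m m' by (simp add: field_simps)
  have "set_average lebesgue H Q = (\<integral>\<^sup>+x\<in>Q. H x \<partial>lebesgue) * ennreal (1 / m)"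
    unfolding set_average_def using m by (simp add: ennreal_divide_real)
  also have "\<dots> \<le> (\<integral>\<^sup>+x\<in>P. H x \<partial>lebesgue) * ennreal (?c * (1 / m'))"
    using mm P(2) by (intro mult_mono nn_set_integral_set_mono ennreal_leI) auto
  also have "\<dots> = ennreal ?c * set_average lebesgue H P"
  proof -
    have "ennreal (?c * (1 / m')) = ennreal ?c * ennreal (1 / m')"
      by (rule ennreal_mult) (use m' in auto)
    then show ?thesis unfolding set_average_def m'(1) ennreal_divide_real[OF m'(2)]
      by (simp only: mult_ac)
  qed
  also have "\<dots> \<le> ennreal ?c * (ennreal B * H x)"
    using maximal_upper[of P dyadic_cubes x lebesgue H] P(1,2) x assms(1)[of x]
    by (intro mult_left_mono) (auto intro: order_trans)
  finally show "set_average lebesgue H Q \<le> ennreal (?c * B) * H x"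
    using assms(2) by (simp add: ennreal_mult mult.assoc)
qed

text \<open>A zero at x makes the averages over all cubes containing x vanish, and the cubes centred
  at x exhaust the space. Consequently a nontrivial majorant has no zeros and admits negative
  powers.\<close>

lemma A1_majorant_zero:
  fixes H :: "real ^ 'n \<Rightarrow> ennreal"
  assumes [measurable]: "H \<in> borel_measurable lebesgue" and A: "A1_majorant B H" and x: "H x = 0"
  shows "AE y in lebesgue. H y = 0"
proof -
  have "AE y in lebesgue. y \<in> ccube x (real (Suc j)) \<longrightarrow> H y = 0" for j
  proof -
    define Q where "Q = ccube x (real (Suc j))"
    have Q: "Q \<in> cubes" unfolding Q_def by (intro ccube_in_cubes) simp
    note [measurable] = cube_emeasure(3)[OF Q]
    have "x \<in> Q" by (simp add: mem_ccube Q_def)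
    then have "set_average lebesgue H Q = 0" using A Q x unfolding A1_majorant_def by fastforce
    then have "(\<integral>\<^sup>+y. H y * indicator Q y \<partial>lebesgue) = 0"
      using cube_emeasure(2)[OF Q] unfolding set_average_def by (auto simp: ennreal_divide_eq_0_iff)
    then have "AE y in lebesgue. H y * indicator Q y = 0"
      by (subst (asm) nn_integral_0_iff_AE) auto
    then show ?thesis unfolding Q_def by eventually_elim (auto simp: indicator_def)
  qed
  then have "AE y in lebesgue. \<forall>j. y \<in> ccube x (real (Suc j)) \<longrightarrow> H y = 0"
    unfolding AE_all_countable by blast
  then show ?thesis
  proof eventually_elim
    fix y assume "\<forall>j. y \<in> ccube x (real (Suc j)) \<longrightarrow> H y = 0"
    then show "H y = 0" using UN_ccube[of x] by blast
  qed
qed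

section \<open>Muckenhoupt weights from majorants\<close>

definition weighted_integral :: "real \<Rightarrow> (real ^ 'n \<Rightarrow> real) \<Rightarrow> (real ^ 'n) set \<Rightarrow> (real ^ 'n \<Rightarrow> real) \<Rightarrow> ennreal" where
  "weighted_integral p w E f = (\<integral>\<^sup>+x\<in>E. ennreal (norm (f x) powr p * w x) \<partial>lebesgue)"

definition extrapolation_pairs :: "((real ^ 'n \<Rightarrow> real) \<times> (real ^ 'n \<Rightarrow> real)) set \<Rightarrow> bool" where
  "extrapolation_pairs F \<longleftrightarrow> (\<forall>(f, g)\<in>F. f \<in> borel_measurable lebesgue \<and> g \<in> borel_measurable lebesgue \<and>
     (\<forall>x. 0 \<le> f x \<and> 0 \<le> g x))"

text \<open>The flag \<open>fin\<close> tells whether the inequality is only claimed when its left-hand side is finite.\<close>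

definition weighted_estimate :: "real \<Rightarrow> real \<Rightarrow> bool \<Rightarrow> real \<Rightarrow> ((real ^ 'n \<Rightarrow> real) \<times> (real ^ 'n \<Rightarrow> real)) set \<Rightarrow> bool" where
  "weighted_estimate C K fin p F \<longleftrightarrow> (\<forall>w f g. w \<in> muckenhoupt p \<longrightarrow> muckenhoupt_const p w \<le> ennreal K \<longrightarrow> (f, g) \<in> F \<longrightarrow>
     (fin \<longrightarrow> weighted_integral p w UNIV g < top) \<longrightarrow>
     weighted_integral p w UNIV g \<le> ennreal C * weighted_integral p w UNIV f)"

text \<open>The constant may depend on the weight only through an upper bound K for the
  characteristic; this is what allows weights that vary with the pair or with the cube.\<close>

definition weighted_bound :: "bool \<Rightarrow> real \<Rightarrow> ((real ^ 'n \<Rightarrow> real) \<times> (real ^ 'n \<Rightarrow> real)) set \<Rightarrow> bool" where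
  "weighted_bound fin p F \<longleftrightarrow> (\<forall>K. \<exists>C>0. weighted_estimate C K fin p F)"

lemma weighted_estimateI:
  "(\<And>w f g. w \<in> muckenhoupt p \<Longrightarrow> muckenhoupt_const p w \<le> ennreal K \<Longrightarrow> (f, g) \<in> F \<Longrightarrow>
     (fin \<longrightarrow> weighted_integral p w UNIV g < top) \<Longrightarrow>
     weighted_integral p w UNIV g \<le> ennreal C * weighted_integral p w UNIV f) \<Longrightarrow> weighted_estimate C K fin p F"
  by (simp add: weighted_estimate_def)

lemma weighted_estimateD:
  "weighted_estimate C K fin p F \<Longrightarrow> w \<in> muckenhoupt p \<Longrightarrow> muckenhoupt_const p w \<le> ennreal K \<Longrightarrow> (f, g) \<in> F \<Longrightarrow>
     (fin \<Longrightarrow> weighted_integral p w UNIV g < top) \<Longrightarrow>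
     weighted_integral p w UNIV g \<le> ennreal C * weighted_integral p w UNIV f"
  by (simp add: weighted_estimate_def)

lemma weight_of_average: "set_average lebesgue (\<lambda>x. ennreal (w x)) Q = cube_average w Q"
  unfolding set_average_def cube_average_def weight_of_def ..

lemma set_average_times:
  assumes "emeasure M Q = ennreal m" "0 < m"
  shows "(\<integral>\<^sup>+x\<in>Q. f x \<partial>M) = set_average M f Q * ennreal m"
proof -
  have "ennreal (1 / m) * ennreal m = 1" using assms(2) by (simp flip: ennreal_mult)
  then show ?thesis unfolding set_average_def assms(1) ennreal_divide_real[OF assms(2)]
    by (simp add: mult.assoc)
qed

text \<open>The easy half of the factorization of Muckenhoupt weights.\<close>

lemma factored_weight_muckenhoupt:
  fixes H V :: "real ^ 'n \<Rightarrow> ennreal"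
  assumes H [measurable]: "H \<in> borel_measurable lebesgue" and V [measurable]: "V \<in> borel_measurable lebesgue"
    and AH: "A1_majorant B H" and AV: "A1_majorant B V" and B: "0 < B"
    and pos: "\<And>x. 0 < H x" "\<And>x. 0 < V x"
    and fin: "AE x in lebesgue. H x < top" "AE x in lebesgue. V x < top"
    and q: "1 \<le> q"
  defines "u \<equiv> \<lambda>x. enn2real (H x) powr (1 - q) * enn2real (V x)"
  shows "u \<in> muckenhoupt q" "muckenhoupt_const q u \<le> ennreal (B powr q)"
proof -
  have [measurable]: "u \<in> borel_measurable lebesgue" unfolding u_def by measurable
  have u0: "0 \<le> u x" for x by (simp add: u_def)
  \<comment> \<open>On each cube both majorants have a finite positive average a and are bounded
    below there by a / B. These two facts replace the essential infimum in the usual proof.\<close>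
  have avg: "\<exists>a>0. set_average lebesgue G Q = ennreal a \<and> (\<forall>x\<in>Q. ennreal (a / B) \<le> G x)"
    if Q: "Q \<in> cubes" and A: "A1_majorant B G" and pos: "\<And>x. 0 < G x" and fin: "AE x in lebesgue. G x < top"
      and [measurable]: "G \<in> borel_measurable lebesgue" for Q and G :: "real ^ 'n \<Rightarrow> ennreal"
  proof -
    note [measurable] = cube_emeasure(3)[OF Q]
    have le: "set_average lebesgue G Q \<le> ennreal B * G x" if "x \<in> Q" for x
      using A Q that unfolding A1_majorant_def by blast
    obtain x where x: "x \<in> Q" "G x < top"
    proof (rule ccontr)
      assume "\<not> thesis"
      then have "\<forall>x\<in>Q. \<not> G x < top" using that by blast
      then have "AE x in lebesgue. x \<notin> Q" using fin by (auto elim: eventually_mono)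
      then have "emeasure lebesgue Q = 0" by (subst (asm) AE_iff_measurable[of Q]) auto
      then show False using cube_emeasure(1)[OF Q] by simp
    qed
    have "set_average lebesgue G Q < top"
      using le[OF x(1)] x(2) by (auto simp: ennreal_mult_less_top intro: le_less_trans)
    moreover have "0 < set_average lebesgue G Q"
    proof (rule ccontr)
      assume "\<not> 0 < set_average lebesgue G Q"
      then have "(\<integral>\<^sup>+x. G x * indicator Q x \<partial>lebesgue) = 0"
        using cube_emeasure(2)[OF Q] unfolding set_average_def by (auto simp: ennreal_divide_eq_0_iff)
      then have "AE x in lebesgue. G x * indicator Q x = 0" by (subst (asm) nn_integral_0_iff_AE) auto
      then have "AE x in lebesgue. x \<notin> Q"
      proof eventually_elim
        fix x assume "G x * indicator Q x = 0"
        then show "x \<notin> Q" using pos[of x] by (auto simp: indicator_def split: if_splits)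
      qed
      then have "emeasure lebesgue Q = 0" by (subst (asm) AE_iff_measurable[of Q]) auto
      then show False using cube_emeasure(1)[OF Q] by simp
    qed
    ultimately obtain a where a: "0 < a" "set_average lebesgue G Q = ennreal a"
      by (cases "set_average lebesgue G Q") auto
    moreover have "ennreal (a / B) \<le> G x" if "x \<in> Q" for x
    proof -
      have "ennreal a \<le> G x * ennreal B" using le[OF that] a by (simp add: mult.commute)
      then have "ennreal a * ennreal (1 / B) \<le> G x" using B by (simp add: ennreal_mult_inverse_le_iff)
      then show ?thesis using a B by (simp flip: ennreal_mult)
    qed
    ultimately show ?thesis by blast
  qed
  have cube: "\<exists>h v m. 0 < h \<and> 0 < v \<and> 0 < m \<and> emeasure lebesgue Q = ennreal m \<and>
      cube_average u Q \<le> ennreal ((h / B) powr (1 - q) * v) \<and>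
      (\<forall>x\<in>Q. ennreal (h / B) \<le> H x) \<and> (\<forall>x\<in>Q. ennreal (v / B) \<le> V x) \<and>
      set_average lebesgue H Q = ennreal h \<and> set_average lebesgue V Q = ennreal v" if Q: "Q \<in> cubes" for Q
  proof -
    note [measurable] = cube_emeasure(3)[OF Q]
    obtain h where h: "0 < h" "set_average lebesgue H Q = ennreal h" "\<forall>x\<in>Q. ennreal (h / B) \<le> H x"
      using avg[OF Q AH pos(1) fin(1) H] by blast
    obtain v where v: "0 < v" "set_average lebesgue V Q = ennreal v" "\<forall>x\<in>Q. ennreal (v / B) \<le> V x"
      using avg[OF Q AV pos(2) fin(2) V] by blast
    obtain m where m: "emeasure lebesgue Q = ennreal m" "0 < m" using Q by (rule cube_emeasure_real)
    have le: "ennreal (u x) \<le> ennreal ((h / B) powr (1 - q)) * V x" if "x \<in> Q" for x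
    \<comment> \<open>Where H or V is infinite, \<open>enn2real top = 0\<close> makes u vanish and
      the estimate is trivial.\<close>
    proof (cases "H x = top \<or> V x = top")
      case True
      then show ?thesis by (auto simp: u_def)
    next
      case False
      then obtain a b where ab: "0 \<le> a" "0 \<le> b" "H x = ennreal a" "V x = ennreal b"
        by (cases "H x"; cases "V x") auto
      then have "h / B \<le> a" using h(3) that by auto
      then have "a powr (1 - q) \<le> (h / B) powr (1 - q)" using h(1) B q by (intro powr_mono2') auto
      then have "a powr (1 - q) * b \<le> (h / B) powr (1 - q) * b" using ab by (intro mult_right_mono) auto
      then show ?thesis using ab by (simp add: u_def ennreal_leI flip: ennreal_mult)
    qed
    have "set_average lebesgue (\<lambda>x. ennreal (u x)) Q \<le> set_average lebesgue (\<lambda>x. ennreal ((h / B) powr (1 - q)) * V x) Q"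
      using le by (rule set_average_mono)
    also have "\<dots> = ennreal ((h / B) powr (1 - q)) * set_average lebesgue V Q"
      unfolding set_average_def by (simp add: mult.assoc nn_integral_cmult ennreal_times_divide)
    also have "\<dots> = ennreal ((h / B) powr (1 - q) * v)" using v(1,2) by (simp add: ennreal_mult)
    finally have "cube_average u Q \<le> ennreal ((h / B) powr (1 - q) * v)" by (simp add: weight_of_average)
    then show ?thesis using h v m by blast
  qed
  have "weight_of u Q < top" if Q: "Q \<in> cubes" for Q
  proof -
    obtain c m where c: "0 < m" "emeasure lebesgue Q = ennreal m" "cube_average u Q \<le> ennreal c"
      using cube[OF Q] by blast
    have "weight_of u Q = cube_average u Q * ennreal m"
      using set_average_times[OF c(2,1), of "\<lambda>x. ennreal (u x)"] unfolding weight_of_average by (simp add: weight_of_def)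
    also have "\<dots> < top" using c(3) by (auto simp: ennreal_mult_less_top intro: le_less_trans)
    finally show ?thesis .
  qed
  then have "weight u" unfolding weight_iff using u0 by auto
  have AEfin: "AE x in lebesgue. \<exists>a b. 0 < a \<and> 0 < b \<and> H x = ennreal a \<and> V x = ennreal b"
    using fin
  proof eventually_elim
    case (elim x)
    then show ?case using pos[of x] by (cases "H x"; cases "V x") auto
  qed
  then have upos: "AE x in lebesgue. 0 < u x"
    by eventually_elim (auto simp: u_def)
  show const: "muckenhoupt_const q u \<le> ennreal (B powr q)"
  proof (cases "q = 1")
    case True
    have "AE x in lebesgue. x \<in> Q \<longrightarrow> cube_average u Q \<le> ennreal B * ennreal (u x)" if Q: "Q \<in> cubes" for Q
      using AEfin
    proof eventually_elim
      case (elim x)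
      then obtain a b where ab: "0 < a" "0 < b" "H x = ennreal a" "V x = ennreal b" by blast
      obtain h v m where hv: "0 < h" "0 < v" "cube_average u Q \<le> ennreal ((h / B) powr (1 - q) * v)"
        "\<forall>x\<in>Q. ennreal (v / B) \<le> V x" using cube[OF Q] by blast
      show ?case
      proof
        assume "x \<in> Q"
        then have "v / B \<le> b" using hv ab by auto
        then have "v \<le> B * b" using B by (simp add: field_simps)
        then have "ennreal v \<le> ennreal B * ennreal (u x)"
          using ab B True by (simp add: u_def ennreal_leI flip: ennreal_mult)
        then show "cube_average u Q \<le> ennreal B * ennreal (u x)"
          using hv True B by auto
      qed
    qed
    then have "muckenhoupt_const q u \<le> ennreal B"
      unfolding muckenhoupt_const_def using True by (auto intro!: Inf_lower)
    then show ?thesis using True B by simp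
  next
    case False
    then have q: "1 < q" using q by simp
    define t where "t = 1 - q / (q - 1)"
    have t: "t = - 1 / (q - 1)" "t < 0" "(1 - q) * t = 1" "t * (q - 1) = - 1"
      using q by (auto simp: t_def field_simps)
    show ?thesis unfolding muckenhoupt_const_le_iff[OF q] t_def[symmetric]
    proof
      fix Q :: "(real ^ 'n) set" assume Q: "Q \<in> cubes"
      note [measurable] = cube_emeasure(3)[OF Q]
      obtain h v m where hv: "0 < h" "0 < v" "0 < m" "emeasure lebesgue Q = ennreal m"
        "cube_average u Q \<le> ennreal ((h / B) powr (1 - q) * v)"
        "\<forall>x\<in>Q. ennreal (v / B) \<le> V x" "set_average lebesgue H Q = ennreal h" using cube[OF Q] by blast
      have 1: "weight_of u Q \<le> ennreal ((h / B) powr (1 - q) * v) * ennreal m"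
      proof -
        have "weight_of u Q = cube_average u Q * ennreal m"
          using set_average_times[OF hv(4,3), of "\<lambda>x. ennreal (u x)"] unfolding weight_of_average by (simp add: weight_of_def)
        then show ?thesis using hv(5) by (simp add: mult_right_mono)
      qed
      have le: "ennreal (u x powr t) \<le> ennreal ((v / B) powr t) * H x" if "x \<in> Q" for x
      \<comment> \<open>Again u vanishes at such points, and \<open>0 powr t = 0\<close> even though
        t is negative.\<close>
      proof (cases "H x = top \<or> V x = top")
        case True
        then show ?thesis by (auto simp: u_def)
      next
        case False
        then obtain a b where ab: "0 < a" "0 < b" "H x = ennreal a" "V x = ennreal b"
          using pos[of x] by (cases "H x"; cases "V x") auto
        then have "v / B \<le> b" using hv that by auto
        then have "b powr t \<le> (v / B) powr t" using hv(2) B t(2) by (intro powr_mono2') auto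
        moreover have "u x powr t = a * b powr t"
          using ab t(3) by (simp add: u_def powr_mult powr_powr)
        ultimately have "u x powr t \<le> (v / B) powr t * a" using ab by (simp add: mult.commute mult_right_mono)
        then show ?thesis using ab by (simp add: ennreal_leI flip: ennreal_mult)
      qed
      have "weight_of (\<lambda>x. u x powr t) Q \<le> (\<integral>\<^sup>+x\<in>Q. ennreal ((v / B) powr t) * H x \<partial>lebesgue)"
        unfolding weight_of_def using le by (intro nn_integral_mono) (auto simp: indicator_def)
      also have "\<dots> = ennreal ((v / B) powr t) * (\<integral>\<^sup>+x\<in>Q. H x \<partial>lebesgue)"
        by (simp add: mult.assoc nn_integral_cmult)
      also have "\<dots> = ennreal ((v / B) powr t * (h * m))"
        using hv by (simp add: set_average_times[OF hv(4,3)] ennreal_mult)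
      finally have 2: "weight_of (\<lambda>x. u x powr t) Q \<le> ennreal ((v / B) powr t * (h * m))" .
      have "weight_of u Q * ennreal_power (weight_of (\<lambda>x. u x powr t) Q) (q - 1)
        \<le> (ennreal ((h / B) powr (1 - q) * v) * ennreal m) * ennreal_power (ennreal ((v / B) powr t * (h * m))) (q - 1)"
        using q 1 2 by (intro mult_mono ennreal_power_mono) auto
      also have "\<dots> = ennreal ((h / B) powr (1 - q) * v * m * ((v / B) powr t * (h * m)) powr (q - 1))"
        using q hv by (subst ennreal_power_ennreal) (auto simp: ennreal_mult)
      \<comment> \<open>Averages of H and V cancel; the majorant constant enters with power q - 1
        through H^(1-q) and once through the dual exponent applied to V.\<close>
      also have "(h / B) powr (1 - q) * v * m * ((v / B) powr t * (h * m)) powr (q - 1)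
        = (h powr (1 - q) * h powr (q - 1)) * (B powr (q - 1) * B) * (m * m powr (q - 1))"
      proof -
        have "((v / B) powr t * (h * m)) powr (q - 1) = (B / v) * (h powr (q - 1) * m powr (q - 1))"
          using hv B t(4) by (simp add: powr_mult powr_powr powr_minus_divide)
        moreover have "(h / B) powr (1 - q) = h powr (1 - q) * B powr (q - 1)"
          using hv B by (simp add: powr_divide powr_minus_divide[of B "q - 1", simplified])
        ultimately show ?thesis using hv by simp
      qed
      also have "\<dots> = B powr q * m powr q"
        using hv B by (simp add: powr_diff)
      also have "ennreal \<dots> = ennreal (B powr q) * ennreal_power (emeasure lebesgue Q) q"
        using hv q by (simp add: ennreal_power_ennreal ennreal_mult)
      finally show "weight_of u Q * ennreal_power (weight_of (\<lambda>x. u x powr t) Q) (q - 1)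
        \<le> ennreal (B powr q) * ennreal_power (emeasure lebesgue Q) q" .
    qed
  qed
  show "u \<in> muckenhoupt q"
    unfolding muckenhoupt_def using \<open>weight u\<close> upos const by (auto simp: infinity_ennreal_def intro: le_less_trans)
qed

section \<open>Extrapolation\<close>

definition majorant_const :: "'n::finite itself \<Rightarrow> real \<Rightarrow> real \<Rightarrow> real" where
  "majorant_const T p K = 6 ^ CARD('n) * (2 * (2 * maximal_const T p K) powr (1 / p))"

lemma A1_majorant_exists:
  fixes w s :: "real ^ 'n \<Rightarrow> ennreal"
  assumes w [measurable]: "w \<in> borel_measurable lebesgue" and s [measurable]: "s \<in> borel_measurable lebesgue"
    and ws: "AE x in lebesgue. 0 < w x \<and> w x < top \<and> s x = ennreal_power (w x) (- 1 / (p - 1))"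
    and p: "1 < p" and K: "0 < K"
    and Ap: "\<And>Q. Q \<in> cubes \<Longrightarrow> (\<integral>\<^sup>+x\<in>Q. w x \<partial>lebesgue) * ennreal_power (\<integral>\<^sup>+x\<in>Q. s x \<partial>lebesgue) (p - 1)
      \<le> ennreal K * ennreal_power (emeasure lebesgue Q) p"
    and f [measurable]: "f \<in> borel_measurable lebesgue"
  obtains H where "H \<in> borel_measurable lebesgue" "\<And>x. f x \<le> H x"
    "(\<integral>\<^sup>+x. ennreal_power (H x) p * w x \<partial>lebesgue) \<le> ennreal (2 * 2 powr p) * (\<integral>\<^sup>+x. ennreal_power (f x) p * w x \<partial>lebesgue)"
    "A1_majorant (majorant_const TYPE('n) p K) H"
proof -
  have "0 < p" using p by simp
  obtain H where H: "H \<in> borel_measurable lebesgue" "\<And>x. f x \<le> H x"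
    "(\<integral>\<^sup>+x. ennreal_power (H x) p * w x \<partial>lebesgue) \<le> ennreal (2 * 2 powr p) * (\<integral>\<^sup>+x. ennreal_power (f x) p * w x \<partial>lebesgue)"
    "\<And>x. dyadic_maximal H x \<le> ennreal (2 * (2 * maximal_const TYPE('n) p K) powr (1 / p)) * H x"
    using rubio_de_francia[OF countable_dyadic_cubes dyadic_cubes_sets w \<open>0 < p\<close> maximal_const_pos[OF p K, where 'n='n]
       dyadic_maximal_weighted[OF w s ws p K Ap] f] by blast
  have "A1_majorant (majorant_const TYPE('n) p K) H"
    unfolding majorant_const_def by (rule A1_majorantI[OF H(4)]) simp
  then show ?thesis using that H by blast
qed

text \<open>If H had a zero, it would vanish almost everywhere, and so would f below it.\<close>

lemma positive_of_A1_majorant: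
  fixes H :: "real ^ 'n \<Rightarrow> ennreal"
  assumes "H \<in> borel_measurable lebesgue" "A1_majorant B H" "\<And>x. f x \<le> H x" "\<not> (AE x in lebesgue. f x = 0)"
  shows "0 < H x"
proof (rule ccontr)
  assume "\<not> 0 < H x"
  then have "AE y in lebesgue. H y = 0" using assms A1_majorant_zero[of H B x] by simp
  then have "AE y in lebesgue. f y = 0"
    by eventually_elim (metis assms(3) le_zero_eq)
  then show False using assms by simp
qed

lemma finite_AE_of_weighted_integral:
  fixes H w :: "'a \<Rightarrow> ennreal"
  assumes [measurable]: "H \<in> borel_measurable M" "w \<in> borel_measurable M" and w: "AE x in M. 0 < w x"
    and p: "0 < p" and I: "(\<integral>\<^sup>+x. ennreal_power (H x) p * w x \<partial>M) < top"
  shows "AE x in M. H x < top"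
proof -
  have "AE x in M. ennreal_power (H x) p * w x \<noteq> \<infinity>"
    using I by (intro nn_integral_PInf_AE) (auto simp: infinity_ennreal_def)
  then show ?thesis using w
  proof eventually_elim
    case (elim x)
    then show ?case using p by (cases "H x") (auto simp: ennreal_power_top ennreal_top_mult split: if_splits)
  qed
qed

text \<open>The two terms on the right balance at a = (b / w)^(1/(p-1)); below this point the second
  one alone dominates a * b, above it the first one does.\<close>

lemma young_weighted:
  assumes p: "1 < p" and w: "0 < w" and a: "0 \<le> a" and b: "0 \<le> (b::real)"
  shows "a * b \<le> a powr p * w + b powr (p / (p - 1)) * w powr (1 - p / (p - 1))"
proof -
  define s where "s = 1 / (p - 1)"
  have s: "p / (p - 1) = 1 + s" "0 < s" "s * (p - 1) = 1" using p by (auto simp: s_def field_simps)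
  define t where "t = (b / w) powr s"
  show ?thesis
  proof (cases "a \<le> t")
    case True
    then have "a * b \<le> t * b" using b by (rule mult_right_mono)
    also have "t * b = b powr (p / (p - 1)) * w powr (1 - p / (p - 1))"
    proof (cases "b = 0")
      case False
      then show ?thesis unfolding t_def s(1) using w b by (simp add: powr_divide powr_add powr_minus_divide)
    qed (use s in simp)
    finally show ?thesis using w by (simp add: add_increasing)
  next
    case False
    then have "t powr (p - 1) \<le> a powr (p - 1)" using p by (intro powr_mono2) (auto simp: t_def)
    moreover have "t powr (p - 1) = b / w" using b w s(3) by (simp add: t_def powr_powr)
    ultimately have "b \<le> a powr (p - 1) * w" using w by (simp add: field_simps)
    then have "a * b \<le> a * (a powr (p - 1) * w)" using a by (rule mult_left_mono)
    also have "\<dots> = a powr p * w"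
      using a by (cases "a = 0") (auto simp: powr_diff)
    finally show ?thesis using w by (simp add: add_increasing2)
  qed
qed

text \<open>If g exceeds d * H, then the negative power 1 - q reverses the comparison and the second
  term alone dominates. Integrated, with d chosen suitably, this serves as Hoelder's
  inequality.\<close>

lemma young_scaled:
  assumes q: "1 \<le> q" and d: "0 < d" and H: "0 < H" and g: "0 \<le> (g::real)"
  shows "g \<le> d * H + d powr (1 - q) * (g powr q * H powr (1 - q))"
proof (cases "g \<le> d * H")
  case True
  then show ?thesis by (simp add: add_increasing2)
next
  case False
  then have g: "0 < g" "d * H \<le> g" using d H mult_pos_pos[OF d H] by linarith+
  have "g powr (1 - q) \<le> (d * H) powr (1 - q)" using q d H g by (intro powr_mono2') auto
  then have "g powr q * g powr (1 - q) \<le> g powr q * (d * H) powr (1 - q)" by (rule mult_left_mono) simp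
  also have "g powr q * g powr (1 - q) = g" using g by (simp flip: powr_add)
  also have "g powr q * (d * H) powr (1 - q) = d powr (1 - q) * (g powr q * H powr (1 - q))"
    using d H by (simp add: powr_mult)
  finally show ?thesis using d H by (simp add: add_increasing)
qed

text \<open>The customary cases p < q and p > q are handled at once. Let \<beta> be the integral of
  g^p w and l the factor that scales f to the size of g. Take A_1 majorants \<open>H\<close> of g +
  l f in L_p(w) and \<open>V\<close> of g^(p-1) w in the dual space L_p'(w^(1-p')). Then u = H^(1-q)
  V is in A_q with controlled characteristic, \<beta> is at most the integral of g V, and J, the
  integral of H V, is at most c \<beta>. As g and l f lie below H, the integrals of g^q u and f^q u
  are at most J and l^(-q) J. The hypothesis in L_q(u) improves the former to C1 l^(-q) J, whence
  \<beta> \<le> (1 + C1) J / l. This bounds l and thereby the ratio of the two integrals.\<close>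

theorem extrapolation_finite:
  fixes F :: "((real ^ 'n \<Rightarrow> real) \<times> (real ^ 'n \<Rightarrow> real)) set"
  assumes F: "extrapolation_pairs F" and q: "1 \<le> q" and bd: "weighted_bound True q F" and p: "1 < p"
  shows "weighted_bound True p F"
  unfolding weighted_bound_def
proof
  fix K0 :: real
  define K where "K = max K0 1"
  have K: "0 < K" "K0 \<le> K" by (auto simp: K_def)
  define p' where "p' = p / (p - 1)"
  have p': "1 < p'" "p' - 1 = 1 / (p - 1)" "1 - p' = - 1 / (p - 1)" "p' / (p' - 1) = p" "(p - 1) * p' = p"
     "- 1 / (p' - 1) = - (p - 1)"
    using p by (auto simp: p'_def field_simps)
  \<comment> \<open>The dual weight w^(1-p') satisfies the A_p' condition with this constant: raise
    the A_p condition for w to the power p' - 1.\<close>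
  define K' where "K' = K powr (p' - 1)"
  have K': "0 < K'" using K by (simp add: K'_def)
  define B where "B = max (majorant_const TYPE('n) p K) (max (majorant_const TYPE('n) p' K') 1)"
  have B: "0 < B" by (auto simp: B_def)
  obtain C1 where C1: "0 < C1" "weighted_estimate C1 (B powr q) True q F"
    using bd unfolding weighted_bound_def by blast
  \<comment> \<open>One factor 2 * 2 powr p comes from the p-th power of the sum g + l f, the other
    from passing to its majorant H; the last summand comes from passing to V.\<close>
  define c where "c = 2 * 2 powr p * (2 * 2 powr p) + 2 * 2 powr p'"
  have c: "0 < c" by (simp add: c_def add_pos_pos)
  define C where "C = ((1 + C1) * c) powr p"
  have C: "0 < C" using C1 c by (simp add: C_def add_pos_pos)
  show "\<exists>C>0. weighted_estimate C K0 True p F"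
  proof (intro exI[of _ C] conjI C weighted_estimateI)
    fix w f g assume w: "w \<in> muckenhoupt p" "muckenhoupt_const p w \<le> ennreal K0" and fg: "(f, g) \<in> F"
      and "True \<longrightarrow> weighted_integral p w UNIV g < top"
    then have fin: "weighted_integral p w UNIV g < top" by simp
    have [measurable]: "f \<in> borel_measurable lebesgue" "g \<in> borel_measurable lebesgue" and f0: "0 \<le> f x" and g0: "0 \<le> g x" for x
      using F fg by (auto simp: extrapolation_pairs_def)
    have [measurable]: "w \<in> borel_measurable lebesgue" and w0: "0 \<le> w x" and wpos: "AE x in lebesgue. 0 < w x" for x
      using w by (auto simp: muckenhoupt_def weight_def)
    define s where "s x = w x powr (1 - p')" for x
    have [measurable]: "s \<in> borel_measurable lebesgue" unfolding s_def by measurable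
    have Ap: "(\<integral>\<^sup>+x\<in>Q. ennreal (w x) \<partial>lebesgue) * ennreal_power (\<integral>\<^sup>+x\<in>Q. ennreal (s x) \<partial>lebesgue) (p - 1)
      \<le> ennreal K * ennreal_power (emeasure lebesgue Q) p" if "Q \<in> cubes" for Q
    proof -
      have "muckenhoupt_const p w \<le> ennreal K" using w(2) K(2) by (auto intro: order_trans ennreal_leI)
      then show ?thesis using that unfolding muckenhoupt_const_le_iff[OF p] weight_of_def s_def p'_def by blast
    qed
    have Ap': "(\<integral>\<^sup>+x\<in>Q. ennreal (s x) \<partial>lebesgue) * ennreal_power (\<integral>\<^sup>+x\<in>Q. ennreal (w x) \<partial>lebesgue) (p' - 1)
      \<le> ennreal K' * ennreal_power (emeasure lebesgue Q) p'" if "Q \<in> cubes" for Q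
    proof -
      have "ennreal_power ((\<integral>\<^sup>+x\<in>Q. ennreal (w x) \<partial>lebesgue) * ennreal_power (\<integral>\<^sup>+x\<in>Q. ennreal (s x) \<partial>lebesgue) (p - 1)) (p' - 1)
        \<le> ennreal_power (ennreal K * ennreal_power (emeasure lebesgue Q) p) (p' - 1)"
        using Ap[OF that] p' by (intro ennreal_power_mono) auto
      moreover have "(p - 1) * (p' - 1) = 1" "p * (p' - 1) = p'" using p by (auto simp: p'_def field_simps)
      ultimately show ?thesis using p p'(1) K by (simp add: ennreal_power_mult ennreal_power_power ennreal_power_ennreal K'_def mult.commute)
    qed
    have AEw: "AE x in lebesgue. 0 < ennreal (w x) \<and> ennreal (w x) < top \<and> ennreal (s x) = ennreal_power (ennreal (w x)) (- 1 / (p - 1))"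
      using wpos by eventually_elim (simp add: s_def p' ennreal_power_ennreal_pos)
    have AEs: "AE x in lebesgue. 0 < ennreal (s x) \<and> ennreal (s x) < top \<and> ennreal (w x) = ennreal_power (ennreal (s x)) (- 1 / (p' - 1))"
      using wpos
    proof eventually_elim
      case (elim x)
      have "(1 - p') * (- 1 / (p' - 1)) = 1" using p'(1) by (simp add: divide_simps)
      then have "s x powr (- 1 / (p' - 1)) = w x" using elim by (simp only: s_def powr_powr powr_one)
      then show ?case using elim by (simp add: s_def ennreal_power_ennreal_pos)
    qed
    obtain \<beta> where \<beta>: "0 \<le> \<beta>" "weighted_integral p w UNIV g = ennreal \<beta>"
      using fin by (cases "weighted_integral p w UNIV g") auto
    \<comment> \<open>Working with any positive bound \<alpha> for the integral of f^p w keeps l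
      defined when that integral is 0; the infimum over \<alpha> is taken at the end.\<close>
    have main: "\<beta> \<le> C * \<alpha>" if \<alpha>: "0 < \<alpha>" "weighted_integral p w UNIV f \<le> ennreal \<alpha>" and "0 < \<beta>" for \<alpha>
    proof -
      define l where "l = (\<beta> / \<alpha>) powr (1 / p)"
      have l: "0 < l" "l powr p = \<beta> / \<alpha>" using \<alpha> \<open>0 < \<beta>\<close> p by (auto simp: l_def powr_powr)
      define h where "h x = ennreal (g x + l * f x)" for x
      have [measurable]: "h \<in> borel_measurable lebesgue" unfolding h_def by measurable
      \<comment> \<open>This is the function extremal in the duality of L_p(w): g * k = g^p w, and
        the p'-th power of k against w^(1-p') again has integral \<beta>.\<close>
      define k where "k x = ennreal (g x powr (p - 1) * w x)" for x
      have [measurable]: "k \<in> borel_measurable lebesgue" unfolding k_def by measurable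
      have Ih: "(\<integral>\<^sup>+x. ennreal_power (h x) p * ennreal (w x) \<partial>lebesgue) \<le> ennreal (2 * 2 powr p * \<beta>)"
      proof -
        have "(\<integral>\<^sup>+x. ennreal_power (h x) p * ennreal (w x) \<partial>lebesgue)
          \<le> (\<integral>\<^sup>+x. ennreal (2 powr p) * (ennreal (norm (g x) powr p * w x) + ennreal (l powr p) * ennreal (norm (f x) powr p * w x)) \<partial>lebesgue)"
        proof (rule nn_integral_mono)
          fix x
          have "(g x + l * f x) powr p \<le> (2 * max (g x) (l * f x)) powr p"
            using f0[of x] g0[of x] l p by (intro powr_mono2) auto
          also have "\<dots> = 2 powr p * max (g x) (l * f x) powr p"
            using f0[of x] g0[of x] l by (subst powr_mult) auto
          also have "max (g x) (l * f x) powr p \<le> g x powr p + l powr p * f x powr p"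
            using f0[of x] g0[of x] l \<alpha>(1) \<open>0 < \<beta>\<close> by (auto simp: max_def powr_mult add_increasing add_increasing2)
          finally have "(g x + l * f x) powr p * w x \<le> 2 powr p * (g x powr p + l powr p * f x powr p) * w x"
            using w0[of x] by (simp add: mult_right_mono)
          also have "\<dots> = 2 powr p * (g x powr p * w x + l powr p * (f x powr p * w x))" by (simp add: algebra_simps)
          finally show "ennreal_power (h x) p * ennreal (w x)
            \<le> ennreal (2 powr p) * (ennreal (norm (g x) powr p * w x) + ennreal (l powr p) * ennreal (norm (f x) powr p * w x))"
            using f0[of x] g0[of x] l(1) w0[of x] p
            by (simp add: h_def ennreal_power_ennreal flip: ennreal_mult ennreal_plus)
        qed
        also have "\<dots> = ennreal (2 powr p) * (weighted_integral p w UNIV g + ennreal (l powr p) * weighted_integral p w UNIV f)"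
          by (simp add: weighted_integral_def nn_integral_cmult nn_integral_add)
        also have "\<dots> \<le> ennreal (2 powr p) * (ennreal \<beta> + ennreal (l powr p) * ennreal \<alpha>)"
          using \<alpha> \<beta> by (intro mult_left_mono add_mono) auto
        also have "\<dots> = ennreal (2 powr p * (\<beta> + l powr p * \<alpha>))"
          using \<alpha> \<beta> l by (simp flip: ennreal_mult ennreal_plus)
        also have "2 powr p * (\<beta> + l powr p * \<alpha>) = 2 * 2 powr p * \<beta>" using l \<alpha> by simp
        finally show ?thesis .
      qed
      have Ik: "(\<integral>\<^sup>+x. ennreal_power (k x) p' * ennreal (s x) \<partial>lebesgue) = ennreal \<beta>"
      proof -
        have "(\<integral>\<^sup>+x. ennreal_power (k x) p' * ennreal (s x) \<partial>lebesgue) = (\<integral>\<^sup>+x. ennreal (norm (g x) powr p * w x) \<partial>lebesgue)"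
        proof (rule nn_integral_cong_AE, use wpos in eventually_elim)
          case (elim x)
          have "(g x powr (p - 1) * w x) powr p' * s x = g x powr p * (w x powr p' * w x powr (1 - p'))"
            using g0[of x] elim p' by (simp add: s_def powr_mult powr_powr)
          also have "w x powr p' * w x powr (1 - p') = w x" using elim by (simp flip: powr_add)
          finally show ?case using g0[of x] elim p' by (simp add: k_def ennreal_power_ennreal s_def flip: ennreal_mult)
        qed
        then show ?thesis using \<beta>(2) by (simp add: weighted_integral_def)
      qed
      have hnz: "\<not> (AE x in lebesgue. h x = 0)"
      proof
        assume "AE x in lebesgue. h x = 0"
        then have "AE x in lebesgue. ennreal (norm (g x) powr p * w x) = 0"
        proof eventually_elim
          case (elim x)
          then have "g x + l * f x \<le> 0" by (simp add: h_def ennreal_eq_0_iff)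
          moreover have "0 \<le> l * f x" using l f0[of x] by simp
          ultimately have "g x = 0" using g0[of x] by linarith
          then show ?case by simp
        qed
        then have "weighted_integral p w UNIV g = 0"
          unfolding weighted_integral_def by (subst nn_integral_0_iff_AE) auto
        then show False using \<beta> \<open>0 < \<beta>\<close> by simp
      qed
      have knz: "\<not> (AE x in lebesgue. k x = 0)"
      proof
        assume "AE x in lebesgue. k x = 0"
        then have "AE x in lebesgue. ennreal_power (k x) p' * ennreal (s x) = 0"
          by eventually_elim (use p' in simp)
        then have "(\<integral>\<^sup>+x. ennreal_power (k x) p' * ennreal (s x) \<partial>lebesgue) = 0"
          by (subst nn_integral_0_iff_AE) auto
        then show False using Ik \<open>0 < \<beta>\<close> by simp
      qed
      obtain H where H [measurable]: "H \<in> borel_measurable lebesgue" and hH: "\<And>x. h x \<le> H x"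
        and IH: "(\<integral>\<^sup>+x. ennreal_power (H x) p * ennreal (w x) \<partial>lebesgue) \<le> ennreal (2 * 2 powr p) * (\<integral>\<^sup>+x. ennreal_power (h x) p * ennreal (w x) \<partial>lebesgue)"
        and AH: "A1_majorant (majorant_const TYPE('n) p K) H"
        by (rule A1_majorant_exists[OF _ _ AEw p K(1) Ap, of h]) measurable
      obtain V where V [measurable]: "V \<in> borel_measurable lebesgue" and kV: "\<And>x. k x \<le> V x"
        and IV: "(\<integral>\<^sup>+x. ennreal_power (V x) p' * ennreal (s x) \<partial>lebesgue) \<le> ennreal (2 * 2 powr p') * (\<integral>\<^sup>+x. ennreal_power (k x) p' * ennreal (s x) \<partial>lebesgue)"
        and AV: "A1_majorant (majorant_const TYPE('n) p' K') V"
        by (rule A1_majorant_exists[OF _ _ AEs p'(1) K' Ap', of k]) measurable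
      have AHB: "A1_majorant B H" and AVB: "A1_majorant B V"
        using AH AV by (auto intro: A1_majorant_mono simp: B_def)
      have Hpos: "0 < H x" and Vpos: "0 < V x" for x
        using positive_of_A1_majorant[OF H AHB hH hnz] positive_of_A1_majorant[OF V AVB kV knz] by auto
      have IH': "(\<integral>\<^sup>+x. ennreal_power (H x) p * ennreal (w x) \<partial>lebesgue) \<le> ennreal (2 * 2 powr p * (2 * 2 powr p) * \<beta>)"
      proof -
        have "ennreal (2 * 2 powr p) * (\<integral>\<^sup>+x. ennreal_power (h x) p * ennreal (w x) \<partial>lebesgue) \<le> ennreal (2 * 2 powr p) * ennreal (2 * 2 powr p * \<beta>)"
          by (intro mult_left_mono Ih) auto
        also have "\<dots> = ennreal (2 * 2 powr p * (2 * 2 powr p) * \<beta>)"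
          using \<beta> by (subst ennreal_mult[symmetric]) (auto simp: mult.assoc)
        finally show ?thesis using IH by (rule order_trans[rotated])
      qed
      have IV': "(\<integral>\<^sup>+x. ennreal_power (V x) p' * ennreal (s x) \<partial>lebesgue) \<le> ennreal (2 * 2 powr p' * \<beta>)"
        using IV Ik \<beta> by (simp add: ennreal_mult)
      have Hfin: "AE x in lebesgue. H x < top"
        by (rule finite_AE_of_weighted_integral[where w="\<lambda>x. ennreal (w x)" and p=p])
           (use wpos p IH' in \<open>auto intro: le_less_trans\<close>)
      have Vfin: "AE x in lebesgue. V x < top"
        by (rule finite_AE_of_weighted_integral[where w="\<lambda>x. ennreal (s x)" and p=p'])
           (use AEs p' IV' in \<open>auto intro: le_less_trans\<close>)
      define u where "u x = enn2real (H x) powr (1 - q) * enn2real (V x)" for x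
      have u: "u \<in> muckenhoupt q" "muckenhoupt_const q u \<le> ennreal (B powr q)"
        unfolding u_def using factored_weight_muckenhoupt[OF H V AHB AVB B Hpos Vpos Hfin Vfin q] by auto
      have AEHV: "AE x in lebesgue. 0 < w x \<and> (\<exists>a b. 0 < a \<and> 0 < b \<and> H x = ennreal a \<and> V x = ennreal b)"
        using Hfin Vfin wpos
      proof eventually_elim
        case (elim x)
        then show ?case using Hpos[of x] Vpos[of x] by (cases "H x"; cases "V x") auto
      qed
      define J where "J = (\<integral>\<^sup>+x. H x * V x \<partial>lebesgue)"
      have J: "J \<le> ennreal (c * \<beta>)"
      proof -
        have "J \<le> (\<integral>\<^sup>+x. ennreal_power (H x) p * ennreal (w x) + ennreal_power (V x) p' * ennreal (s x) \<partial>lebesgue)"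
          unfolding J_def
        proof (rule nn_integral_mono_AE, use AEHV in eventually_elim)
          case (elim x)
          then obtain a b where ab: "0 < w x" "0 < a" "0 < b" "H x = ennreal a" "V x = ennreal b" by blast
          have "a * b \<le> a powr p * w x + b powr p' * s x"
            using young_weighted[OF p ab(1), of a b] ab by (simp add: p'_def s_def)
          then show ?case using ab p p' by (simp add: ennreal_power_ennreal s_def ennreal_leI flip: ennreal_mult ennreal_plus)
        qed
        also have "\<dots> \<le> ennreal (2 * 2 powr p * (2 * 2 powr p) * \<beta>) + ennreal (2 * 2 powr p' * \<beta>)"
          using IH' IV' by (subst nn_integral_add) (auto intro: add_mono)
        also have "\<dots> = ennreal (c * \<beta>)" using \<beta> by (simp add: c_def algebra_simps flip: ennreal_plus)
        finally show ?thesis .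
      qed
      have Ig: "weighted_integral q u UNIV g \<le> J"
        unfolding weighted_integral_def J_def
      proof (rule nn_integral_mono_AE, use AEHV in eventually_elim)
        case (elim x)
        then obtain a b where ab: "0 < a" "0 < b" "H x = ennreal a" "V x = ennreal b" by blast
        have "ennreal (g x + l * f x) \<le> ennreal a" using hH[of x] ab by (simp add: h_def)
        then have "g x + l * f x \<le> a" using ab by simp
        moreover have "0 \<le> l * f x" using l f0[of x] by simp
        ultimately have "g x \<le> a" by linarith
        then have "g x powr q * a powr (1 - q) \<le> a powr q * a powr (1 - q)"
          using g0[of x] q by (intro mult_right_mono powr_mono2) auto
        also have "\<dots> = a" using ab by (simp flip: powr_add)
        finally have "g x powr q * a powr (1 - q) * b \<le> a * b" using ab by simp
        then show ?case using ab g0[of x] by (simp add: u_def mult.assoc ennreal_leI flip: ennreal_mult)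
      qed
      have If: "weighted_integral q u UNIV f \<le> ennreal (l powr (- q)) * J"
      proof -
        have "weighted_integral q u UNIV f \<le> (\<integral>\<^sup>+x. ennreal (l powr (- q)) * (H x * V x) \<partial>lebesgue)"
          unfolding weighted_integral_def
        proof (rule nn_integral_mono_AE, use AEHV in eventually_elim)
          case (elim x)
          then obtain a b where ab: "0 < a" "0 < b" "H x = ennreal a" "V x = ennreal b" by blast
          have "ennreal (g x + l * f x) \<le> ennreal a" using hH[of x] ab by (simp add: h_def)
          then have "g x + l * f x \<le> a" using ab by simp
          then have "f x \<le> a / l" using g0[of x] l by (simp add: field_simps)
          then have "f x powr q * a powr (1 - q) \<le> (a / l) powr q * a powr (1 - q)"
            using f0[of x] q by (intro mult_right_mono powr_mono2) auto
          also have "\<dots> = l powr (- q) * (a powr q * a powr (1 - q))"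
            using ab l by (simp add: powr_divide powr_minus_divide)
          also have "a powr q * a powr (1 - q) = a" using ab by (simp flip: powr_add)
          finally have "f x powr q * a powr (1 - q) * b \<le> l powr (- q) * (a * b)" using ab by (simp add: mult_right_mono flip: mult.assoc)
          then show ?case using ab f0[of x] by (simp add: u_def mult.assoc ennreal_leI flip: ennreal_mult)
        qed
        also have "\<dots> = ennreal (l powr (- q)) * J" unfolding J_def by (rule nn_integral_cmult) measurable
        finally show ?thesis .
      qed
      \<comment> \<open>Because H dominates g, finiteness in L_q(u) is automatic, so the hypothesis
        applies even when it is restricted to finite left-hand sides.\<close>
      have "weighted_integral q u UNIV g < top" using order_trans[OF Ig J] by (rule le_less_trans) simp
      then have "weighted_integral q u UNIV g \<le> ennreal C1 * weighted_integral q u UNIV f"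
        using weighted_estimateD[OF C1(2) u fg] by simp
      also have "\<dots> \<le> ennreal C1 * (ennreal (l powr (- q)) * J)" by (intro mult_left_mono If) auto
      finally have Ig2: "weighted_integral q u UNIV g \<le> ennreal C1 * (ennreal (l powr (- q)) * J)" .
      have "ennreal \<beta> \<le> (\<integral>\<^sup>+x. ennreal (1 / l) * (H x * V x) + ennreal ((1 / l) powr (1 - q)) * ennreal (norm (g x) powr q * u x) \<partial>lebesgue)"
        unfolding \<beta>(2)[symmetric] weighted_integral_def
      proof (rule nn_integral_mono_AE, use AEHV in eventually_elim)
        case (elim x)
        then obtain a b where ab: "0 < w x" "0 < a" "0 < b" "H x = ennreal a" "V x = ennreal b" by blast
        have "ennreal (g x powr (p - 1) * w x) \<le> ennreal b" using kV[of x] ab by (simp add: k_def)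
        then have "g x powr (p - 1) * w x \<le> b" using ab by simp
        then have "g x * (g x powr (p - 1) * w x) \<le> g x * b" using g0[of x] by (intro mult_left_mono) auto
        \<comment> \<open>The parameter 1 / l balances the terms: after integration they become J /
          l and, through the hypothesis, C1 * J / l.\<close>
        also have "g x * b \<le> (1 / l * a + (1 / l) powr (1 - q) * (g x powr q * a powr (1 - q))) * b"
          using young_scaled[OF q _ ab(2) g0[of x], of "1 / l"] l ab by (intro mult_right_mono) auto
        also have "\<dots> = 1 / l * (a * b) + (1 / l) powr (1 - q) * (g x powr q * (a powr (1 - q) * b))" by (simp add: algebra_simps)
        also have "g x * (g x powr (p - 1) * w x) = g x powr p * w x"
          using g0[of x] by (cases "g x = 0") (auto simp: powr_diff)
        finally have "ennreal (g x powr p * w x) \<le> ennreal (1 / l * (a * b) + (1 / l) powr (1 - q) * (g x powr q * (a powr (1 - q) * b)))"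
          by (rule ennreal_leI)
        also have "\<dots> = ennreal (1 / l) * (H x * V x) + ennreal ((1 / l) powr (1 - q)) * ennreal (norm (g x) powr q * u x)"
          using ab l g0[of x] by (simp add: u_def flip: ennreal_mult ennreal_plus)
        finally show ?case using g0[of x] by simp
      qed
      also have "\<dots> = ennreal (1 / l) * J + ennreal ((1 / l) powr (1 - q)) * weighted_integral q u UNIV g"
        using u(1) by (subst nn_integral_add) (auto simp: J_def weighted_integral_def nn_integral_cmult u_def)
      also have "\<dots> \<le> ennreal (1 / l) * J + ennreal ((1 / l) powr (1 - q)) * (ennreal C1 * (ennreal (l powr (- q)) * J))"
        by (intro add_left_mono mult_left_mono Ig2) auto
      also have "\<dots> = ennreal (1 / l + (1 / l) powr (1 - q) * (C1 * l powr (- q))) * J"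
        using l C1 by (simp add: distrib_right ennreal_mult mult.assoc)
      also have "(1 / l) powr (1 - q) * (C1 * l powr (- q)) = C1 / l"
      proof -
        have "(1 / l) powr (1 - q) * l powr (- q) = 1 / l"
          using l by (simp add: powr_divide powr_diff powr_minus_divide)
        then show ?thesis by (simp add: mult_ac)
      qed
      also have "ennreal (1 / l + C1 / l) * J \<le> ennreal (1 / l + C1 / l) * ennreal (c * \<beta>)"
        by (intro mult_left_mono J) auto
      also have "\<dots> = ennreal ((1 / l + C1 / l) * (c * \<beta>))" using l C1 c \<beta> by (subst ennreal_mult[symmetric]) auto
      finally have "\<beta> \<le> (1 / l + C1 / l) * (c * \<beta>)"
        using l C1 c \<beta> by (subst (asm) ennreal_le_iff) auto
      then have "\<beta> * l \<le> \<beta> * ((1 + C1) * c)" using l by (simp add: field_simps)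
      then have "l \<le> (1 + C1) * c" using \<open>0 < \<beta>\<close> by simp
      then have "l powr p \<le> C" unfolding C_def using l p by (intro powr_mono2) auto
      then show ?thesis using l \<alpha> by (simp add: field_simps)
    qed
    show "weighted_integral p w UNIV g \<le> ennreal C * weighted_integral p w UNIV f"
    proof (cases "weighted_integral p w UNIV f")
      case top
      then show ?thesis using C by (simp add: ennreal_mult_top)
    next
      case (real \<phi>)
      have "\<beta> / C \<le> \<phi>"
      proof (rule dense_ge)
        fix \<alpha> assume \<alpha>: "\<phi> < \<alpha>"
        show "\<beta> / C \<le> \<alpha>"
        proof (cases "\<beta> = 0")
          case False
          then have "\<beta> \<le> C * \<alpha>" using main[of \<alpha>] \<alpha> real \<beta> by (auto intro: ennreal_leI)
          then show ?thesis using C by (simp add: field_simps)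
        qed (use real \<alpha> in auto)
      qed
      then have "\<beta> \<le> C * \<phi>" using C by (simp add: field_simps)
      then show ?thesis using real \<beta> C by (simp add: ennreal_leI flip: ennreal_mult)
    qed
  qed
qed

section \<open>Truncation and the removal of the finiteness restriction\<close>

definition truncation :: "nat \<Rightarrow> (real ^ 'n \<Rightarrow> real) \<Rightarrow> real ^ 'n \<Rightarrow> real" where
  "truncation N g x = (if norm x \<le> real N \<and> g x \<le> real N then g x else 0)"

lemma truncation_measurable:
  fixes g :: "real ^ 'n \<Rightarrow> real"
  assumes [measurable]: "g \<in> borel_measurable lebesgue"
  shows "truncation N g \<in> borel_measurable lebesgue"
proof -
  have [measurable]: "cball (0 :: real ^ 'n) (real N) \<in> sets lebesgue" by simp
  have "truncation N g = (\<lambda>x. indicator (cball 0 (real N)) x * (if g x \<le> real N then g x else 0))"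
    by (auto simp: truncation_def indicator_def)
  also have "\<dots> \<in> borel_measurable lebesgue" by measurable
  finally show ?thesis .
qed

lemma truncation_SUP:
  fixes w :: "real ^ 'n \<Rightarrow> real"
  assumes [measurable]: "g \<in> borel_measurable lebesgue" "w \<in> borel_measurable lebesgue"
    and g0: "\<And>x. 0 \<le> g x" and w0: "\<And>x. 0 \<le> w x"
  shows "weighted_integral p w UNIV g = (SUP N. weighted_integral p w UNIV (truncation N g))"
proof -
  note [measurable] = truncation_measurable[OF assms(1)]
  let ?h = "\<lambda>N x. ennreal (norm (truncation N g x) powr p * w x)"
  have inc: "?h N x \<le> ?h N' x" if "N \<le> N'" for N N' x
    using that g0[of x] w0[of x] by (auto simp: truncation_def intro!: ennreal_leI)
  have "weighted_integral p w UNIV g = (\<integral>\<^sup>+x. (SUP N. ?h N x) \<partial>lebesgue)"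
    unfolding weighted_integral_def
  proof (rule nn_integral_cong)
    fix x
    obtain N where "max (norm x) (g x) \<le> real N" using real_arch_simple by blast
    then have "ennreal (norm (g x) powr p * w x) \<le> (SUP N. ?h N x)"
      by (intro SUP_upper2[of N]) (auto simp: truncation_def)
    moreover have "(SUP N. ?h N x) \<le> ennreal (norm (g x) powr p * w x)"
      using g0[of x] w0[of x] by (intro SUP_least) (auto simp: truncation_def intro!: ennreal_leI)
    ultimately show "ennreal (norm (g x) powr p * w x) * indicator UNIV x = (SUP N. ?h N x)" by simp
  qed
  also have "\<dots> = (SUP N. \<integral>\<^sup>+x. ?h N x \<partial>lebesgue)"
    using inc by (intro nn_integral_monotone_convergence_SUP) (auto simp: incseq_def le_fun_def)
  finally show ?thesis by (simp add: weighted_integral_def)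
qed

text \<open>A truncated g is bounded with bounded support and so has a finite integral against every
  locally integrable weight. The family of all truncated pairs inherits the hypothesis with the same
  constant, the restricted theorem applies to it, and monotone convergence returns to g.\<close>

theorem extrapolation:
  fixes F :: "((real ^ 'n \<Rightarrow> real) \<times> (real ^ 'n \<Rightarrow> real)) set"
  assumes F: "extrapolation_pairs F" and q: "1 \<le> q" and bd: "weighted_bound fin q F" and p: "1 < p"
  shows "weighted_bound fin p F"
proof (cases fin)
  case True
  then show ?thesis using extrapolation_finite[OF F q _ p] bd by simp
next
  case False
  define F' where "F' = {(f, truncation N g) | f g N. (f, g) \<in> F}"
  have meas: "f \<in> borel_measurable lebesgue" "g \<in> borel_measurable lebesgue" "0 \<le> f x" "0 \<le> g x"
    if "(f, g) \<in> F" for f g x using F that by (auto simp: extrapolation_pairs_def)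
  have F': "extrapolation_pairs F'"
    unfolding extrapolation_pairs_def
  proof
    fix fg assume "fg \<in> F'"
    then obtain f g N where g: "fg = (f, truncation N g)" "(f, g) \<in> F" by (auto simp: F'_def)
    then show "case fg of (f, g) \<Rightarrow> f \<in> borel_measurable lebesgue \<and> g \<in> borel_measurable lebesgue \<and> (\<forall>x. 0 \<le> f x \<and> 0 \<le> g x)"
      using meas[OF g(2)] truncation_measurable[OF meas(2)[OF g(2)]] by (simp add: truncation_def)
  qed
  have "weighted_bound True q F'"
    unfolding weighted_bound_def
  proof
    fix K
    obtain C where C: "0 < C" "weighted_estimate C K fin q F"
      using bd unfolding weighted_bound_def by blast
    show "\<exists>C>0. weighted_estimate C K True q F'"
    proof (intro exI[of _ C] conjI C(1) weighted_estimateI)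
      fix w :: "real ^ 'n \<Rightarrow> real" and f g' assume w: "w \<in> muckenhoupt q" "muckenhoupt_const q w \<le> ennreal K" and "(f, g') \<in> F'"
      then obtain g N where g: "(f, g) \<in> F" "g' = truncation N g" by (auto simp: F'_def)
      have "weighted_integral q w UNIV g' \<le> weighted_integral q w UNIV g"
        unfolding weighted_integral_def g using w meas[OF g(1)]
        by (intro nn_integral_mono) (auto simp: truncation_def muckenhoupt_def weight_def intro!: ennreal_leI)
      also have "\<dots> \<le> ennreal C * weighted_integral q w UNIV f"
        using weighted_estimateD[OF C(2) w g(1)] False by simp
      finally show "weighted_integral q w UNIV g' \<le> ennreal C * weighted_integral q w UNIV f" .
    qed
  qed
  then have bd': "weighted_bound True p F'" using extrapolation_finite F' q p by blast
  show ?thesis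
    unfolding weighted_bound_def
  proof
    fix K
    obtain C where C: "0 < C" "weighted_estimate C K True p F'"
      using bd' unfolding weighted_bound_def by blast
    show "\<exists>C>0. weighted_estimate C K fin p F"
    proof (intro exI[of _ C] conjI C(1) weighted_estimateI)
      fix w :: "real ^ 'n \<Rightarrow> real" and f g assume w: "w \<in> muckenhoupt p" "muckenhoupt_const p w \<le> ennreal K" and g: "(f, g) \<in> F"
      have wm [measurable]: "w \<in> borel_measurable lebesgue" and w0: "\<And>x. 0 \<le> w x"
        and wfin: "\<And>Q. Q \<in> cubes \<Longrightarrow> weight_of w Q < top"
        using w by (auto simp: muckenhoupt_def weight_iff)
      show "weighted_integral p w UNIV g \<le> ennreal C * weighted_integral p w UNIV f"
        unfolding truncation_SUP[OF meas(2)[OF g] wm meas(4)[OF g] w0]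
      proof (rule SUP_least)
        fix N
        have "bounded (cball (0 :: real ^ 'n) (real N))" by simp
        then obtain r where r: "0 < r" "cball 0 (real N) \<subseteq> ccube (0 :: real ^ 'n) r" by (rule bounded_subset_ccube)
        note [measurable] = cube_emeasure(3)[OF ccube_in_cubes[OF r(1), of 0]]
        have "weighted_integral p w UNIV (truncation N g)
          \<le> (\<integral>\<^sup>+x. ennreal (real N powr p) * (ennreal (w x) * indicator (ccube 0 r) x) \<partial>lebesgue)"
          unfolding weighted_integral_def
        proof (rule nn_integral_mono)
          fix x
          show "ennreal (norm (truncation N g x) powr p * w x) * indicator UNIV x
            \<le> ennreal (real N powr p) * (ennreal (w x) * indicator (ccube 0 r) x)"
          proof (cases "norm x \<le> real N \<and> g x \<le> real N")
            case True
            then have "x \<in> ccube 0 r" using r(2) by auto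
            moreover have "g x powr p * w x \<le> real N powr p * w x"
              using True meas(4)[OF g, of x] w0[of x] p by (intro mult_right_mono powr_mono2) auto
            ultimately show ?thesis using True meas(4)[OF g, of x] w0[of x]
              by (simp add: truncation_def ennreal_leI flip: ennreal_mult)
          qed (auto simp: truncation_def)
        qed
        also have "\<dots> = ennreal (real N powr p) * weight_of w (ccube 0 r)"
          unfolding weight_of_def by (rule nn_integral_cmult) measurable
        also have "\<dots> < top" using wfin[OF ccube_in_cubes[OF r(1)]] by (simp add: ennreal_mult_less_top)
        finally show "weighted_integral p w UNIV (truncation N g) \<le> ennreal C * weighted_integral p w UNIV f"
          using g by (intro weighted_estimateD[OF C(2) w]) (auto simp: F'_def)
      qed
    qed
  qed
qed

section \<open>Uniformity in the Muckenhoupt constant\<close>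

lemma weight_of_cmult_le:
  assumes "0 \<le> b" "u \<in> borel_measurable lebesgue" "\<And>x. 0 \<le> u x" "\<And>x. v x \<le> b * u x" "Q \<in> sets lebesgue"
  shows "weight_of v Q \<le> ennreal b * weight_of u Q"
proof -
  note [measurable] = assms(2,5)
  have "weight_of v Q \<le> (\<integral>\<^sup>+x. ennreal b * (ennreal (u x) * indicator Q x) \<partial>lebesgue)"
    unfolding weight_of_def using assms(1,3,4)
    by (intro nn_integral_mono) (auto simp: indicator_def ennreal_leI simp flip: ennreal_mult)
  also have "\<dots> = ennreal b * weight_of u Q"
    unfolding weight_of_def by (rule nn_integral_cmult) measurable
  finally show ?thesis .
qed

text \<open>The comparison factor \<mu> may change from cube to cube because it cancels: the dual
  exponent t satisfies t (p - 1) = -1. The clause on zeros guards against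
  \<open>0 powr t = 0\<close>, which would break the estimate of v^t by \<mu>^t w^t at a point where
  w vanishes and v does not.\<close>

lemma muckenhoupt_const_le_cubewise:
  fixes v w :: "real ^ 'n \<Rightarrow> real"
  assumes p: "1 \<le> p" and K: "0 < K" and w [measurable]: "w \<in> borel_measurable lebesgue" and w0: "\<And>x. 0 \<le> w x"
    and cub: "\<And>R. R \<in> cubes \<Longrightarrow> \<exists>\<mu>>0. (\<forall>y\<in>R. \<mu> * w y \<le> v y \<and> (w y = 0 \<longrightarrow> v y = 0)) \<and> weight_of v R \<le> ennreal (K * \<mu>) * weight_of w R"
  shows "muckenhoupt_const p v \<le> ennreal K * muckenhoupt_const p w"
proof (cases "p = 1")
  case True
  \<comment> \<open>The factor K is moved to the other side so that the right-hand side is a bare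
    infimum over admissible c.\<close>
  have "muckenhoupt_const p v * ennreal (1 / K) \<le> c"
    if c: "\<And>Q. Q \<in> cubes \<Longrightarrow> AE x in lebesgue. x \<in> Q \<longrightarrow> cube_average w Q \<le> c * ennreal (w x)" for c
  proof -
    have "AE x in lebesgue. x \<in> Q \<longrightarrow> cube_average v Q \<le> ennreal K * c * ennreal (v x)" if Q: "Q \<in> cubes" for Q
      using c[OF Q]
    proof eventually_elim
      case (elim x)
      obtain \<mu> where \<mu>: "0 < \<mu>" "\<And>y. y \<in> Q \<Longrightarrow> \<mu> * w y \<le> v y \<and> (w y = 0 \<longrightarrow> v y = 0)" "weight_of v Q \<le> ennreal (K * \<mu>) * weight_of w Q"
        using cub[OF Q] by blast
      show ?case
      proof
        assume x: "x \<in> Q"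
        have "cube_average v Q \<le> ennreal (K * \<mu>) * cube_average w Q"
          unfolding cube_average_def ennreal_times_divide by (intro divide_right_mono_ennreal \<mu>(3))
        also have "\<dots> \<le> ennreal (K * \<mu>) * (c * ennreal (w x))" using elim x by (intro mult_left_mono) auto
        also have "\<dots> = ennreal K * c * (ennreal \<mu> * ennreal (w x))" using K \<mu>(1) by (simp add: ennreal_mult mult_ac)
        also have "\<dots> \<le> ennreal K * c * ennreal (v x)"
        proof (rule mult_left_mono)
          show "ennreal \<mu> * ennreal (w x) \<le> ennreal (v x)" using \<mu>(1) \<mu>(2)[OF x] w0[of x] by (simp add: ennreal_leI flip: ennreal_mult)
        qed simp
        finally show "cube_average v Q \<le> ennreal K * c * ennreal (v x)" .
      qed
    qed
    then have "muckenhoupt_const p v \<le> ennreal K * c"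
      unfolding muckenhoupt_const_def using True by (auto intro!: Inf_lower)
    then show ?thesis using K by (subst ennreal_mult_inverse_le_iff) (auto simp: mult.commute)
  qed
  then have "muckenhoupt_const p v * ennreal (1 / K) \<le> muckenhoupt_const p w"
    unfolding muckenhoupt_const_def[of p w] using True by (auto intro!: Inf_greatest)
  then show ?thesis using K by (subst (asm) ennreal_mult_inverse_le_iff) (auto simp: mult.commute)
next
  case False
  then have p: "1 < p" using p by simp
  define t where "t = 1 - p / (p - 1)"
  have t: "t < 0" "t * (p - 1) = - 1" using p by (auto simp: t_def field_simps)
  show ?thesis unfolding muckenhoupt_const_le_iff[OF p] t_def[symmetric]
  proof
    fix Q :: "(real ^ 'n) set" assume Q: "Q \<in> cubes"
    note [measurable] = cube_emeasure(3)[OF Q]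
    obtain \<mu> where \<mu>: "0 < \<mu>" "\<And>y. y \<in> Q \<Longrightarrow> \<mu> * w y \<le> v y \<and> (w y = 0 \<longrightarrow> v y = 0)" "weight_of v Q \<le> ennreal (K * \<mu>) * weight_of w Q"
      using cub[OF Q] by blast
    have "weight_of (\<lambda>x. v x powr t) Q \<le> (\<integral>\<^sup>+x. ennreal (\<mu> powr t) * (ennreal (w x powr t) * indicator Q x) \<partial>lebesgue)"
      unfolding weight_of_def
    proof (rule nn_integral_mono)
      fix x
      have "v x powr t \<le> \<mu> powr t * w x powr t" if "x \<in> Q"
      proof -
        have "v x powr t \<le> (\<mu> * w x) powr t" if "w x \<noteq> 0"
          using \<mu>(1) \<mu>(2)[OF \<open>x \<in> Q\<close>] t w0[of x] that by (intro powr_mono2') auto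
        then show ?thesis using \<mu>(1) \<mu>(2)[OF \<open>x \<in> Q\<close>] w0[of x] by (cases "w x = 0") (auto simp: powr_mult)
      qed
      then show "ennreal (v x powr t) * indicator Q x \<le> ennreal (\<mu> powr t) * (ennreal (w x powr t) * indicator Q x)"
        by (auto simp: indicator_def ennreal_leI simp flip: ennreal_mult)
    qed
    also have "\<dots> = ennreal (\<mu> powr t) * weight_of (\<lambda>x. w x powr t) Q"
      unfolding weight_of_def by (rule nn_integral_cmult) measurable
    finally have 2: "weight_of (\<lambda>x. v x powr t) Q \<le> ennreal (\<mu> powr t) * weight_of (\<lambda>x. w x powr t) Q" .
    have "weight_of v Q * ennreal_power (weight_of (\<lambda>x. v x powr t) Q) (p - 1)
      \<le> (ennreal (K * \<mu>) * weight_of w Q) * ennreal_power (ennreal (\<mu> powr t) * weight_of (\<lambda>x. w x powr t) Q) (p - 1)"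
      using \<mu>(3) 2 p by (intro mult_mono ennreal_power_mono) auto
    also have "\<dots> = (ennreal (K * \<mu>) * ennreal (1 / \<mu>)) * (weight_of w Q * ennreal_power (weight_of (\<lambda>x. w x powr t) Q) (p - 1))"
      using p \<mu>(1) t by (simp add: ennreal_power_mult ennreal_power_ennreal powr_powr powr_minus_divide mult_ac)
    also have "ennreal (K * \<mu>) * ennreal (1 / \<mu>) = ennreal K" using K \<mu>(1) by (simp flip: ennreal_mult)
    also have "ennreal K * (weight_of w Q * ennreal_power (weight_of (\<lambda>x. w x powr t) Q) (p - 1))
      \<le> ennreal K * (muckenhoupt_const p w * ennreal_power (emeasure lebesgue Q) p)"
      using Q muckenhoupt_const_le_iff[OF p, of w "muckenhoupt_const p w"] unfolding t_def
      by (intro mult_left_mono) auto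
    finally show "weight_of v Q * ennreal_power (weight_of (\<lambda>x. v x powr t) Q) (p - 1)
      \<le> ennreal K * muckenhoupt_const p w * ennreal_power (emeasure lebesgue Q) p"
      by (simp add: mult.assoc)
  qed
qed

section \<open>Continuity and growth of the characteristic under damping\<close>

lemma muckenhoupt_const_comparable:
  fixes u v :: "real ^ 'n \<Rightarrow> real"
  assumes p: "1 \<le> p" and ab: "0 < a" "0 < b" and u: "u \<in> borel_measurable lebesgue" and u0: "\<And>x. 0 \<le> u x"
    and le: "\<And>x. a * u x \<le> v x" "\<And>x. v x \<le> b * u x"
  shows "muckenhoupt_const p v \<le> ennreal (b / a) * muckenhoupt_const p u"
proof (rule muckenhoupt_const_le_cubewise[OF p _ u u0])
  fix R :: "(real ^ 'n) set" assume R: "R \<in> cubes"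
  have "weight_of v R \<le> ennreal b * weight_of u R"
    using ab by (intro weight_of_cmult_le u u0 le(2) cube_emeasure(3)[OF R]) auto
  moreover have "u y = 0 \<Longrightarrow> v y = 0" for y using le[of y] by simp
  ultimately show "\<exists>\<mu>>0. (\<forall>y\<in>R. \<mu> * u y \<le> v y \<and> (u y = 0 \<longrightarrow> v y = 0)) \<and> weight_of v R \<le> ennreal (b / a * \<mu>) * weight_of u R"
    using ab le(1) by (intro exI[of _ a]) auto
qed (use ab in simp)

text \<open>With e = exp |s - t|, exchanging s and t gives \<phi> t / e \<le> \<phi> s, and 1 / e
  \<ge> 2 - e turns this into the mirror image of the upper bound.\<close>

lemma continuous_of_exp_lipschitz:
  fixes \<phi> :: "real \<Rightarrow> real"
  assumes "\<And>t. 0 \<le> \<phi> t" and le: "\<And>s t. \<phi> s \<le> exp \<bar>s - t\<bar> * \<phi> t"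
  shows "isCont \<phi> t"
proof -
  have *: "norm (\<phi> s - \<phi> t) \<le> (exp \<bar>s - t\<bar> - 1) * \<phi> t" for s
  proof -
    let ?e = "exp \<bar>s - t\<bar>"
    have e: "1 \<le> ?e" by simp
    have "\<phi> t / ?e \<le> \<phi> s" using le[of t s] by (simp add: abs_minus_commute field_simps)
    moreover have "(2 - ?e) * \<phi> t \<le> 1 / ?e * \<phi> t"
    proof (intro mult_right_mono assms)
      have "0 \<le> (?e - 1)\<^sup>2" by simp
      then have "(2 - ?e) * ?e \<le> 1" by (simp add: power2_eq_square algebra_simps)
      then show "2 - ?e \<le> 1 / ?e" by (simp add: field_simps)
    qed
    ultimately have "(2 - ?e) * \<phi> t \<le> \<phi> s" by simp
    then show ?thesis using le[of s t] by (simp add: abs_le_iff algebra_simps)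
  qed
  have "((\<lambda>s. (exp \<bar>s - t\<bar> - 1) * \<phi> t) \<longlongrightarrow> (exp \<bar>t - t\<bar> - 1) * \<phi> t) (at t)"
    by (intro tendsto_intros)
  then have "((\<lambda>s. (exp \<bar>s - t\<bar> - 1) * \<phi> t) \<longlongrightarrow> 0) (at t)" by simp
  moreover have "eventually (\<lambda>s. norm (\<phi> s - \<phi> t) \<le> (exp \<bar>s - t\<bar> - 1) * \<phi> t) (at t)"
    by (intro always_eventually allI *)
  ultimately have "((\<lambda>s. \<phi> s - \<phi> t) \<longlongrightarrow> 0) (at t)"
    by (rule Lim_null_comparison[rotated])
  then show ?thesis unfolding isCont_def by (rule Lim_null[THEN iffD2])
qed

text \<open>The exponential parameter turns the comparability of two damped weights into the factor
  exp |s - t|, hence into continuity of the characteristic.\<close>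

definition damped :: "(real ^ 'n) set \<Rightarrow> (real ^ 'n \<Rightarrow> real) \<Rightarrow> real \<Rightarrow> real ^ 'n \<Rightarrow> real" where
  "damped E w t x = (if x \<in> E then exp (- t) * w x else w x)"

lemma weight_of_pos_set:
  fixes u :: "real ^ 'n \<Rightarrow> real"
  assumes [measurable]: "u \<in> borel_measurable lebesgue" "E \<in> sets lebesgue"
    and E: "0 < emeasure lebesgue E" and pos: "AE x in lebesgue. 0 < u x"
  shows "0 < weight_of u E"
proof (rule ccontr)
  assume "\<not> 0 < weight_of u E"
  then have "AE x in lebesgue. ennreal (u x) * indicator E x = 0"
    unfolding weight_of_def by (simp add: nn_integral_0_iff_AE)
  then have "AE x in lebesgue. x \<notin> E"
    using pos by eventually_elim (auto simp: indicator_def split: if_splits)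
  then have "emeasure lebesgue E = 0" by (subst (asm) AE_iff_measurable[of E]) auto
  then show False using E by simp
qed

lemma weight_of_pos:
  fixes u :: "real ^ 'n \<Rightarrow> real"
  assumes "u \<in> borel_measurable lebesgue" "E \<in> cubes" "AE x in lebesgue. 0 < u x"
  shows "0 < weight_of u E"
  using assms cube_emeasure[OF assms(2)] by (intro weight_of_pos_set)

text \<open>On Q the weight keeps at least its mass on E', while the dual weight on E grows like exp
  (-t s) with s (p - 1) = -1, so the A_p product grows like exp t. For p = 1 the average over Q
  stays bounded below while the weight on E decays like exp (-t).\<close>

lemma damped_const_lower:
  fixes w :: "real ^ 'n \<Rightarrow> real"
  assumes p: "1 \<le> p" and w: "w \<in> muckenhoupt p" and E: "E \<in> cubes" "E' \<in> cubes" "Q \<in> cubes" "E \<inter> E' = {}" "E \<union> E' \<subseteq> Q"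
  shows "\<exists>A>0. \<forall>t. ennreal (exp t * A) \<le> muckenhoupt_const p (damped E w t)"
proof -
  note [measurable] = cube_emeasure(3)[OF E(1)] cube_emeasure(3)[OF E(2)] cube_emeasure(3)[OF E(3)]
  have [measurable]: "w \<in> borel_measurable lebesgue" and w0: "\<And>x. 0 \<le> w x" and wpos: "AE x in lebesgue. 0 < w x"
    and wfin: "\<And>Q. Q \<in> cubes \<Longrightarrow> weight_of w Q < top"
    using w by (auto simp: muckenhoupt_def weight_iff)
  obtain a where a: "0 < a" "weight_of w E' = ennreal a"
    using weight_of_pos[of w E'] E(2) wpos wfin[OF E(2)] by (cases "weight_of w E'") auto
  obtain m where m: "emeasure lebesgue Q = ennreal m" "0 < m" using E(3) by (rule cube_emeasure_real)
  have lowW: "ennreal a \<le> weight_of (damped E w t) Q" for t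
    unfolding a(2)[symmetric] weight_of_def using E(4,5)
    by (intro nn_integral_mono) (auto simp: damped_def indicator_def)
  show ?thesis
  proof (cases "p = 1")
    case True
    obtain b where b: "0 < b" "weight_of w E = ennreal b"
      using weight_of_pos[of w E] E(1) wpos wfin[OF E(1)] by (cases "weight_of w E") auto
    obtain n where n: "emeasure lebesgue E = ennreal n" "0 < n" using E(1) by (rule cube_emeasure_real)
    let ?A = "a / m * n / b"
    have "ennreal (exp t * ?A) \<le> muckenhoupt_const p (damped E w t)" for t
    proof -
      have "ennreal (exp t * ?A) \<le> c"
        if c: "\<And>Q. Q \<in> cubes \<Longrightarrow> AE x in lebesgue. x \<in> Q \<longrightarrow> cube_average (damped E w t) Q \<le> c * ennreal (damped E w t x)" for c
      proof -
        have "ennreal (a / m) \<le> cube_average (damped E w t) Q"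
          unfolding cube_average_def using lowW[of t] m a
          by (simp add: divide_ennreal[symmetric] divide_right_mono_ennreal)
        then have ae: "AE x in lebesgue. x \<in> E \<longrightarrow> ennreal (a / m) \<le> c * ennreal (exp (- t)) * ennreal (w x)"
          using c[OF E(3)]
        proof (elim eventually_mono, intro impI)
          fix x assume "x \<in> Q \<longrightarrow> cube_average (damped E w t) Q \<le> c * ennreal (damped E w t x)" "x \<in> E"
            "ennreal (a / m) \<le> cube_average (damped E w t) Q"
          then show "ennreal (a / m) \<le> c * ennreal (exp (- t)) * ennreal (w x)"
            using E(5) w0[of x] by (auto simp: damped_def ennreal_mult mult.assoc intro: order_trans)
        qed
        have "ennreal (a / m * n) = (\<integral>\<^sup>+x. ennreal (a / m) * indicator E x \<partial>lebesgue)"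
          using n a m by (subst ennreal_mult) (auto simp: nn_integral_cmult_indicator)
        also have "\<dots> \<le> (\<integral>\<^sup>+x. c * ennreal (exp (- t)) * (ennreal (w x) * indicator E x) \<partial>lebesgue)"
          using ae by (intro nn_integral_mono_AE) (auto elim!: eventually_mono simp: indicator_def)
        also have "\<dots> = c * ennreal (exp (- t)) * weight_of w E"
          unfolding weight_of_def by (rule nn_integral_cmult) measurable
        also have "\<dots> = c * ennreal (exp (- t) * b)" using b by (simp add: ennreal_mult mult.assoc)
        finally have "ennreal (a / m * n) * ennreal (1 / (exp (- t) * b)) \<le> c"
          using b by (subst ennreal_mult_inverse_le_iff) auto
        moreover have "a / m * n * (1 / (exp (- t) * b)) = exp t * ?A" by (simp add: exp_minus field_simps)
        ultimately show ?thesis using a m n b by (simp flip: ennreal_mult)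
      qed
      then show ?thesis unfolding muckenhoupt_const_def using True by (auto intro!: Inf_greatest)
    qed
    then show ?thesis using a m n b by (intro exI[of _ ?A]) auto
  next
    case False
    then have p: "1 < p" using p by simp
    define s where "s = 1 - p / (p - 1)"
    have s: "s < 0" "s * (p - 1) = - 1" using p by (auto simp: s_def field_simps)
    have "0 < weight_of (\<lambda>x. w x powr s) E"
      using wpos by (intro weight_of_pos E) (auto elim!: eventually_mono)
    then obtain b where b: "0 < b" "ennreal b \<le> weight_of (\<lambda>x. w x powr s) E"
    proof (cases "weight_of (\<lambda>x. w x powr s) E")
      case (real r)
      then show ?thesis using that[of r] \<open>0 < weight_of (\<lambda>x. w x powr s) E\<close> by auto
    qed (use that[of 1] in auto)
    let ?A = "a * b powr (p - 1) / m powr p"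
    have "ennreal (exp t * ?A) \<le> muckenhoupt_const p (damped E w t)" for t
    proof -
      have "ennreal (exp (- t * s) * b) \<le> weight_of (\<lambda>x. damped E w t x powr s) Q"
      proof -
        have "ennreal (exp (- t * s) * b) \<le> ennreal (exp (- t * s)) * weight_of (\<lambda>x. w x powr s) E"
          using b by (simp add: ennreal_mult mult_left_mono)
        also have "\<dots> = (\<integral>\<^sup>+x. ennreal (exp (- t * s)) * (ennreal (w x powr s) * indicator E x) \<partial>lebesgue)"
          unfolding weight_of_def by (rule nn_integral_cmult[symmetric]) measurable
        also have "\<dots> \<le> weight_of (\<lambda>x. damped E w t x powr s) Q"
          unfolding weight_of_def using E(5) w0
          by (intro nn_integral_mono)
             (auto simp: damped_def indicator_def powr_mult exp_powr_real ennreal_mult)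
        finally show ?thesis .
      qed
      then have "ennreal a * ennreal_power (ennreal (exp (- t * s) * b)) (p - 1)
        \<le> weight_of (damped E w t) Q * ennreal_power (weight_of (\<lambda>x. damped E w t x powr s) Q) (p - 1)"
        using lowW p by (intro mult_mono ennreal_power_mono) auto
      also have "\<dots> \<le> muckenhoupt_const p (damped E w t) * ennreal_power (emeasure lebesgue Q) p"
        using E(3) muckenhoupt_const_le_iff[OF p, of "damped E w t" "muckenhoupt_const p (damped E w t)"] unfolding s_def
        by auto
      finally have "ennreal a * ennreal_power (ennreal (exp (- t * s) * b)) (p - 1) * ennreal (1 / m powr p)
        \<le> muckenhoupt_const p (damped E w t)"
        using m p by (simp add: ennreal_mult_inverse_le_iff ennreal_power_ennreal)
      moreover have "(exp (- t * s) * b) powr (p - 1) = exp t * b powr (p - 1)"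
      proof -
        have "- t * s * (p - 1) = t" using s(2) by (simp add: mult.assoc)
        then show ?thesis using b by (simp add: powr_mult exp_powr_real)
      qed
      then have "ennreal a * ennreal_power (ennreal (exp (- t * s) * b)) (p - 1) * ennreal (1 / m powr p) = ennreal (exp t * ?A)"
        using a b m p by (simp add: ennreal_power_ennreal mult_ac flip: ennreal_mult)
      ultimately show ?thesis by simp
    qed
    then show ?thesis using a b m by (intro exI[of _ ?A]) auto
  qed
qed

lemma damped_muckenhoupt:
  fixes w :: "real ^ 'n \<Rightarrow> real"
  assumes p: "1 \<le> p" and w: "w \<in> muckenhoupt p" and E: "E \<in> cubes"
  shows "damped E w t \<in> muckenhoupt p"
    and "muckenhoupt_const p (damped E w s) \<le> ennreal (exp \<bar>s - t\<bar>) * muckenhoupt_const p (damped E w t)"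
proof -
  note [measurable] = cube_emeasure(3)[OF E]
  have [measurable]: "w \<in> borel_measurable lebesgue" and w0: "\<And>x. 0 \<le> w x" and wpos: "AE x in lebesgue. 0 < w x"
    and wfin: "\<And>Q. Q \<in> cubes \<Longrightarrow> weight_of w Q < top" and wc: "muckenhoupt_const p w < top"
    using w by (auto simp: muckenhoupt_def weight_iff)
  have m [measurable]: "damped E w t \<in> borel_measurable lebesgue" for t unfolding damped_def by measurable
  have d0: "0 \<le> damped E w t x" for t x using w0[of x] by (simp add: damped_def)
  show le: "muckenhoupt_const p (damped E w s) \<le> ennreal (exp \<bar>s - t\<bar>) * muckenhoupt_const p (damped E w t)" for s t
  proof (cases "s \<le> t")
    case True
    then have "damped E w t x \<le> damped E w s x" "damped E w s x \<le> exp (t - s) * damped E w t x" for x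
      using w0[of x] by (auto simp: damped_def mult_right_mono mult_le_cancel_right1 simp flip: mult.assoc exp_add)
    then show ?thesis using muckenhoupt_const_comparable[OF p _ _ m d0, of 1 "exp (t - s)"] True by simp
  next
    case False
    then have "exp (t - s) * damped E w t x \<le> damped E w s x" "damped E w s x \<le> damped E w t x" for x
      using w0[of x] by (auto simp: damped_def mult_right_mono mult_le_cancel_right2 simp flip: mult.assoc exp_add)
    then show ?thesis using muckenhoupt_const_comparable[OF p _ _ m d0, of "exp (t - s)" 1] False
      by (simp add: exp_minus inverse_eq_divide[symmetric] flip: exp_minus)
  qed
  have "damped E w 0 = w" by (auto simp: damped_def)
  then have "muckenhoupt_const p (damped E w t) < top"
    using le[of t 0] wc by (auto simp: ennreal_mult_less_top intro: le_less_trans)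
  moreover have "weight_of (damped E w t) Q < top" if Q: "Q \<in> cubes" for Q
  proof -
    have "damped E w t x \<le> max 1 (exp (- t)) * w x" for x
      using w0[of x] by (auto simp: damped_def max_def mult_right_mono mult_le_cancel_right1)
    then have "weight_of (damped E w t) Q \<le> ennreal (max 1 (exp (- t))) * weight_of w Q"
      using w0 by (intro weight_of_cmult_le cube_emeasure(3)[OF Q]) auto
    also have "\<dots> < top" using wfin[OF Q] by (simp add: ennreal_mult_less_top)
    finally show ?thesis .
  qed
  moreover have "AE x in lebesgue. 0 < damped E w t x" using wpos by eventually_elim (simp add: damped_def)
  ultimately show "damped E w t \<in> muckenhoupt p"
    using d0 by (simp add: muckenhoupt_def weight_iff infinity_ennreal_def)
qed

text \<open>Intermediate values: the characteristic starts at most at L, is continuous in the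
  damping parameter and eventually exceeds L.\<close>

lemma damped_attains_const:
  fixes w :: "real ^ 'n \<Rightarrow> real"
  assumes p: "1 \<le> p" and w: "w \<in> muckenhoupt p" and L: "muckenhoupt_const p w \<le> ennreal L" "0 \<le> L"
    and E: "E \<in> cubes" "E' \<in> cubes" "Q \<in> cubes" "E \<inter> E' = {}" "E \<union> E' \<subseteq> Q"
  obtains t where "0 \<le> t" "muckenhoupt_const p (damped E w t) = ennreal L"
proof -
  define \<phi> where "\<phi> t = enn2real (muckenhoupt_const p (damped E w t))" for t
  have \<phi>: "muckenhoupt_const p (damped E w t) = ennreal (\<phi> t)" "0 \<le> \<phi> t" for t
    using damped_muckenhoupt(1)[OF p w E(1), of t] by (auto simp: \<phi>_def muckenhoupt_def infinity_ennreal_def)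
  have "\<phi> s \<le> exp \<bar>s - t\<bar> * \<phi> t" for s t
    using damped_muckenhoupt(2)[OF p w E(1), of s t] \<phi>(2)[of t] unfolding \<phi>(1) by (simp flip: ennreal_mult)
  then have cont: "isCont \<phi> t" for t using \<phi>(2) by (intro continuous_of_exp_lipschitz) auto
  have "damped E w 0 = w" by (auto simp: damped_def)
  then have start: "\<phi> 0 \<le> L" using L \<phi>(1)[of 0] by simp
  obtain A where A: "0 < A" "\<And>t. ennreal (exp t * A) \<le> muckenhoupt_const p (damped E w t)"
    using damped_const_lower[OF p w E] by blast
  \<comment> \<open>Large enough because exp T \<ge> 1 + T.\<close>
  define T where "T = L / A"
  have "L \<le> exp T * A" using exp_ge_add_one_self[of T] A(1) by (simp add: T_def field_simps)
  also have "\<dots> \<le> \<phi> T" using A(2)[of T] \<phi>(2)[of T] unfolding \<phi>(1) by simp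
  finally have "L \<le> \<phi> T" .
  moreover have "0 \<le> T" using L A by (simp add: T_def)
  ultimately obtain t where "0 \<le> t" "\<phi> t = L" using IVT[of \<phi> 0 L T] start cont by blast
  then show ?thesis using that \<phi>(1)[of t] by simp
qed

lemma Lp_norm_weighted_integral: "Lp_norm p w E f = ennreal_power (weighted_integral p w E f) (1 / p)"
  by (simp add: Lp_norm_def weighted_integral_def)

lemma Lp_norm_finite_iff: "0 < p \<Longrightarrow> Lp_norm p w UNIV g < top \<longleftrightarrow> weighted_integral p w UNIV g < top"
  by (simp add: Lp_norm_weighted_integral ennreal_power_lt_top infinity_ennreal_def)

text \<open>The constant in the hypothesis need not be bounded on bounded sets of characteristics. Damping
  the weight on one of two disjoint cubes, the one carrying less of the norm of \<open>g\<close>, moves its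
  characteristic continuously up to a prescribed value, whence uniformity.\<close>

theorem weighted_bound_uniform:
  fixes F :: "((real ^ 'n \<Rightarrow> real) \<times> (real ^ 'n \<Rightarrow> real)) set"
  assumes F: "extrapolation_pairs F" and p: "1 \<le> p" and C1: "\<And>t. 0 < C1 t"
    and bd: "\<And>w f g. w \<in> muckenhoupt p \<Longrightarrow> (f, g) \<in> F \<Longrightarrow> (fin \<Longrightarrow> Lp_norm p w UNIV g < \<infinity>) \<Longrightarrow>
      Lp_norm p w UNIV g \<le> ennreal (C1 (muckenhoupt_const p w)) * Lp_norm p w UNIV f"
  shows "weighted_bound fin p F"
  unfolding weighted_bound_def
proof
  fix K :: real
  \<comment> \<open>All admissible weights are moved to this one characteristic, so only the value
    of \<open>C1\<close> at L enters. For negative K one has \<open>ennreal K = 0\<close>, hence the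
    maximum.\<close>
  define L where "L = max K 0"
  \<comment> \<open>The factor 2 pays for the part of g on the damped cube; the power p undoes the
    root in \<open>Lp_norm\<close>.\<close>
  define D where "D = 2 * C1 (ennreal L) powr p"
  have D: "0 < D" using C1[of "ennreal L"] by (simp add: D_def)
  show "\<exists>C>0. weighted_estimate C K fin p F"
  proof (intro exI[of _ D] conjI D weighted_estimateI)
    fix w :: "real ^ 'n \<Rightarrow> real" and f g
    assume w: "w \<in> muckenhoupt p" "muckenhoupt_const p w \<le> ennreal K" and fg: "(f, g) \<in> F"
      and fin: "fin \<longrightarrow> weighted_integral p w UNIV g < top"
    have [measurable]: "f \<in> borel_measurable lebesgue" "g \<in> borel_measurable lebesgue"
      using F fg by (auto simp: extrapolation_pairs_def)
    have [measurable]: "w \<in> borel_measurable lebesgue" and w0: "\<And>x. 0 \<le> w x"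
      using w by (auto simp: muckenhoupt_def weight_def)
    have wL: "muckenhoupt_const p w \<le> ennreal L" "0 \<le> L"
      using w(2) by (auto simp: L_def intro: order_trans ennreal_leI)
    define E1 E2 Q where "E1 = ccube (0 :: real ^ 'n) 1" and "E2 = ccube (\<chi> i. 3 :: real ^ 'n) 1"
      and "Q = ccube (0 :: real ^ 'n) 5"
    have cub: "E1 \<in> cubes" "E2 \<in> cubes" "Q \<in> cubes" unfolding E1_def E2_def Q_def by (auto intro: ccube_in_cubes)
    note [measurable] = cube_emeasure(3)[OF cub(1)] cube_emeasure(3)[OF cub(2)]
    have disj: "E1 \<inter> E2 = {}"
    proof (rule equals0I)
      fix x assume "x \<in> E1 \<inter> E2"
      then have "\<bar>x $ undefined\<bar> \<le> 1" "\<bar>x $ undefined - 3\<bar> \<le> 1" by (auto simp: E1_def E2_def mem_ccube)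
      then show False by linarith
    qed
    have sub: "E1 \<union> E2 \<subseteq> Q" unfolding E1_def E2_def Q_def
    proof (rule Un_least; rule subsetI)
      fix x :: "real ^ 'n" assume "x \<in> ccube 0 1"
      then show "x \<in> ccube 0 5" by (auto simp: mem_ccube intro: order_trans)
    next
      fix x :: "real ^ 'n" assume x: "x \<in> ccube (\<chi> i. 3) 1"
      have "\<bar>x $ i\<bar> \<le> 5" for i
      proof -
        have "\<bar>x $ i - 3\<bar> \<le> 1" using x by (simp add: mem_ccube)
        then show ?thesis by linarith
      qed
      then show "x \<in> ccube 0 5" by (simp add: mem_ccube)
    qed
    let ?I = "\<lambda>E. weighted_integral p w E g"
    have "?I UNIV \<le> (\<integral>\<^sup>+x. ennreal (norm (g x) powr p * w x) * indicator (- E1) x +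
        ennreal (norm (g x) powr p * w x) * indicator (- E2) x \<partial>lebesgue)"
      unfolding weighted_integral_def using disj
      by (intro nn_integral_mono) (auto simp: indicator_def)
    also have "\<dots> = ?I (- E1) + ?I (- E2)" unfolding weighted_integral_def
      by (rule nn_integral_add) measurable
    finally have sum: "?I UNIV \<le> ?I (- E1) + ?I (- E2)" .
    have *: "\<exists>E E'. E \<in> cubes \<and> E' \<in> cubes \<and> E \<inter> E' = {} \<and> E \<union> E' \<subseteq> Q \<and> ?I UNIV \<le> 2 * ?I (- E)"
    proof (cases "?I (- E1) \<le> ?I (- E2)")
      case True
      then have "?I UNIV \<le> 2 * ?I (- E2)" using order_trans[OF sum add_right_mono[OF True]] by (simp add: mult_2)
      then show ?thesis using cub disj sub by (intro exI[of _ E2] exI[of _ E1]) auto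
    next
      case False
      then have "?I (- E2) \<le> ?I (- E1)" by simp
      then have "?I UNIV \<le> 2 * ?I (- E1)" using order_trans[OF sum add_left_mono] by (simp add: mult_2)
      then show ?thesis using cub disj sub by (intro exI[of _ E1] exI[of _ E2]) auto
    qed
    then obtain E E' where E: "E \<in> cubes" "E' \<in> cubes" "E \<inter> E' = {}" "E \<union> E' \<subseteq> Q" and half: "?I UNIV \<le> 2 * ?I (- E)"
      by blast
    obtain t where t: "0 \<le> t" "muckenhoupt_const p (damped E w t) = ennreal L"
      using damped_attains_const[OF p w(1) wL E(1,2) cub(3) E(3,4)] by blast
    let ?v = "damped E w t"
    have v: "?v \<in> muckenhoupt p" by (rule damped_muckenhoupt[OF p w(1) E(1)])
    have dw: "?v x \<le> w x" for x
      using t(1) w0[of x] by (auto simp: damped_def mult_le_cancel_right2)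
    have vw: "weighted_integral p ?v UNIV h \<le> weighted_integral p w UNIV h" for h
      unfolding weighted_integral_def
      by (intro nn_integral_mono mult_right_mono ennreal_leI mult_left_mono dw) auto
    \<comment> \<open>Outside E damping does nothing, so the retained part of g is measured
      correctly; on the side of f it is enough that damping decreases the weight.\<close>
    have "?I (- E) \<le> weighted_integral p ?v UNIV g"
      unfolding weighted_integral_def by (intro nn_integral_mono) (auto simp: damped_def indicator_def)
    also have "\<dots> \<le> ennreal (C1 (ennreal L) powr p) * weighted_integral p ?v UNIV f"
    proof -
      have "fin \<Longrightarrow> Lp_norm p ?v UNIV g < \<infinity>"
        using fin vw[of g] p by (auto simp: Lp_norm_finite_iff intro: le_less_trans)
      then have "ennreal_power (weighted_integral p ?v UNIV g) (1 / p)
        \<le> ennreal (C1 (ennreal L)) * ennreal_power (weighted_integral p ?v UNIV f) (1 / p)"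
        using bd[OF v fg] unfolding Lp_norm_weighted_integral t(2) by blast
      then have "ennreal_power (ennreal_power (weighted_integral p ?v UNIV g) (1 / p)) p
        \<le> ennreal_power (ennreal (C1 (ennreal L)) * ennreal_power (weighted_integral p ?v UNIV f) (1 / p)) p"
        using p by (intro ennreal_power_mono) auto
      then show ?thesis using p C1[of "ennreal L"] by (simp add: ennreal_power_mult ennreal_power_power ennreal_power_ennreal)
    qed
    also have "\<dots> \<le> ennreal (C1 (ennreal L) powr p) * weighted_integral p w UNIV f"
      by (intro mult_left_mono vw) auto
    finally have "2 * ?I (- E) \<le> 2 * (ennreal (C1 (ennreal L) powr p) * weighted_integral p w UNIV f)"
      by (intro mult_left_mono) auto
    then show "?I UNIV \<le> ennreal D * weighted_integral p w UNIV f"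
      using order_trans[OF half] by (simp add: D_def ennreal_mult mult.assoc)
  qed
qed

section \<open>Doubling and reverse doubling\<close>

text \<open>The requirements on an A_p weight apart from its characteristic; they are also imposed
  on w^\<sigma>, for which no characteristic is computed.\<close>

definition pos_weight :: "(real ^ 'n \<Rightarrow> real) \<Rightarrow> bool" where
  "pos_weight u \<longleftrightarrow> u \<in> borel_measurable lebesgue \<and> (\<forall>x. 0 \<le> u x) \<and> (AE x in lebesgue. 0 < u x) \<and>
     (\<forall>Q\<in>cubes. weight_of u Q < top)"

lemma muckenhoupt_iff: "w \<in> muckenhoupt p \<longleftrightarrow> pos_weight w \<and> muckenhoupt_const p w < top"
  by (auto simp: muckenhoupt_def weight_iff pos_weight_def infinity_ennreal_def)

definition mass :: "(real ^ 'n \<Rightarrow> real) \<Rightarrow> (real ^ 'n) set \<Rightarrow> real" where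
  "mass u Q = enn2real (weight_of u Q)"

lemma weight_of_mass:
  assumes "pos_weight u" "Q \<in> cubes"
  shows "weight_of u Q = ennreal (mass u Q)" "0 < mass u Q"
  using assms weight_of_pos[of u Q] by (auto simp: pos_weight_def mass_def enn2real_positive_iff)

lemma weight_of_mono: "E \<subseteq> Q \<Longrightarrow> weight_of u E \<le> weight_of u Q"
  unfolding weight_of_def by (rule nn_set_integral_set_mono)

lemma weight_of_mass_subset:
  assumes u: "pos_weight u" and Q: "Q \<in> cubes" and E: "E \<subseteq> Q"
  shows "weight_of u E = ennreal (mass u E)" "0 \<le> mass u E" "mass u E \<le> mass u Q"
proof -
  have "weight_of u E \<le> weight_of u Q" using E by (rule weight_of_mono)
  moreover have "weight_of u Q < top" using weight_of_mass[OF u Q] by simp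
  ultimately show "weight_of u E = ennreal (mass u E)" "mass u E \<le> mass u Q"
    unfolding mass_def by (auto intro!: enn2real_mono intro: le_less_trans)
qed (simp add: mass_def)

text \<open>A quantitative \<open>A\<^sub>\<infinity>\<close> property; it contains both doubling and reverse doubling.\<close>

definition thick :: "(real ^ 'n \<Rightarrow> real) \<Rightarrow> bool" where
  "thick u \<longleftrightarrow> (\<forall>\<eta>>0. \<exists>c>0. \<forall>Q\<in>cubes. \<forall>E\<in>sets lebesgue. E \<subseteq> Q \<longrightarrow>
     \<eta> * measure lebesgue Q \<le> measure lebesgue E \<longrightarrow> c * mass u Q \<le> mass u E)"

lemma thickE:
  fixes u :: "real ^ 'n \<Rightarrow> real"
  assumes "thick u" "0 < \<eta>"
  obtains c where "0 < c" "\<And>Q E. Q \<in> cubes \<Longrightarrow> E \<in> sets lebesgue \<Longrightarrow> E \<subseteq> Q \<Longrightarrow>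
     \<eta> * measure lebesgue Q \<le> measure lebesgue E \<Longrightarrow> c * mass u Q \<le> mass u E"
proof -
  have "\<exists>c>0. \<forall>Q\<in>cubes. \<forall>E\<in>sets lebesgue. E \<subseteq> Q \<longrightarrow>
     \<eta> * measure lebesgue Q \<le> measure lebesgue E \<longrightarrow> c * mass u Q \<le> mass u E"
    using assms unfolding thick_def by (elim allE impE)
  then show ?thesis using that by (elim exE conjE) simp
qed

lemma measure_cube:
  fixes Q :: "(real ^ 'n) set"
  assumes "Q \<in> cubes"
  shows "emeasure lebesgue Q = ennreal (measure lebesgue Q)" "0 < measure lebesgue Q"
proof -
  obtain m where "emeasure lebesgue Q = ennreal m" "0 < m" using assms by (rule cube_emeasure_real)
  then show "emeasure lebesgue Q = ennreal (measure lebesgue Q)" "0 < measure lebesgue Q"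
    by (simp_all add: measure_def)
qed

lemma measure_cube_subset:
  fixes Q :: "(real ^ 'n) set"
  assumes "Q \<in> cubes" "E \<subseteq> Q" "E \<in> sets lebesgue"
  shows "emeasure lebesgue E = ennreal (measure lebesgue E)" "measure lebesgue E \<le> measure lebesgue Q"
proof -
  have le: "emeasure lebesgue E \<le> emeasure lebesgue Q" using assms cube_emeasure(3) by (intro emeasure_mono) auto
  then have "emeasure lebesgue E < top" using cube_emeasure(2)[OF assms(1)] by (rule le_less_trans)
  then show eq: "emeasure lebesgue E = ennreal (measure lebesgue E)" by (simp add: emeasure_eq_ennreal_measure)
  show "measure lebesgue E \<le> measure lebesgue Q"
    using le unfolding eq measure_cube(1)[OF assms(1)] by (simp add: ennreal_le_iff)
qed

lemma thick_muckenhoupt: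
  fixes w :: "real ^ 'n \<Rightarrow> real"
  assumes p: "1 \<le> p" and w: "w \<in> muckenhoupt p"
  shows "thick w"
  unfolding thick_def
proof (intro allI impI)
  fix \<eta> :: real assume \<eta>: "0 < \<eta>"
  have pw: "pos_weight w" and fin: "muckenhoupt_const p w < top" using w by (auto simp: muckenhoupt_iff)
  then have [measurable]: "w \<in> borel_measurable lebesgue" and w0: "\<And>x. 0 \<le> w x" and wpos: "AE x in lebesgue. 0 < w x"
    by (auto simp: pos_weight_def)
  show "\<exists>c>0. \<forall>Q\<in>cubes. \<forall>E\<in>sets lebesgue. E \<subseteq> Q \<longrightarrow>
     \<eta> * measure lebesgue Q \<le> measure lebesgue E \<longrightarrow> c * mass w Q \<le> mass w E"
  proof (cases "p = 1")
    case True
    obtain c where c: "c < top" "\<And>Q. Q \<in> cubes \<Longrightarrow> AE x in lebesgue. x \<in> Q \<longrightarrow> cube_average w Q \<le> c * ennreal (w x)"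
      using fin True unfolding muckenhoupt_const_def by (auto simp: Inf_less_iff)
    define k where "k = enn2real c + 1"
    have k: "0 < k" "c \<le> ennreal k"
      using c(1) enn2real_nonneg[of c] unfolding k_def by (cases c; simp add: add_nonneg_pos)+
    show ?thesis
    proof (intro exI[of _ "\<eta> / k"] conjI ballI impI)
      fix Q E :: "(real ^ 'n) set" assume Q: "Q \<in> cubes" and E [measurable]: "E \<in> sets lebesgue" and EQ: "E \<subseteq> Q"
        and le: "\<eta> * measure lebesgue Q \<le> measure lebesgue E"
      let ?m = "measure lebesgue Q" and ?e = "measure lebesgue E"
      note m = measure_cube[OF Q] and W = weight_of_mass[OF pw Q] and e = measure_cube_subset[OF Q EQ E]
      have "cube_average w Q = ennreal (mass w Q / ?m)"
        unfolding cube_average_def using m W by (simp add: divide_ennreal)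
      then have "AE x in lebesgue. x \<in> E \<longrightarrow> ennreal (mass w Q / ?m) \<le> ennreal k * ennreal (w x)"
        using c(2)[OF Q]
      proof eventually_elim
        case (elim x)
        have "c * ennreal (w x) \<le> ennreal k * ennreal (w x)" using k(2) by (rule mult_right_mono) simp
        then show ?case using elim EQ \<open>cube_average w Q = _\<close> by (auto intro: order_trans)
      qed
      then have "(\<integral>\<^sup>+x. ennreal (mass w Q / ?m) * indicator E x \<partial>lebesgue) \<le> (\<integral>\<^sup>+x. ennreal k * (ennreal (w x) * indicator E x) \<partial>lebesgue)"
        by (intro nn_integral_mono_AE) (auto elim!: eventually_mono simp: indicator_def)
      also have "\<dots> = ennreal k * weight_of w E"
        unfolding weight_of_def by (rule nn_integral_cmult) measurable
      finally have "ennreal (mass w Q / ?m) * ennreal ?e \<le> ennreal k * ennreal (mass w E)"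
        using e(1) weight_of_mass_subset(1)[OF pw Q EQ] by (simp add: nn_integral_cmult_indicator)
      then have "mass w Q / ?m * ?e \<le> k * mass w E"
        using m W k weight_of_mass_subset(2)[OF pw Q EQ] by (simp flip: ennreal_mult)
      moreover have "\<eta> * mass w Q \<le> mass w Q / ?m * ?e"
        using le m W(2) by (simp add: field_simps)
      ultimately show "\<eta> / k * mass w Q \<le> mass w E" using k by (simp add: field_simps)
    qed (use \<eta> k in simp)
  next
    case False
    then have p: "1 < p" using p by simp
    define t where "t = 1 - p / (p - 1)"
    have t: "t < 0" "t * (p - 1) = - 1" using p by (auto simp: t_def field_simps)
    define K where "K = enn2real (muckenhoupt_const p w) + 1"
    have K: "0 < K" "muckenhoupt_const p w \<le> ennreal K"
      using fin enn2real_nonneg[of "muckenhoupt_const p w"] unfolding K_def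
      by (cases "muckenhoupt_const p w"; simp add: add_nonneg_pos)+
    show ?thesis
    proof (intro exI[of _ "(\<eta> / 2) powr p / K"] conjI ballI impI)
      fix Q E :: "(real ^ 'n) set" assume Q: "Q \<in> cubes" and E [measurable]: "E \<in> sets lebesgue" and EQ: "E \<subseteq> Q"
        and le: "\<eta> * measure lebesgue Q \<le> measure lebesgue E"
      define m where "m = measure lebesgue Q"
      define e where "e = measure lebesgue E"
      have m: "emeasure lebesgue Q = ennreal m" "0 < m" using measure_cube[OF Q] by (auto simp: m_def)
      have e: "emeasure lebesgue E = ennreal e" "\<eta> * m \<le> e" using measure_cube_subset[OF Q EQ E] le by (auto simp: e_def m_def)
      have e0: "0 < e" using e(2) \<eta> m(2) by (auto intro: less_le_trans[rotated])
      note W = weight_of_mass[OF pw Q]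
      define y where "y = mass w E"
      have "0 < weight_of w E" using e e0 wpos by (intro weight_of_pos_set) auto
      then have y: "weight_of w E = ennreal y" "0 < y"
        using weight_of_mass_subset(1)[OF pw Q EQ] by (auto simp: y_def)
      have ap: "ennreal (mass w Q) * ennreal_power (weight_of (\<lambda>x. w x powr t) Q) (p - 1) \<le> ennreal (K * m powr p)"
        using K Q m p W unfolding muckenhoupt_const_le_iff[OF p] t_def[symmetric]
        by (auto simp: ennreal_power_ennreal ennreal_mult)
      have "weight_of (\<lambda>x. w x powr t) Q < top"
      proof (rule ccontr)
        assume "\<not> weight_of (\<lambda>x. w x powr t) Q < top"
        then have "weight_of (\<lambda>x. w x powr t) Q = top" by (metis top.not_eq_extremum)
        then show False using ap W(2) p by (auto simp: ennreal_power_top ennreal_mult_top top_unique)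
      qed
      then obtain S where S: "0 \<le> S" "weight_of (\<lambda>x. w x powr t) Q = ennreal S"
        by (cases "weight_of (\<lambda>x. w x powr t) Q") auto
      have ap': "mass w Q * S powr (p - 1) \<le> K * m powr p"
        using ap S W p K by (simp add: ennreal_power_ennreal flip: ennreal_mult)
      \<comment> \<open>Chosen so that the first term of the pointwise splitting integrates over E
        to exactly half of |E| and can be absorbed.\<close>
      define s where "s = e / (2 * y)"
      have s: "0 < s" using e0 y by (simp add: s_def)
      have ptw: "1 \<le> s * z + s powr t * z powr t" if "0 < z" for z
      proof (cases "1 \<le> s * z")
        case True
        then show ?thesis by (simp add: add_increasing2)
      next
        case False
        then have "1 powr t \<le> (s * z) powr t" using t s that by (intro powr_mono2') auto
        then show ?thesis using s that by (simp add: powr_mult add_increasing)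
      qed
      have "ennreal e = (\<integral>\<^sup>+x. indicator E x \<partial>lebesgue)" using e(1) by simp
      also have "\<dots> \<le> (\<integral>\<^sup>+x. ennreal s * (ennreal (w x) * indicator E x) + ennreal (s powr t) * (ennreal (w x powr t) * indicator E x) \<partial>lebesgue)"
      proof (rule nn_integral_mono_AE, use wpos in eventually_elim)
        case (elim x)
        show ?case using ptw[OF elim] elim s
          by (auto simp: indicator_def simp flip: ennreal_mult ennreal_plus ennreal_1 intro!: ennreal_leI)
      qed
      also have "\<dots> = ennreal s * weight_of w E + ennreal (s powr t) * weight_of (\<lambda>x. w x powr t) E"
        unfolding weight_of_def by (simp add: nn_integral_add nn_integral_cmult)
      also have "\<dots> \<le> ennreal s * ennreal y + ennreal (s powr t) * ennreal S"
        using weight_of_mono[OF EQ, of "\<lambda>x. w x powr t"] S y by (intro add_mono mult_left_mono) auto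
      also have "\<dots> = ennreal (e / 2 + s powr t * S)"
        using s y S e0 by (simp add: s_def flip: ennreal_mult ennreal_plus)
      finally have "e \<le> e / 2 + s powr t * S" using s S e0 by (subst (asm) ennreal_le_iff) (auto intro: add_nonneg_nonneg)
      then have "e / 2 \<le> s powr t * S" by simp
      then have "(e / 2) powr (p - 1) \<le> (s powr t * S) powr (p - 1)" using e0 p by (intro powr_mono2) auto
      also have "\<dots> = (1 / s) * S powr (p - 1)" using s S t(2) by (simp add: powr_mult powr_powr powr_minus_divide)
      finally have "(e / 2) powr (p - 1) \<le> y * S powr (p - 1) / (e / 2)" using e0 y by (simp add: s_def field_simps)
      then have "(e / 2) powr (p - 1) * (e / 2) \<le> y * S powr (p - 1)" using e0 by (simp add: pos_le_divide_eq)
      moreover have "(e / 2) powr (p - 1) * (e / 2) = (e / 2) powr p" using e0 by (simp add: powr_diff)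
      ultimately have 1: "(e / 2) powr p \<le> y * S powr (p - 1)" by simp
      have "(\<eta> / 2) powr p * m powr p = (\<eta> * m / 2) powr p" using \<eta> m by (simp flip: powr_mult)
      also have "\<dots> \<le> (e / 2) powr p" using e \<eta> m p by (intro powr_mono2) auto
      finally have "mass w Q * ((\<eta> / 2) powr p * m powr p) \<le> mass w Q * (y * S powr (p - 1))"
        using 1 W(2) by (intro mult_left_mono) auto
      also have "\<dots> = y * (mass w Q * S powr (p - 1))" by simp
      also have "\<dots> \<le> y * (K * m powr p)" using ap' y by (intro mult_left_mono) auto
      finally have "m powr p * (mass w Q * (\<eta> / 2) powr p) \<le> m powr p * (y * K)" by (simp add: mult_ac)
      then have "mass w Q * (\<eta> / 2) powr p \<le> y * K" using m(2) by simp
      then show "(\<eta> / 2) powr p / K * mass w Q \<le> mass w E" using K by (simp add: y_def field_simps)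
    qed (use \<eta> K in simp)
  qed
qed

section \<open>Powers of a reverse Hoelder weight\<close>

definition reverse_holder_const :: "real \<Rightarrow> (real ^ 'n \<Rightarrow> real) \<Rightarrow> real \<Rightarrow> bool" where
  "reverse_holder_const \<sigma> w c \<longleftrightarrow> (\<forall>Q\<in>cubes.
     ennreal_power (cube_average (\<lambda>x. w x powr \<sigma>) Q) (1 / \<sigma>) \<le> ennreal c * cube_average w Q)"

text \<open>The finite right-hand side forces w^\<sigma> to be integrable on cubes; the second claim
  is the inequality multiplied by |Q|. Admitting \<sigma> = 1, where it is trivial with c = 1, lets
  one argument serve both types of Morrey space.\<close>

lemma reverse_holder_pos_weight:
  fixes w :: "real ^ 'n \<Rightarrow> real"
  assumes w: "pos_weight w" and \<sigma>: "1 \<le> \<sigma>" and rh: "reverse_holder_const \<sigma> w c" and c: "0 < c"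
  shows "pos_weight (\<lambda>x. w x powr \<sigma>)"
    and "Q \<in> cubes \<Longrightarrow> mass (\<lambda>x. w x powr \<sigma>) Q powr (1 / \<sigma>) * measure lebesgue Q powr (1 - 1 / \<sigma>) \<le> c * mass w Q"
proof -
  let ?W = "\<lambda>x. w x powr \<sigma>"
  have [measurable]: "w \<in> borel_measurable lebesgue" and w0: "\<And>x. 0 \<le> w x" and wpos: "AE x in lebesgue. 0 < w x"
    using w by (auto simp: pos_weight_def)
  have rhQ: "ennreal_power (cube_average ?W Q) (1 / \<sigma>) \<le> ennreal (c * (mass w Q / measure lebesgue Q))" if Q: "Q \<in> cubes" for Q
    using rh[unfolded reverse_holder_const_def, rule_format, OF Q] c weight_of_mass[OF w Q] measure_cube[OF Q]
    by (simp add: cube_average_def divide_ennreal flip: ennreal_mult)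
  have fin: "weight_of ?W Q < top" if Q: "Q \<in> cubes" for Q
  proof (rule ccontr)
    assume "\<not> weight_of ?W Q < top"
    then have "weight_of ?W Q = top" by (metis top.not_eq_extremum)
    then have "cube_average ?W Q = top" using measure_cube[OF Q] by (simp add: cube_average_def ennreal_top_divide)
    then show False using rhQ[OF Q] \<sigma> by (simp add: ennreal_power_top top_unique)
  qed
  then show pw: "pos_weight ?W" using wpos by (auto simp: pos_weight_def elim!: eventually_mono)
  assume Q: "Q \<in> cubes"
  let ?m = "measure lebesgue Q"
  note W = weight_of_mass[OF pw Q] and m = measure_cube[OF Q]
  have "ennreal ((mass ?W Q / ?m) powr (1 / \<sigma>)) \<le> ennreal (c * (mass w Q / ?m))"
    using rhQ[OF Q] W m \<sigma> by (simp add: cube_average_def divide_ennreal ennreal_power_ennreal)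
  then have "(mass ?W Q / ?m) powr (1 / \<sigma>) \<le> c * (mass w Q / ?m)"
    using c m weight_of_mass(2)[OF w Q] by (subst (asm) ennreal_le_iff) auto
  then have "(mass ?W Q / ?m) powr (1 / \<sigma>) * ?m \<le> c * mass w Q" using m(2) by (simp add: field_simps)
  moreover have "(mass ?W Q / ?m) powr (1 / \<sigma>) * ?m = mass ?W Q powr (1 / \<sigma>) * ?m powr (1 - 1 / \<sigma>)"
    using m(2) W(2) by (simp add: powr_divide powr_diff)
  ultimately show "mass ?W Q powr (1 / \<sigma>) * ?m powr (1 - 1 / \<sigma>) \<le> c * mass w Q" by simp
qed

text \<open>Hoelder's inequality up to the factor 2: w is split at the height t = (W(E) /
  |E|)^(1/\<sigma>) with W = w^\<sigma>, where both resulting terms equal t |E|.\<close>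

lemma mass_le_power_mass:
  fixes w :: "real ^ 'n \<Rightarrow> real"
  assumes w: "pos_weight w" and pW: "pos_weight (\<lambda>x. w x powr \<sigma>)" and \<sigma>: "1 \<le> \<sigma>"
    and Q: "Q \<in> cubes" "E \<subseteq> Q" and E [measurable]: "E \<in> sets lebesgue" and e: "0 < measure lebesgue E"
  shows "mass w E \<le> 2 * (measure lebesgue E powr (1 - 1 / \<sigma>) * mass (\<lambda>x. w x powr \<sigma>) E powr (1 / \<sigma>))"
proof -
  let ?W = "\<lambda>x. w x powr \<sigma>" and ?e = "measure lebesgue E"
  have [measurable]: "w \<in> borel_measurable lebesgue" and w0: "\<And>x. 0 \<le> w x" and wpos: "AE x in lebesgue. 0 < w x"
    using w by (auto simp: pos_weight_def)
  have em: "emeasure lebesgue E = ennreal ?e" by (rule measure_cube_subset[OF Q E])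
  have "0 < weight_of ?W E" using em e wpos by (intro weight_of_pos_set) (auto elim!: eventually_mono)
  then have W: "weight_of ?W E = ennreal (mass ?W E)" "0 < mass ?W E"
    using weight_of_mass_subset(1)[OF pW Q] by auto
  note wE = weight_of_mass_subset[OF w Q]
  define t where "t = (mass ?W E / ?e) powr (1 / \<sigma>)"
  have t: "0 < t" using W e by (simp add: t_def)
  have tE: "t * ?e = ?e powr (1 - 1 / \<sigma>) * mass ?W E powr (1 / \<sigma>)"
    unfolding t_def using W e by (simp add: powr_divide powr_diff)
  have ptw: "z \<le> t + t powr (1 - \<sigma>) * z powr \<sigma>" if z: "0 \<le> z" for z
    using young_scaled[OF \<sigma> t zero_less_one z] by simp
  have "weight_of w E \<le> (\<integral>\<^sup>+x. ennreal t * indicator E x + ennreal (t powr (1 - \<sigma>)) * (ennreal (?W x) * indicator E x) \<partial>lebesgue)"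
    unfolding weight_of_def using ptw w0 t
    by (intro nn_integral_mono) (auto simp: indicator_def simp flip: ennreal_mult ennreal_plus intro!: ennreal_leI)
  also have "\<dots> = ennreal t * ennreal ?e + ennreal (t powr (1 - \<sigma>)) * weight_of ?W E"
    unfolding weight_of_def using em by (simp add: nn_integral_add nn_integral_cmult nn_integral_cmult_indicator)
  also have "\<dots> = ennreal (t * ?e + t powr (1 - \<sigma>) * mass ?W E)"
    using W t e by (simp flip: ennreal_mult ennreal_plus)
  finally have "mass w E \<le> t * ?e + t powr (1 - \<sigma>) * mass ?W E"
    using t W e unfolding wE(1) by (subst (asm) ennreal_le_iff) (auto intro: add_nonneg_nonneg)
  also have "t powr (1 - \<sigma>) * mass ?W E = t * ?e"
  proof -
    have "t powr \<sigma> = mass ?W E / ?e" using W e \<sigma> by (simp add: t_def powr_powr)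
    then show ?thesis using t W e by (simp add: powr_diff)
  qed
  finally show ?thesis using tE by simp
qed

text \<open>Reverse Hoelder on Q bounds W(Q)^(1/\<sigma>) from above by w(Q), Hoelder on E bounds
  W(E)^(1/\<sigma>) from below by w(E), and thickness of w links the two; the volume factors compare
  the right way because |E| \<le> |Q|.\<close>

lemma thick_reverse_holder:
  fixes w :: "real ^ 'n \<Rightarrow> real"
  assumes w: "pos_weight w" and th: "thick w" and \<sigma>: "1 \<le> \<sigma>" and rh: "reverse_holder_const \<sigma> w c" and c: "0 < c"
  shows "thick (\<lambda>x. w x powr \<sigma>)"
  unfolding thick_def
proof (intro allI impI)
  let ?W = "\<lambda>x. w x powr \<sigma>"
  note pW = reverse_holder_pos_weight(1)[OF w \<sigma> rh c] and rhQ = reverse_holder_pos_weight(2)[OF w \<sigma> rh c]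
  fix \<eta> :: real assume \<eta>: "0 < \<eta>"
  obtain d where d: "0 < d" "\<And>Q E. Q \<in> cubes \<Longrightarrow> E \<in> sets lebesgue \<Longrightarrow> E \<subseteq> Q \<Longrightarrow>
     \<eta> * measure lebesgue Q \<le> measure lebesgue E \<Longrightarrow> d * mass w Q \<le> mass w E"
    using th \<eta> by (rule thickE) blast
  show "\<exists>k>0. \<forall>Q\<in>cubes. \<forall>E\<in>sets lebesgue. E \<subseteq> Q \<longrightarrow>
     \<eta> * measure lebesgue Q \<le> measure lebesgue E \<longrightarrow> k * mass ?W Q \<le> mass ?W E"
  proof (intro exI[of _ "(d / (2 * c)) powr \<sigma>"] conjI ballI impI)
    fix Q E :: "(real ^ 'n) set" assume Q: "Q \<in> cubes" and E: "E \<in> sets lebesgue" and EQ: "E \<subseteq> Q"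
      and le: "\<eta> * measure lebesgue Q \<le> measure lebesgue E"
    let ?m = "measure lebesgue Q" and ?e = "measure lebesgue E" and ?a = "1 - 1 / \<sigma>"
    have a: "0 \<le> ?a" using \<sigma> by simp
    have m: "0 < ?m" by (rule measure_cube[OF Q])
    have e: "0 < ?e" using le \<eta> m by (auto intro: less_le_trans[rotated])
    have WQ: "0 < mass ?W Q" by (rule weight_of_mass[OF pW Q])
    have "d / (2 * c) * (mass ?W Q powr (1 / \<sigma>) * ?m powr ?a) \<le> d / (2 * c) * (c * mass w Q)"
      using rhQ[OF Q] d c by (intro mult_left_mono) auto
    also have "\<dots> = d * mass w Q / 2" using c by simp
    also have "\<dots> \<le> mass w E / 2" using d(2)[OF Q E EQ le] by simp
    also have "\<dots> \<le> ?e powr ?a * mass ?W E powr (1 / \<sigma>)"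
      using mass_le_power_mass[OF w pW \<sigma> Q EQ E e] by simp
    also have "\<dots> \<le> ?m powr ?a * mass ?W E powr (1 / \<sigma>)"
      using measure_cube_subset[OF Q EQ E] e a by (intro mult_right_mono powr_mono2) auto
    finally have "?m powr ?a * (d / (2 * c) * mass ?W Q powr (1 / \<sigma>)) \<le> ?m powr ?a * mass ?W E powr (1 / \<sigma>)"
      by (simp add: mult_ac)
    then have "d / (2 * c) * mass ?W Q powr (1 / \<sigma>) \<le> mass ?W E powr (1 / \<sigma>)"
      using m by (subst (asm) mult_le_cancel_left_pos) auto
    then have "(d / (2 * c) * mass ?W Q powr (1 / \<sigma>)) powr \<sigma> \<le> (mass ?W E powr (1 / \<sigma>)) powr \<sigma>"
      using d c \<sigma> by (intro powr_mono2) auto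
    then show "(d / (2 * c)) powr \<sigma> * mass ?W Q \<le> mass ?W E"
      using \<sigma> WQ weight_of_mass_subset(2)[OF pW Q EQ] d(1) c
      by (subst (asm) powr_mult) (auto simp: powr_powr)
  qed (use d c in simp)
qed

text \<open>Doubling is thickness for a cube in its double, which it fills to the fraction 2^(-n).
  Reverse doubling is thickness for the complement, which in dimension at least 1 fills at least
  half of the double.\<close>

lemma thick_doubling:
  fixes u :: "real ^ 'n \<Rightarrow> real"
  assumes u: "pos_weight u" and th: "thick u"
  obtains \<gamma> D where "0 < \<gamma>" "\<gamma> < 1" "1 \<le> D"
    "\<And>x h. 0 < h \<Longrightarrow> mass u (ccube x h) \<le> \<gamma> * mass u (ccube x (2 * h))"
    "\<And>x h. 0 < h \<Longrightarrow> mass u (ccube x (2 * h)) \<le> D * mass u (ccube x h)"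
proof -
  let ?n = "CARD('n)"
  have [measurable]: "u \<in> borel_measurable lebesgue" using u by (simp add: pos_weight_def)
  obtain c1 where c1: "0 < c1" "\<And>Q E. Q \<in> cubes \<Longrightarrow> E \<in> sets lebesgue \<Longrightarrow> E \<subseteq> Q \<Longrightarrow>
     1 / 2 * measure lebesgue Q \<le> measure lebesgue E \<Longrightarrow> c1 * mass u Q \<le> mass u E"
    using th by (rule thickE[where \<eta>="1 / 2"]) auto
  obtain c2 where c2: "0 < c2" "\<And>Q E. Q \<in> cubes \<Longrightarrow> E \<in> sets lebesgue \<Longrightarrow> E \<subseteq> Q \<Longrightarrow>
     1 / 2 ^ ?n * measure lebesgue Q \<le> measure lebesgue E \<Longrightarrow> c2 * mass u Q \<le> mass u E"
    using th by (rule thickE[where \<eta>="1 / 2 ^ ?n"]) auto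
  have meas: "measure lebesgue (ccube x h) = (2 * h) ^ ?n" if "0 < h" for x :: "real ^ 'n" and h
    using emeasure_ccube[of h x] that by (simp add: measure_def)
  have sub: "ccube x h \<subseteq> ccube x (2 * h)" if "0 < h" for x :: "real ^ 'n" and h
  proof
    fix y assume "y \<in> ccube x h"
    then have "\<bar>y $ i - x $ i\<bar> \<le> h" for i by (simp add: mem_ccube)
    have "\<bar>y $ i - x $ i\<bar> \<le> 2 * h" for i
      using \<open>\<bar>y $ i - x $ i\<bar> \<le> h\<close> \<open>0 < h\<close> by linarith
    then show "y \<in> ccube x (2 * h)" by (simp add: mem_ccube)
  qed
  show ?thesis
  proof (rule that)
    \<comment> \<open>The maximum with 1 / 2 secures positivity of the ratio, which is later raised
      to real powers and divided by.\<close>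
    show "0 < max (1 - c1) (1 / 2)" by simp
    show "max (1 - c1) (1 / 2) < 1" using c1 by simp
    show "1 \<le> max 1 (1 / c2)" by simp
  next
    fix x :: "real ^ 'n" and h :: real assume h: "0 < h"
    let ?Q = "ccube x h" and ?R = "ccube x (2 * h)"
    have Q: "?Q \<in> cubes" and R: "?R \<in> cubes" using h by (auto intro: ccube_in_cubes)
    note [measurable] = cube_emeasure(3)[OF Q] cube_emeasure(3)[OF R]
    have "1 / 2 ^ ?n * measure lebesgue ?R \<le> measure lebesgue ?Q"
    proof -
      have "(2 * (2 * h)) ^ ?n = 2 ^ ?n * (2 * h) ^ ?n" by (rule power_mult_distrib)
      then show ?thesis using h by (simp only: meas) simp
    qed
    then have "c2 * mass u ?R \<le> mass u ?Q" using c2(2)[OF R _ sub[OF h]] by simp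
    then have "mass u ?R \<le> 1 / c2 * mass u ?Q" using c2(1) by (simp add: field_simps)
    also have "\<dots> \<le> max 1 (1 / c2) * mass u ?Q"
      using weight_of_mass(2)[OF u Q] by (intro mult_right_mono) auto
    finally show "mass u ?R \<le> max 1 (1 / c2) * mass u ?Q" .
    have diff: "measure lebesgue (?R - ?Q) = measure lebesgue ?R - measure lebesgue ?Q"
      using sub[OF h, of x] measure_cube[OF Q] measure_cube[OF R]
      by (intro measure_Diff) auto
    have "2 * (2 * h) ^ ?n \<le> 2 ^ ?n * (2 * h) ^ ?n"
      using h by (intro mult_right_mono self_le_power[of "2::real"]) auto
    then have "1 / 2 * measure lebesgue ?R \<le> measure lebesgue (?R - ?Q)"
    proof -
      have "(2 * (2 * h)) ^ ?n = 2 ^ ?n * (2 * h) ^ ?n" by (rule power_mult_distrib)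
      then show ?thesis using h \<open>2 * (2 * h) ^ ?n \<le> _\<close> by (simp add: diff meas)
    qed
    then have 1: "c1 * mass u ?R \<le> mass u (?R - ?Q)" by (intro c1(2) R) auto
    have "weight_of u ?R = weight_of u ?Q + weight_of u (?R - ?Q)"
    proof -
      have "weight_of u ?R = (\<integral>\<^sup>+y. ennreal (u y) * indicator ?Q y + ennreal (u y) * indicator (?R - ?Q) y \<partial>lebesgue)"
        unfolding weight_of_def using sub[OF h, of x]
        by (intro nn_integral_cong) (auto simp: indicator_def)
      also have "\<dots> = weight_of u ?Q + weight_of u (?R - ?Q)"
        unfolding weight_of_def by (rule nn_integral_add) measurable
      finally show ?thesis .
    qed
    then have "ennreal (mass u ?R) = ennreal (mass u ?Q + mass u (?R - ?Q))"
      using weight_of_mass[OF u Q] weight_of_mass[OF u R] weight_of_mass_subset[OF u R, of "?R - ?Q"] by simp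
    then have "mass u ?R = mass u ?Q + mass u (?R - ?Q)"
      using weight_of_mass(2)[OF u Q] weight_of_mass(2)[OF u R] weight_of_mass_subset(2)[OF u R, of "?R - ?Q"]
      by (subst (asm) ennreal_inj) auto
    then have "mass u ?Q \<le> (1 - c1) * mass u ?R" using 1 by (simp add: algebra_simps)
    also have "\<dots> \<le> max (1 - c1) (1 / 2) * mass u ?R"
      using weight_of_mass(2)[OF u R] by (intro mult_right_mono) auto
    finally show "mass u ?Q \<le> max (1 - c1) (1 / 2) * mass u ?R" .
  qed
qed

section \<open>Layered weights\<close>

definition dil :: "real ^ 'n \<Rightarrow> real \<Rightarrow> nat \<Rightarrow> (real ^ 'n) set" where
  "dil x h j = ccube x (2 ^ j * h)"

lemma dil_0: "dil x h 0 = ccube x h"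
  by (simp add: dil_def)

lemma dil_in_cubes: "0 < h \<Longrightarrow> dil x h j \<in> cubes"
  unfolding dil_def by (intro ccube_in_cubes) simp

lemma ccube_mono: "r \<le> s \<Longrightarrow> ccube x r \<subseteq> ccube x s"
  unfolding mem_ccube subset_iff by (meson order_trans)

lemma dil_mono: "j \<le> k \<Longrightarrow> 0 < h \<Longrightarrow> dil x h j \<subseteq> dil x h k"
  unfolding dil_def by (intro ccube_mono mult_right_mono power_increasing) auto

lemma bounded_subset_dil:
  assumes "bounded S" "0 < h"
  obtains j where "S \<subseteq> dil x h j"
proof -
  obtain r where r: "0 < r" "S \<subseteq> ccube x r" using assms(1) by (rule bounded_subset_ccube)
  obtain j where "r / h < 2 ^ j" using real_arch_pow[of 2 "r / h"] by auto
  then have "r \<le> 2 ^ j * h" using assms(2) by (simp add: field_simps)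
  then show ?thesis using that[of j] r(2) ccube_mono[of r "2 ^ j * h" x] unfolding dil_def by blast
qed

text \<open>For a nonincreasing sequence this is the step function with value a j on dilate j minus
  dilate j - 1. As a supremum it is visibly measurable and below the corresponding sum.\<close>

definition layered :: "(nat \<Rightarrow> real) \<Rightarrow> real ^ 'n \<Rightarrow> real \<Rightarrow> real ^ 'n \<Rightarrow> real" where
  "layered a x h y = enn2real (SUP j. ennreal (a j) * indicator (dil x h j) y)"

text \<open>The last clause makes \<open>layered a x h\<close> an \<open>A\<^sub>1\<close> weight with respect to the measure \<open>w dx\<close>;
  it replaces a power of the maximal function of the indicator of a cube.\<close>

definition layer_seq :: "real \<Rightarrow> real \<Rightarrow> (real ^ 'n \<Rightarrow> real) \<Rightarrow> real ^ 'n \<Rightarrow> real \<Rightarrow> (nat \<Rightarrow> real) \<Rightarrow> bool" where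
  "layer_seq D C w x h a \<longleftrightarrow> a 0 = 1 \<and> (\<forall>j. 0 < a j \<and> a (Suc j) \<le> a j \<and> a j \<le> D * a (Suc j)) \<and>
     (\<forall>J. (\<Sum>j\<le>J. a j * mass w (dil x h j)) \<le> C * (a J * mass w (dil x h J)))"

lemma layer_seq_decreasing:
  assumes "layer_seq D C w x h a" "j \<le> k"
  shows "a k \<le> a j"
  using assms(2)
proof (induction rule: dec_induct)
  case (step n)
  then show ?case using assms(1) unfolding layer_seq_def by (meson order_trans)
qed simp

lemma layered_props:
  fixes x :: "real ^ 'n"
  assumes a: "layer_seq D C w x h a" and h: "0 < h"
  shows "layered a x h \<in> borel_measurable lebesgue"
    and "y \<in> dil x h J \<Longrightarrow> a J \<le> layered a x h y"
    and "y \<notin> dil x h J \<Longrightarrow> layered a x h y \<le> a (Suc J)"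
    and "layered a x h y \<le> 1"
    and "0 < layered a x h y"
    and "y \<in> dil x h J \<Longrightarrow> ennreal (layered a x h y) \<le> (\<Sum>j\<le>J. ennreal (a j) * indicator (dil x h j) y)"
    and "ennreal (layered a x h y) \<le> (\<Sum>j. ennreal (a j) * indicator (dil x h j) y)"
proof -
  have [measurable]: "dil x h j \<in> sets lebesgue" for j by (rule cube_emeasure(3)[OF dil_in_cubes[OF h]])
  let ?S = "\<lambda>y. SUP j. ennreal (a j) * indicator (dil x h j) y"
  have a0: "0 < a j" "a j \<le> 1" for j
    using a layer_seq_decreasing[OF a, of 0 j] by (auto simp: layer_seq_def)
  show "layered a x h \<in> borel_measurable lebesgue" unfolding layered_def by measurable
  have le: "?S y \<le> ennreal b" if "\<And>j. y \<in> dil x h j \<Longrightarrow> a j \<le> b" for y b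
    using that by (intro SUP_least) (auto simp: indicator_def intro: ennreal_leI)
  have S1: "?S y \<le> ennreal 1" for y using a0 by (intro le) auto
  then have S: "ennreal (layered a x h y) = ?S y" for y
    unfolding layered_def by (simp add: le_less_trans[OF S1])
  have l0: "0 \<le> layered a x h y" for y by (simp add: layered_def)
  have upper: "layered a x h y \<le> b" if "\<And>j. y \<in> dil x h j \<Longrightarrow> a j \<le> b" "0 \<le> b" for y b
  proof -
    have "ennreal (layered a x h y) \<le> ennreal b" unfolding S by (rule le) (rule that(1))
    then show ?thesis using that(2) by simp
  qed
  show lower: "a J \<le> layered a x h y" if "y \<in> dil x h J" for y J
  proof -
    have "ennreal (a J) \<le> ?S y" using that by (intro SUP_upper2[of J]) auto
    then have "ennreal (a J) \<le> ennreal (layered a x h y)" unfolding S .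
    then show ?thesis using l0[of y] by simp
  qed
  show "layered a x h y \<le> a (Suc J)" if "y \<notin> dil x h J" for y J
  proof (rule upper)
    fix j assume "y \<in> dil x h j"
    then have "\<not> j \<le> J" using that dil_mono[of j J h x] h by blast
    then show "a j \<le> a (Suc J)" by (intro layer_seq_decreasing[OF a]) simp
  qed (use a0 less_imp_le in blast)
  show "layered a x h y \<le> 1" using a0 by (intro upper) auto
  obtain N where "{y} \<subseteq> dil x h N" using bounded_subset_dil[of "{y}" h x] h by auto
  then have "a N \<le> layered a x h y" by (intro lower) simp
  then show "0 < layered a x h y" using a0(1)[of N] by linarith
  show "ennreal (layered a x h y) \<le> (\<Sum>j\<le>J. ennreal (a j) * indicator (dil x h j) y)" if y: "y \<in> dil x h J"
    unfolding S
  proof (rule SUP_least)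
    fix j
    show "ennreal (a j) * indicator (dil x h j) y \<le> (\<Sum>j\<le>J. ennreal (a j) * indicator (dil x h j) y)"
    proof (cases "j \<le> J")
      case True
      then show ?thesis by (intro member_le_sum) auto
    next
      case False
      then have "ennreal (a j) * indicator (dil x h j) y \<le> ennreal (a J) * indicator (dil x h J) y"
        using y layer_seq_decreasing[OF a, of J j] by (auto simp: indicator_def intro: ennreal_leI)
      also have "\<dots> \<le> (\<Sum>j\<le>J. ennreal (a j) * indicator (dil x h j) y)" by (intro member_le_sum) auto
      finally show ?thesis .
    qed
  qed
  show "ennreal (layered a x h y) \<le> (\<Sum>j. ennreal (a j) * indicator (dil x h j) y)"
    unfolding S by (intro SUP_least ennreal_le_suminf)
qed

text \<open>The cube contains a point within s of x and a point more than 2 s away from x in some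
  coordinate, so its side 2 \<rho> is at least s.\<close>

lemma ccube_large:
  fixes y x :: "real ^ 'n"
  assumes "\<not> ccube y \<rho> \<subseteq> ccube x (2 * s)" "ccube y \<rho> \<inter> ccube x s \<noteq> {}"
  shows "s \<le> 2 * \<rho>"
proof -
  obtain z where z: "z \<in> ccube y \<rho>" "z \<notin> ccube x (2 * s)" using assms(1) by blast
  then obtain i where i: "\<not> \<bar>z $ i - x $ i\<bar> \<le> 2 * s" by (auto simp: mem_ccube)
  obtain u where u: "u \<in> ccube y \<rho>" "u \<in> ccube x s" using assms(2) by blast
  have "\<bar>z $ i - y $ i\<bar> \<le> \<rho>" "\<bar>u $ i - y $ i\<bar> \<le> \<rho>" "\<bar>u $ i - x $ i\<bar> \<le> s"
    using z(1) u by (auto simp: mem_ccube)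
  then show ?thesis using i by linarith
qed

text \<open>Let J be least such that R lies in the J-th dilate; then the layered function is at
  least \<mu> = a J on R. If R meets dilate J - 2, it has size comparable to dilate J, thickness
  gives w(R) \<ge> c w(dilate J), and the summation clause bounds the mass. Otherwise the function
  is at most a (J - 1) \<le> D * a J on all of R. The constant depends on neither x nor h.\<close>

lemma layered_A1:
  fixes w :: "real ^ 'n \<Rightarrow> real"
  assumes w: "pos_weight w" and th: "thick w" and D: "1 \<le> D" and C: "0 < C"
  obtains K where "0 < K" "\<And>x h a R. 0 < h \<Longrightarrow> layer_seq D C w x h a \<Longrightarrow> R \<in> cubes \<Longrightarrow>
    \<exists>\<mu>>0. (\<forall>y\<in>R. \<mu> \<le> layered a x h y) \<and> weight_of (\<lambda>y. w y * layered a x h y) R \<le> ennreal (K * \<mu>) * weight_of w R"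
proof -
  let ?n = "CARD('n)"
  have [measurable]: "w \<in> borel_measurable lebesgue" and w0: "\<And>x. 0 \<le> w x" using w by (auto simp: pos_weight_def)
  obtain c where c: "0 < c" "\<And>Q E. Q \<in> cubes \<Longrightarrow> E \<in> sets lebesgue \<Longrightarrow> E \<subseteq> Q \<Longrightarrow>
     1 / 8 ^ ?n * measure lebesgue Q \<le> measure lebesgue E \<Longrightarrow> c * mass w Q \<le> mass w E"
    using th by (rule thickE[where \<eta>="1 / 8 ^ ?n"]) auto
  define K where "K = C / c + D"
  have K: "0 < K" "C / c \<le> K" "D \<le> K" using C c(1) D by (auto simp: K_def add_pos_pos)
  show ?thesis
  proof (rule that[OF K(1)])
    fix x :: "real ^ 'n" and h a and R :: "(real ^ 'n) set" assume h: "0 < h" and a: "layer_seq D C w x h a" and R: "R \<in> cubes"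
    note v = layered_props[OF a h]
    note [measurable] = cube_emeasure(3)[OF R] cube_emeasure(3)[OF dil_in_cubes[OF h, of x]]
    let ?v = "layered a x h"
    have a0: "0 < a j" "a j \<le> D * a (Suc j)" for j using a by (auto simp: layer_seq_def)
    define J where "J = (LEAST j. R \<subseteq> dil x h j)"
    have "bounded R" using R by (auto simp: cubes_def)
    then have "\<exists>j. R \<subseteq> dil x h j" using bounded_subset_dil[of R h x] h by blast
    then have RJ: "R \<subseteq> dil x h J" unfolding J_def by (rule LeastI_ex)
    have notR: "\<not> R \<subseteq> dil x h j" if "j < J" for j using not_less_Least that unfolding J_def by blast
    have "weight_of (\<lambda>y. w y * ?v y) R \<le> ennreal (K * a J) * weight_of w R"
    proof (cases "2 \<le> J \<and> R \<inter> dil x h (J - 2) \<noteq> {}")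
      case True
      then obtain j where j: "J = Suc (Suc j)" by (metis add_2_eq_Suc le_Suc_ex)
      obtain y \<rho> where y: "0 < \<rho>" "R = ccube y \<rho>" using R by (rule cubes_ccube)
      have "2 ^ j * h \<le> 2 * \<rho>"
      proof (rule ccube_large)
        show "\<not> ccube y \<rho> \<subseteq> ccube x (2 * (2 ^ j * h))" using notR[of "Suc j"] j y by (simp add: dil_def mult.assoc)
        show "ccube y \<rho> \<inter> ccube x (2 ^ j * h) \<noteq> {}" using True j y by (simp add: dil_def)
      qed
      \<comment> \<open>The 8 consists of 4 for the two doublings from J - 2 to J and 2 from
        \<open>ccube_large\<close>.\<close>
      then have "2 * (2 ^ J * h) / 8 \<le> 2 * \<rho>" using j by simp
      then have "(2 * (2 ^ J * h) / 8) ^ ?n \<le> (2 * \<rho>) ^ ?n" using h by (intro power_mono) auto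
      moreover have "measure lebesgue R = (2 * \<rho>) ^ ?n" "measure lebesgue (dil x h J) = (2 * (2 ^ J * h)) ^ ?n"
        using emeasure_ccube[of \<rho> y] emeasure_ccube[of "2 ^ J * h" x] y h by (auto simp: measure_def dil_def)
      ultimately have "1 / 8 ^ ?n * measure lebesgue (dil x h J) \<le> measure lebesgue R"
        by (simp only: power_divide times_divide_eq_left mult_1)
      then have cw: "c * mass w (dil x h J) \<le> mass w R" by (intro c(2) dil_in_cubes h RJ) auto
      have "weight_of (\<lambda>y. w y * ?v y) R \<le> (\<integral>\<^sup>+y. (\<Sum>j\<le>J. ennreal (a j) * (ennreal (w y) * indicator (dil x h j) y)) \<partial>lebesgue)"
        unfolding weight_of_def
      proof (rule nn_integral_mono)
        fix y
        show "ennreal (w y * ?v y) * indicator R y \<le> (\<Sum>j\<le>J. ennreal (a j) * (ennreal (w y) * indicator (dil x h j) y))"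
        proof (cases "y \<in> R")
          case True
          then have "ennreal (w y) * ennreal (?v y) \<le> ennreal (w y) * (\<Sum>j\<le>J. ennreal (a j) * indicator (dil x h j) y)"
            using RJ by (intro mult_left_mono v(6)) auto
          also have "\<dots> = (\<Sum>j\<le>J. ennreal (a j) * (ennreal (w y) * indicator (dil x h j) y))"
            unfolding sum_distrib_left by (intro sum.cong refl mult.left_commute)
          finally show ?thesis using True w0[of y] v(5)[of y] by (simp add: ennreal_mult less_imp_le)
        qed simp
      qed
      also have "\<dots> = (\<Sum>j\<le>J. ennreal (a j) * weight_of w (dil x h j))"
        unfolding weight_of_def by (subst nn_integral_sum) (auto simp: nn_integral_cmult)
      also have "\<dots> = (\<Sum>j\<le>J. ennreal (a j * mass w (dil x h j)))"
        using a0 weight_of_mass[OF w dil_in_cubes[OF h]] by (intro sum.cong refl) (simp add: ennreal_mult less_imp_le)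
      also have "\<dots> = ennreal (\<Sum>j\<le>J. a j * mass w (dil x h j))"
        using a0 weight_of_mass(2)[OF w dil_in_cubes[OF h]] by (intro sum_ennreal) (simp add: less_imp_le)
      also have "\<dots> \<le> ennreal (C * (a J * mass w (dil x h J)))"
        using a by (intro ennreal_leI) (simp add: layer_seq_def)
      also have "\<dots> \<le> ennreal (K * a J * mass w R)"
      proof (rule ennreal_leI)
        have "C * (a J * mass w (dil x h J)) = C / c * a J * (c * mass w (dil x h J))" using c(1) by simp
        also have "\<dots> \<le> C / c * a J * mass w R"
          using cw C c(1) a0[of J] by (intro mult_left_mono) auto
        also have "\<dots> \<le> K * a J * mass w R"
          using K a0[of J] weight_of_mass(2)[OF w R] by (intro mult_right_mono) auto
        finally show "C * (a J * mass w (dil x h J)) \<le> K * a J * mass w R" .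
      qed
      also have "\<dots> = ennreal (K * a J) * weight_of w R"
        using K a0[of J] weight_of_mass[OF w R] by (simp add: ennreal_mult)
      finally show ?thesis .
    next
      case False
      have vle: "?v y \<le> D * a J" if y: "y \<in> R" for y
      proof (cases "2 \<le> J")
        case True
        then obtain j where j: "J = Suc (Suc j)" by (metis add_2_eq_Suc le_Suc_ex)
        then have "y \<notin> dil x h j" using False y by auto
        then have "?v y \<le> a (Suc j)" by (rule v(3))
        then show ?thesis using a0(2)[of "Suc j"] j by simp
      next
        case F: False
        \<comment> \<open>For J at most 1 there is no dilate J - 2 to stay away from; here a 0 = 1
          and at most one step of the sequence suffice.\<close>
        have "1 \<le> D * a J"
        proof (cases J)
          case 0
          then show ?thesis using a D by (simp add: layer_seq_def)
        next
          case (Suc k)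
          then have "J = Suc 0" using F by simp
          then show ?thesis using a0(2)[of 0] a by (simp add: layer_seq_def)
        qed
        then show ?thesis using v(4)[of y] by linarith
      qed
      have "weight_of (\<lambda>y. w y * ?v y) R \<le> (\<integral>\<^sup>+y. ennreal (D * a J) * (ennreal (w y) * indicator R y) \<partial>lebesgue)"
        unfolding weight_of_def
      proof (rule nn_integral_mono)
        fix y
        have "y \<in> R \<Longrightarrow> w y * ?v y \<le> D * a J * w y" using mult_right_mono[OF vle[of y] w0[of y]] by (simp add: mult.commute)
        then show "ennreal (w y * ?v y) * indicator R y \<le> ennreal (D * a J) * (ennreal (w y) * indicator R y)"
          using D a0(1)[of J] w0[of y] by (auto simp: indicator_def ennreal_leI simp flip: ennreal_mult)
      qed
      also have "\<dots> = ennreal (D * a J) * weight_of w R" unfolding weight_of_def by (rule nn_integral_cmult) measurable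
      also have "\<dots> \<le> ennreal (K * a J) * weight_of w R"
        using K(3) a0(1)[of J] by (intro mult_right_mono ennreal_leI) auto
      finally show ?thesis .
    qed
    then show "\<exists>\<mu>>0. (\<forall>y\<in>R. \<mu> \<le> ?v y) \<and> weight_of (\<lambda>y. w y * ?v y) R \<le> ennreal (K * \<mu>) * weight_of w R"
      using RJ v(2) a0(1)[of J] by (intro exI[of _ "a J"]) blast
  qed
qed

text \<open>The A_1 condition of v relative to w dx is exactly the cubewise comparison; the bounds 0
  < v \<le> 1 preserve positivity and integrability on cubes.\<close>

lemma muckenhoupt_product:
  fixes w v :: "real ^ 'n \<Rightarrow> real"
  assumes p: "1 \<le> p" and w: "w \<in> muckenhoupt p" and K: "0 < K"
    and v [measurable]: "v \<in> borel_measurable lebesgue" and v01: "\<And>x. 0 < v x" "\<And>x. v x \<le> 1"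
    and A1: "\<And>R. R \<in> cubes \<Longrightarrow> \<exists>\<mu>>0. (\<forall>y\<in>R. \<mu> \<le> v y) \<and> weight_of (\<lambda>y. w y * v y) R \<le> ennreal (K * \<mu>) * weight_of w R"
  shows "(\<lambda>y. w y * v y) \<in> muckenhoupt p"
    and "muckenhoupt_const p (\<lambda>y. w y * v y) \<le> ennreal K * muckenhoupt_const p w"
proof -
  have pw: "pos_weight w" and fin: "muckenhoupt_const p w < top" using w by (auto simp: muckenhoupt_iff)
  then have [measurable]: "w \<in> borel_measurable lebesgue" and w0: "\<And>x. 0 \<le> w x" and wpos: "AE x in lebesgue. 0 < w x"
    by (auto simp: pos_weight_def)
  let ?u = "\<lambda>y. w y * v y"
  show const: "muckenhoupt_const p ?u \<le> ennreal K * muckenhoupt_const p w"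
  proof (rule muckenhoupt_const_le_cubewise[OF p K _ w0])
    fix R :: "(real ^ 'n) set" assume "R \<in> cubes"
    then obtain \<mu> where "0 < \<mu>" "\<forall>y\<in>R. \<mu> \<le> v y" "weight_of ?u R \<le> ennreal (K * \<mu>) * weight_of w R"
      using A1 by blast
    then show "\<exists>\<mu>>0. (\<forall>y\<in>R. \<mu> * w y \<le> ?u y \<and> (w y = 0 \<longrightarrow> ?u y = 0)) \<and> weight_of ?u R \<le> ennreal (K * \<mu>) * weight_of w R"
      using w0 by (intro exI[of _ \<mu>]) (auto simp: mult.commute[of _ "w _"] intro: mult_left_mono)
  qed measurable
  have "weight_of ?u Q < top" if Q: "Q \<in> cubes" for Q
  proof -
    have "weight_of ?u Q \<le> ennreal 1 * weight_of w Q"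
      using w0 v01(2) by (intro weight_of_cmult_le cube_emeasure(3)[OF Q]) (auto simp: mult_le_cancel_left1 mult_left_le)
    also have "\<dots> < top" using weight_of_mass(1)[OF pw Q] by simp
    finally show ?thesis .
  qed
  moreover have "AE x in lebesgue. 0 < ?u x" using wpos by eventually_elim (simp add: v01)
  moreover have "0 \<le> ?u x" for x using w0[of x] v01(1)[of x] by simp
  moreover have "muckenhoupt_const p ?u < top"
    using const fin by (auto simp: ennreal_mult_less_top intro: le_less_trans)
  ultimately show "?u \<in> muckenhoupt p" by (simp add: muckenhoupt_iff pos_weight_def)
qed

section \<open>Morrey spaces\<close>

lemma geometric_sum_le_last:
  fixes b :: "nat \<Rightarrow> real"
  assumes "\<And>j. 0 \<le> b j" "\<And>j. b j \<le> g * b (Suc j)" "0 \<le> g" "g < 1"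
  shows "(\<Sum>j\<le>J. b j) \<le> b J / (1 - g)"
proof (induction J)
  case 0
  have "b 0 * (1 - g) \<le> b 0" using assms(1)[of 0] assms(3) by (simp add: mult_left_le)
  then show ?case using assms by (simp add: field_simps)
next
  case (Suc J)
  have "(\<Sum>j\<le>Suc J. b j) \<le> b J / (1 - g) + b (Suc J)" using Suc by simp
  also have "\<dots> \<le> g * b (Suc J) / (1 - g) + b (Suc J)"
    using assms(2)[of J] assms(4) by (intro add_right_mono divide_right_mono) auto
  also have "\<dots> = b (Suc J) / (1 - g)" using assms(4) by (simp add: field_simps)
  finally show ?case .
qed

definition layer_coeff :: "real \<Rightarrow> real \<Rightarrow> (real ^ 'n \<Rightarrow> real) \<Rightarrow> real ^ 'n \<Rightarrow> real \<Rightarrow> nat \<Rightarrow> real" where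
  "layer_coeff \<sigma> \<theta> w x h j =
     (measure lebesgue (dil x h 0) / measure lebesgue (dil x h j)) powr (1 - 1 / \<sigma>) *
     (mass (\<lambda>x. w x powr \<sigma>) (dil x h 0) / mass (\<lambda>x. w x powr \<sigma>) (dil x h j)) powr \<theta>"

lemma measure_dil:
  fixes x :: "real ^ 'n"
  assumes "0 < h"
  shows "measure lebesgue (dil x h j) = (2 * (2 ^ j * h)) ^ CARD('n)"
  using emeasure_ccube[of "2 ^ j * h" x] assms by (simp add: dil_def measure_def)

lemma measure_dil_Suc:
  fixes x :: "real ^ 'n"
  assumes "0 < h"
  shows "measure lebesgue (dil x h (Suc j)) = 2 ^ CARD('n) * measure lebesgue (dil x h j)"
proof -
  have "(2 * (2 ^ Suc j * h)) ^ CARD('n) = (2 * (2 * (2 ^ j * h))) ^ CARD('n)" by simp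
  also have "\<dots> = 2 ^ CARD('n) * (2 * (2 ^ j * h)) ^ CARD('n)" by (rule power_mult_distrib)
  finally show ?thesis by (simp only: measure_dil[OF assms])
qed

lemma layer_coeff_Suc:
  assumes "pos_weight (\<lambda>x. w x powr \<sigma>)" "0 < h"
  shows "layer_coeff \<sigma> \<theta> w x h (Suc j) = layer_coeff \<sigma> \<theta> w x h j *
     ((measure lebesgue (dil x h j) / measure lebesgue (dil x h (Suc j))) powr (1 - 1 / \<sigma>) *
      (mass (\<lambda>x. w x powr \<sigma>) (dil x h j) / mass (\<lambda>x. w x powr \<sigma>) (dil x h (Suc j))) powr \<theta>)"
proof -
  have "0 < mass (\<lambda>x. w x powr \<sigma>) (dil x h i)" "0 < measure lebesgue (dil x h i)" for i
    using weight_of_mass(2)[OF assms(1) dil_in_cubes[OF assms(2)]] measure_cube(2)[OF dil_in_cubes[OF assms(2)]] by auto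
  note this[of 0] this[of j] this[of "Suc j"]
  then show ?thesis unfolding layer_coeff_def by (simp add: powr_divide less_imp_le)
qed

text \<open>Write m and U for volume and W-mass of the j-th dilate, with W = w^\<sigma>. Hoelder and
  reverse Hoelder make w(dilate) comparable to m^(1-1/\<sigma>) U^(1/\<sigma>). The volume factor of
  the coefficient cancels the first power, so coefficient times mass behaves like
  U^(1/\<sigma>-\<theta>), which grows geometrically by reverse doubling; its sums are controlled by
  their last term.\<close>

lemma layer_coeff_layer_seq:
  fixes w :: "real ^ 'n \<Rightarrow> real"
  assumes p: "1 \<le> p" and w: "w \<in> muckenhoupt p" and \<sigma>: "1 \<le> \<sigma>" and rh: "reverse_holder_const \<sigma> w c" and c: "0 < c"
    and \<theta>: "0 < \<theta>" "\<theta> < 1 / \<sigma>"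
  obtains D C \<gamma> where "1 \<le> D" "0 < C" "0 < \<gamma>" "\<gamma> < 1"
    "\<And>x h. 0 < h \<Longrightarrow> layer_seq D C w x h (layer_coeff \<sigma> \<theta> w x h)"
    "\<And>x h j. 0 < h \<Longrightarrow> mass (\<lambda>x. w x powr \<sigma>) (dil x h j) \<le> \<gamma> * mass (\<lambda>x. w x powr \<sigma>) (dil x h (Suc j))"
proof -
  let ?n = "CARD('n)"
  let ?W = "\<lambda>x. w x powr \<sigma>"
  define \<alpha> where "\<alpha> = 1 - 1 / \<sigma>"
  have \<alpha>: "0 \<le> \<alpha>" using \<sigma> by (simp add: \<alpha>_def)
  have pw: "pos_weight w" using w by (simp add: muckenhoupt_iff)
  have th: "thick w" by (rule thick_muckenhoupt[OF p w])
  note pW = reverse_holder_pos_weight(1)[OF pw \<sigma> rh c]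
  have thW: "thick ?W" by (rule thick_reverse_holder[OF pw th \<sigma> rh c])
  obtain \<gamma> D0 where \<gamma>: "0 < \<gamma>" "\<gamma> < 1" "1 \<le> D0"
    "\<And>x h. 0 < h \<Longrightarrow> mass ?W (ccube x h) \<le> \<gamma> * mass ?W (ccube x (2 * h))"
    "\<And>x h. 0 < h \<Longrightarrow> mass ?W (ccube x (2 * h)) \<le> D0 * mass ?W (ccube x h)"
    using pW thW by (rule thick_doubling) blast
  define g where "g = \<gamma> powr (1 / \<sigma> - \<theta>)"
  have g: "0 < g" "g < 1" using \<gamma>(1,2) \<theta> powr_less_mono2[of "1 / \<sigma> - \<theta>" \<gamma> 1] by (auto simp: g_def)
  \<comment> \<open>One step of the sequence multiplies it by the volume ratio 2^(-n) to the power 1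
    - 1/\<sigma> and by at least D0^(-\<theta>).\<close>
  define D where "D = (2 ^ ?n) powr \<alpha> * D0 powr \<theta>"
  \<comment> \<open>2 comes from Hoelder for all summands, c from reverse Hoelder for the last one,
    and 1 / (1 - g) from the geometric sum.\<close>
  define C where "C = 2 * c / (1 - g)"
  have D: "1 \<le> D"
  proof -
    have "1 * 1 \<le> (2 ^ ?n) powr \<alpha> * D0 powr \<theta>"
      using \<alpha> \<theta> \<gamma> by (intro mult_mono ge_one_powr_ge_zero) auto
    then show ?thesis by (simp add: D_def)
  qed
  have C: "0 < C" using c g by (simp add: C_def)
  have grow: "mass ?W (dil x h j) \<le> \<gamma> * mass ?W (dil x h (Suc j))"
    and doub: "mass ?W (dil x h (Suc j)) \<le> D0 * mass ?W (dil x h j)" if "0 < h" for x h j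
    using \<gamma>(4,5)[of "2 ^ j * h" x] that by (auto simp: dil_def mult.assoc)
  have "layer_seq D C w x h (layer_coeff \<sigma> \<theta> w x h)" if h: "0 < h" for x h
  proof -
    let ?a = "layer_coeff \<sigma> \<theta> w x h"
    define U where "U j = mass ?W (dil x h j)" for j
    define m where "m j = measure lebesgue (dil x h j)" for j
    have U: "0 < U j" for j unfolding U_def by (rule weight_of_mass(2)[OF pW dil_in_cubes[OF h]])
    have m: "0 < m j" "m (Suc j) = 2 ^ ?n * m j" for j
      unfolding m_def by (rule measure_cube(2)[OF dil_in_cubes[OF h]]) (rule measure_dil_Suc[OF h])
    have a: "?a j = (m 0 / m j) powr \<alpha> * (U 0 / U j) powr \<theta>" for j
      unfolding layer_coeff_def U_def m_def \<alpha>_def ..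
    have apos: "0 < ?a j" for j using U[of j] U[of 0] m(1)[of j] m(1)[of 0] by (simp add: a)
    define f where "f j = (m j / m (Suc j)) powr \<alpha> * (U j / U (Suc j)) powr \<theta>" for j
    have aS: "?a (Suc j) = ?a j * f j" for j
      using layer_coeff_Suc[OF pW h, of \<theta> x j] unfolding f_def U_def m_def \<alpha>_def .
    have mr: "m j / m (Suc j) = 1 / 2 ^ ?n" for j using m(1)[of j] by (simp add: m(2))
    have f1: "f j \<le> 1" for j
    proof -
      have "(m j / m (Suc j)) powr \<alpha> \<le> 1" using \<alpha> by (simp add: mr powr_le1)
      moreover have "U j \<le> U (Suc j)"
      proof -
        have "\<gamma> * U (Suc j) \<le> 1 * U (Suc j)" using \<gamma> U[of "Suc j"] by (intro mult_right_mono) auto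
        then show ?thesis using grow[OF h, of x j] by (simp add: U_def)
      qed
      then have "(U j / U (Suc j)) powr \<theta> \<le> 1" using U \<theta> by (intro powr_le1) (auto simp: less_imp_le)
      ultimately have "f j \<le> 1 * 1" unfolding f_def by (intro mult_mono) auto
      then show ?thesis by simp
    qed
    have fD: "1 \<le> D * f j" for j
    proof -
      have "1 / D0 \<le> U j / U (Suc j)" using doub[OF h, of x j] \<gamma>(3) U by (simp add: U_def field_simps)
      then have "(1 / D0) powr \<theta> \<le> (U j / U (Suc j)) powr \<theta>" using \<gamma>(3) \<theta> by (intro powr_mono2) auto
      then have "(1 / 2 ^ ?n) powr \<alpha> * (1 / D0) powr \<theta> \<le> f j" unfolding f_def mr by (intro mult_left_mono) auto
      moreover have "D * ((1 / 2 ^ ?n) powr \<alpha> * (1 / D0) powr \<theta>) = 1"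
        using \<gamma>(3) by (simp add: D_def powr_divide)
      moreover have "D * ((1 / 2 ^ ?n) powr \<alpha> * (1 / D0) powr \<theta>) \<le> D * f j"
        using calculation(1) D by (intro mult_left_mono) auto
      ultimately show ?thesis by simp
    qed
    define b where "b j = ?a j * (m j powr \<alpha> * U j powr (1 / \<sigma>))" for j
    have b: "b j = m 0 powr \<alpha> * U 0 powr \<theta> * U j powr (1 / \<sigma> - \<theta>)" for j
      using U[of 0] U[of j] m(1)[of 0] m(1)[of j] by (simp add: b_def a powr_divide powr_diff)
    have bg: "b j \<le> g * b (Suc j)" for j
    proof -
      have "U j powr (1 / \<sigma> - \<theta>) \<le> (\<gamma> * U (Suc j)) powr (1 / \<sigma> - \<theta>)"
        using grow[OF h, of x j] U[of j] \<theta> by (intro powr_mono2) (auto simp: U_def)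
      also have "\<dots> = g * U (Suc j) powr (1 / \<sigma> - \<theta>)" using \<gamma> U[of "Suc j"] by (simp add: g_def powr_mult)
      finally have "m 0 powr \<alpha> * U 0 powr \<theta> * U j powr (1 / \<sigma> - \<theta>)
        \<le> m 0 powr \<alpha> * U 0 powr \<theta> * (g * U (Suc j) powr (1 / \<sigma> - \<theta>))" by (intro mult_left_mono) auto
      then show ?thesis unfolding b by (simp add: mult_ac)
    qed
    have "(\<Sum>j\<le>J. ?a j * mass w (dil x h j)) \<le> C * (?a J * mass w (dil x h J))" for J
    proof -
      have "(\<Sum>j\<le>J. ?a j * mass w (dil x h j)) \<le> (\<Sum>j\<le>J. 2 * b j)"
      proof (rule sum_mono)
        fix j
        note Q = dil_in_cubes[OF h, of x j]
        have "mass w (dil x h j) \<le> 2 * (m j powr \<alpha> * U j powr (1 / \<sigma>))"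
          using mass_le_power_mass[OF pw pW \<sigma> Q order_refl cube_emeasure(3)[OF Q]] m(1)[of j]
          unfolding m_def U_def \<alpha>_def by blast
        then have "?a j * mass w (dil x h j) \<le> ?a j * (2 * (m j powr \<alpha> * U j powr (1 / \<sigma>)))"
          using apos[of j] by (intro mult_left_mono) auto
        then show "?a j * mass w (dil x h j) \<le> 2 * b j" by (simp add: b_def)
      qed
      also have "\<dots> = 2 * (\<Sum>j\<le>J. b j)" by (simp add: sum_distrib_left)
      also have "\<dots> \<le> 2 * (b J / (1 - g))"
        using g bg apos by (intro mult_left_mono geometric_sum_le_last) (auto simp: b_def less_imp_le)
      also have "\<dots> \<le> 2 * (?a J * (c * mass w (dil x h J)) / (1 - g))"
      proof -
        have "m J powr \<alpha> * U J powr (1 / \<sigma>) \<le> c * mass w (dil x h J)"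
          using reverse_holder_pos_weight(2)[OF pw \<sigma> rh c dil_in_cubes[OF h, of x J]]
          unfolding m_def U_def \<alpha>_def by (simp add: mult.commute)
        then have "b J \<le> ?a J * (c * mass w (dil x h J))" unfolding b_def using apos[of J] by (intro mult_left_mono) auto
        then show ?thesis using g by (intro mult_left_mono divide_right_mono) auto
      qed
      also have "\<dots> = C * (?a J * mass w (dil x h J))" by (simp add: C_def)
      finally show ?thesis .
    qed
    moreover have "?a 0 = 1" using U[of 0] m(1)[of 0] by (simp add: a)
    moreover have "?a (Suc j) \<le> ?a j" for j using f1[of j] apos[of j] by (simp add: aS mult_left_le)
    moreover have "?a j \<le> D * ?a (Suc j)" for j
    proof -
      have "?a j * 1 \<le> ?a j * (D * f j)" using fD[of j] apos[of j] by (intro mult_left_mono) auto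
      then show ?thesis by (simp add: aS mult_ac)
    qed
    ultimately show ?thesis using apos unfolding layer_seq_def by blast
  qed
  then show ?thesis using that D C \<gamma>(1,2) grow by blast
qed

section \<open>Transfer from weighted norms to Morrey norms\<close>

definition morrey_sup :: "((real ^ 'n) set \<Rightarrow> ennreal) \<Rightarrow> real \<Rightarrow> real \<Rightarrow> (real ^ 'n \<Rightarrow> real) \<Rightarrow> (real ^ 'n \<Rightarrow> real) \<Rightarrow> ennreal" where
  "morrey_sup \<nu> \<kappa> p w f = (SUP Q\<in>cubes. ennreal_power (\<nu> Q) (- \<kappa>) * Lp_norm p w Q f)"

lemma morrey_norm_eq: "morrey_norm r p w = morrey_sup (weight_of w) (1 / p + r / real CARD('n)) p w"
  for w :: "real ^ 'n \<Rightarrow> real"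
  by (rule ext) (simp only: morrey_norm_def morrey_sup_def)

lemma morrey_norm_leb_eq: "morrey_norm_leb r p w = morrey_sup (emeasure lebesgue) (1 / p + r / real CARD('n)) p w"
  for w :: "real ^ 'n \<Rightarrow> real"
  by (rule ext) (simp only: morrey_norm_leb_def morrey_sup_def)

definition dominated :: "bool \<Rightarrow> ('a \<Rightarrow> ennreal) \<Rightarrow> ('a \<times> 'a) set \<Rightarrow> bool" where
  "dominated fin M F \<longleftrightarrow> (\<exists>c>0. \<forall>(f, g)\<in>F. (fin \<longrightarrow> M g < \<infinity>) \<longrightarrow> M g \<le> ennreal c * M f)"

text \<open>Around Q = ccube x h the weight w is multiplied by the layered function, which equals 1
  on Q; so the weighted integral of g controls the one over Q. Splitting the integral of f into
  dilates, each bounded by the Morrey norm, leaves the series of a j * N^(p \<kappa>), and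
  \<open>dec\<close> makes it geometric with first term N(Q)^(p \<kappa>), precisely the
  normalisation wanted. The characteristics of all these weights are below the single bound
  \<open>K2\<close>.\<close>

theorem morrey_transfer:
  fixes F :: "((real ^ 'n \<Rightarrow> real) \<times> (real ^ 'n \<Rightarrow> real)) set" and a :: "real ^ 'n \<Rightarrow> real \<Rightarrow> nat \<Rightarrow> real"
  assumes F: "extrapolation_pairs F" and p: "1 \<le> p" and bd: "weighted_bound fin p F" and w: "w \<in> muckenhoupt p"
    and D: "1 \<le> D" and C: "0 < C" and \<gamma>: "0 < \<gamma>" "\<gamma> < 1"
    and seq: "\<And>x h. 0 < h \<Longrightarrow> layer_seq D C w x h (a x h)"
    and N: "\<And>Q. Q \<in> cubes \<Longrightarrow> \<nu> Q = ennreal (N Q)" "\<And>Q. Q \<in> cubes \<Longrightarrow> 0 < N Q"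
    and dec: "\<And>x h j. 0 < h \<Longrightarrow> a x h (Suc j) * N (dil x h (Suc j)) powr (p * \<kappa>) \<le> \<gamma> * (a x h j * N (dil x h j) powr (p * \<kappa>))"
  shows "dominated fin (morrey_sup \<nu> \<kappa> p w) F"
proof -
  have pw: "pos_weight w" and wfin: "muckenhoupt_const p w < top" using w by (auto simp: muckenhoupt_iff)
  have [measurable]: "w \<in> borel_measurable lebesgue" and w0: "\<And>x. 0 \<le> w x" using pw by (auto simp: pos_weight_def)
  have th: "thick w" by (rule thick_muckenhoupt[OF p w])
  obtain K where K: "0 < K" "\<And>x h a R. 0 < h \<Longrightarrow> layer_seq D C w x h a \<Longrightarrow> R \<in> cubes \<Longrightarrow>
    \<exists>\<mu>>0. (\<forall>y\<in>R. \<mu> \<le> layered a x h y) \<and> weight_of (\<lambda>y. w y * layered a x h y) R \<le> ennreal (K * \<mu>) * weight_of w R"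
    using layered_A1[OF pw th D C] by blast
  define u where "u x h y = w y * layered (a x h) x h y" for x h y
  define K2 where "K2 = K * enn2real (muckenhoupt_const p w)"
  have u: "u x h \<in> muckenhoupt p" "muckenhoupt_const p (u x h) \<le> ennreal K2" if h: "0 < h" for x h
  proof -
    note v = layered_props[OF seq[OF h, of x] h]
    note m = muckenhoupt_product[OF p w K(1) v(1) v(5) v(4) K(2)[OF h seq[OF h]]]
    show "u x h \<in> muckenhoupt p" unfolding u_def[abs_def] by (rule m(1))
    have "muckenhoupt_const p (u x h) \<le> ennreal K * muckenhoupt_const p w" unfolding u_def[abs_def] by (rule m(2))
    also have "\<dots> = ennreal K2" using wfin K(1) by (simp add: K2_def ennreal_mult less_imp_le)
    finally show "muckenhoupt_const p (u x h) \<le> ennreal K2" .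
  qed
  obtain C3 where C3: "0 < C3" "weighted_estimate C3 K2 fin p F"
    using bd unfolding weighted_bound_def by blast
  \<comment> \<open>Formulated for an arbitrary function because it is applied to g as well: there
    it turns a finite Morrey norm into the finiteness required by the restricted estimate.\<close>
  have est: "weighted_integral p (u x h) UNIV f \<le> ennreal (A powr p / (1 - \<gamma>) * N (ccube x h) powr (p * \<kappa>))"
    if h: "0 < h" and [measurable]: "f \<in> borel_measurable lebesgue" and A: "morrey_sup \<nu> \<kappa> p w f \<le> ennreal A" "0 \<le> A"
    for x h A and f :: "real ^ 'n \<Rightarrow> real"
  proof -
    note v = layered_props[OF seq[OF h, of x] h]
    have [measurable]: "dil x h j \<in> sets lebesgue" for j by (rule cube_emeasure(3)[OF dil_in_cubes[OF h]])
    have a0: "a x h 0 = 1" "0 < a x h j" for j using seq[OF h, of x] by (auto simp: layer_seq_def)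
    have IQ: "weighted_integral p w Q f \<le> ennreal (A powr p * N Q powr (p * \<kappa>))" if Q: "Q \<in> cubes" for Q
    proof -
      have "ennreal_power (\<nu> Q) (- \<kappa>) * Lp_norm p w Q f \<le> ennreal A"
        using A(1) Q unfolding morrey_sup_def by (simp add: SUP_le_iff)
      moreover have "ennreal_power (\<nu> Q) (- \<kappa>) = ennreal (1 / N Q powr \<kappa>)"
        using N[OF Q] by (simp add: ennreal_power_ennreal_pos powr_minus_divide)
      ultimately have "Lp_norm p w Q f * ennreal (1 / N Q powr \<kappa>) \<le> ennreal A" by (simp add: mult.commute)
      then have "Lp_norm p w Q f \<le> ennreal A * ennreal (N Q powr \<kappa>)"
        using N(2)[OF Q] by (subst (asm) ennreal_mult_inverse_le_iff) auto
      then have "Lp_norm p w Q f \<le> ennreal (A * N Q powr \<kappa>)" using A(2) by (simp add: ennreal_mult)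
      then have "weighted_integral p w Q f \<le> ennreal_power (ennreal (A * N Q powr \<kappa>)) (1 / (1 / p))"
        unfolding Lp_norm_weighted_integral using p by (subst (asm) ennreal_power_le_iff) auto
      then show ?thesis using p A(2) N(2)[OF Q] by (simp add: ennreal_power_ennreal powr_mult powr_powr mult.commute)
    qed
    define e where "e j = a x h j * N (dil x h j) powr (p * \<kappa>)" for j
    have e0: "0 \<le> e j" for j using a0(2)[of j] by (simp add: e_def)
    have ej: "e j \<le> \<gamma> ^ j * e 0" for j
    proof (induction j)
      case (Suc j)
      have "e (Suc j) \<le> \<gamma> * e j" unfolding e_def by (rule dec[OF h])
      also have "\<dots> \<le> \<gamma> * (\<gamma> ^ j * e 0)" using Suc \<gamma> by (intro mult_left_mono) auto
      finally show ?case by simp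
    qed simp
    have "weighted_integral p (u x h) UNIV f
      \<le> (\<integral>\<^sup>+y. (\<Sum>j. ennreal (a x h j) * (ennreal (norm (f y) powr p * w y) * indicator (dil x h j) y)) \<partial>lebesgue)"
      unfolding weighted_integral_def
    proof (rule nn_integral_mono)
      fix y
      have "ennreal (norm (f y) powr p * u x h y) = ennreal (norm (f y) powr p * w y) * ennreal (layered (a x h) x h y)"
        using w0[of y] v(5)[of y] by (simp add: u_def mult.assoc[symmetric] ennreal_mult less_imp_le)
      also have "\<dots> \<le> ennreal (norm (f y) powr p * w y) * (\<Sum>j. ennreal (a x h j) * indicator (dil x h j) y)"
        by (intro mult_left_mono v(7)) simp
      also have "\<dots> = (\<Sum>j. ennreal (a x h j) * (ennreal (norm (f y) powr p * w y) * indicator (dil x h j) y))"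
        unfolding ennreal_suminf_cmult[symmetric] by (intro suminf_cong mult.left_commute)
      finally show "ennreal (norm (f y) powr p * u x h y) * indicator UNIV y \<le> \<dots>" by simp
    qed
    also have "\<dots> = (\<Sum>j. ennreal (a x h j) * weighted_integral p w (dil x h j) f)"
      unfolding weighted_integral_def by (subst nn_integral_suminf) (auto simp: nn_integral_cmult)
    also have "\<dots> \<le> (\<Sum>j. ennreal (A powr p * e 0 * \<gamma> ^ j))"
    proof (intro suminf_le allI)
      fix j
      have "ennreal (a x h j) * weighted_integral p w (dil x h j) f
        \<le> ennreal (a x h j) * ennreal (A powr p * N (dil x h j) powr (p * \<kappa>))"
        by (intro mult_left_mono IQ dil_in_cubes h) simp
      also have "\<dots> = ennreal (A powr p * e j)" using a0(2)[of j] by (simp add: e_def mult_ac flip: ennreal_mult)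
      also have "\<dots> \<le> ennreal (A powr p * e 0 * \<gamma> ^ j)"
        using mult_left_mono[OF ej[of j], of "A powr p"] by (intro ennreal_leI) (simp add: mult_ac)
      finally show "ennreal (a x h j) * weighted_integral p w (dil x h j) f \<le> ennreal (A powr p * e 0 * \<gamma> ^ j)" .
    qed auto
    also have "\<dots> = ennreal (A powr p * e 0 * (1 / (1 - \<gamma>)))"
    proof (rule suminf_ennreal_eq)
      show "0 \<le> A powr p * e 0 * \<gamma> ^ j" for j using e0[of 0] \<gamma> by simp
      show "(\<lambda>j. A powr p * e 0 * \<gamma> ^ j) sums (A powr p * e 0 * (1 / (1 - \<gamma>)))"
        using \<gamma> by (intro sums_mult geometric_sums) auto
    qed
    also have "A powr p * e 0 * (1 / (1 - \<gamma>)) = A powr p / (1 - \<gamma>) * N (ccube x h) powr (p * \<kappa>)"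
      by (simp add: e_def a0(1) dil_0)
    finally show ?thesis .
  qed
  define c where "c = (C3 / (1 - \<gamma>)) powr (1 / p)"
  have c: "0 < c" using C3(1) \<gamma> by (simp add: c_def)
  show ?thesis unfolding dominated_def infinity_ennreal_def
  proof (intro exI[of _ c] conjI c ballI, clarify)
    fix f g assume fg: "(f, g) \<in> F" and gfin: "fin \<longrightarrow> morrey_sup \<nu> \<kappa> p w g < top"
    have [measurable]: "f \<in> borel_measurable lebesgue" "g \<in> borel_measurable lebesgue"
      using F fg by (auto simp: extrapolation_pairs_def)
    show "morrey_sup \<nu> \<kappa> p w g \<le> ennreal c * morrey_sup \<nu> \<kappa> p w f"
    proof (cases "morrey_sup \<nu> \<kappa> p w f")
      case top
      then show ?thesis using c by (simp add: ennreal_mult_top)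
    next
      case (real A)
      show ?thesis unfolding morrey_sup_def[of \<nu> \<kappa> p w g]
      proof (rule SUP_least)
        fix Q :: "(real ^ 'n) set" assume Q: "Q \<in> cubes"
        then obtain x h where xh: "0 < h" "Q = ccube x h" by (rule cubes_ccube)
        note v = layered_props[OF seq[OF xh(1), of x] xh(1)]
        have "fin \<Longrightarrow> weighted_integral p (u x h) UNIV g < top"
        proof -
          assume fin
          then obtain B where "0 \<le> B" "morrey_sup \<nu> \<kappa> p w g = ennreal B"
            using gfin by (cases "morrey_sup \<nu> \<kappa> p w g") auto
          then have "weighted_integral p (u x h) UNIV g \<le> ennreal (B powr p / (1 - \<gamma>) * N (ccube x h) powr (p * \<kappa>))"
            by (intro est xh) auto
          then show ?thesis by (rule le_less_trans) simp
        qed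
        then have "weighted_integral p (u x h) UNIV g \<le> ennreal C3 * weighted_integral p (u x h) UNIV f"
          by (rule weighted_estimateD[OF C3(2) u(1)[OF xh(1)] u(2)[OF xh(1)] fg])
        also have "\<dots> \<le> ennreal C3 * ennreal (A powr p / (1 - \<gamma>) * N (ccube x h) powr (p * \<kappa>))"
          using real by (intro mult_left_mono est xh) auto
        also have "\<dots> = ennreal (C3 * (A powr p / (1 - \<gamma>) * N Q powr (p * \<kappa>)))"
          using C3(1) \<gamma> by (subst ennreal_mult) (auto simp: xh)
        finally have Iu: "weighted_integral p (u x h) UNIV g \<le> ennreal (C3 * (A powr p / (1 - \<gamma>) * N Q powr (p * \<kappa>)))" .
        have "weighted_integral p w Q g \<le> weighted_integral p (u x h) UNIV g"
          unfolding weighted_integral_def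
        proof (rule nn_integral_mono)
          fix y
          have "y \<in> Q \<Longrightarrow> 1 \<le> layered (a x h) x h y"
            using v(2)[of y 0] seq[OF xh(1), of x] by (simp add: dil_0 xh layer_seq_def)
          then have "y \<in> Q \<Longrightarrow> norm (g y) powr p * w y \<le> norm (g y) powr p * u x h y"
            using w0[of y] by (intro mult_left_mono) (auto simp: u_def mult_le_cancel_left1)
          then show "ennreal (norm (g y) powr p * w y) * indicator Q y \<le> ennreal (norm (g y) powr p * u x h y) * indicator UNIV y"
            by (auto simp: indicator_def intro: ennreal_leI)
        qed
        then have "weighted_integral p w Q g \<le> ennreal (C3 * (A powr p / (1 - \<gamma>) * N Q powr (p * \<kappa>)))"
          using Iu by (rule order_trans)
        then have "Lp_norm p w Q g \<le> ennreal_power (ennreal (C3 * (A powr p / (1 - \<gamma>) * N Q powr (p * \<kappa>)))) (1 / p)"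
          unfolding Lp_norm_weighted_integral using p by (intro ennreal_power_mono) auto
        also have "\<dots> = ennreal ((C3 * (A powr p / (1 - \<gamma>) * N Q powr (p * \<kappa>))) powr (1 / p))"
          using p C3(1) \<gamma> by (intro ennreal_power_ennreal) auto
        also have "(C3 * (A powr p / (1 - \<gamma>) * N Q powr (p * \<kappa>))) powr (1 / p)
          = (C3 / (1 - \<gamma>) * (A powr p * N Q powr (p * \<kappa>))) powr (1 / p)" by simp
        also have "\<dots> = c * A * N Q powr \<kappa>"
        proof -
          have "(A powr p) powr (1 / p) = A" "(N Q powr (p * \<kappa>)) powr (1 / p) = N Q powr \<kappa>"
            using p real N(2)[OF Q] by (simp_all add: powr_powr)
          then show ?thesis using C3(1) \<gamma> unfolding c_def by (subst powr_mult) (auto simp: powr_mult)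
        qed
        finally have "Lp_norm p w Q g \<le> ennreal (c * A) * ennreal (N Q powr \<kappa>)"
          using c real by (simp add: ennreal_mult)
        then have "Lp_norm p w Q g * ennreal (1 / N Q powr \<kappa>) \<le> ennreal (c * A)"
          using N(2)[OF Q] by (subst ennreal_mult_inverse_le_iff) auto
        moreover have "ennreal_power (\<nu> Q) (- \<kappa>) = ennreal (1 / N Q powr \<kappa>)"
          using N[OF Q] by (simp add: ennreal_power_ennreal_pos powr_minus_divide)
        ultimately show "ennreal_power (\<nu> Q) (- \<kappa>) * Lp_norm p w Q g \<le> ennreal c * morrey_sup \<nu> \<kappa> p w f"
          using real c by (simp add: mult.commute ennreal_mult)
      qed
    qed
  qed
qed

lemma morrey_bounds:
  fixes F :: "((real ^ 'n \<Rightarrow> real) \<times> (real ^ 'n \<Rightarrow> real)) set"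
  assumes F: "extrapolation_pairs F" and p: "1 \<le> p" and bd: "weighted_bound fin p F" and w: "w \<in> muckenhoupt p"
  shows morrey_bound: "- real CARD('n) / p \<le> r \<Longrightarrow> r < 0 \<Longrightarrow>
      dominated fin (morrey_norm r p w) F"
    and morrey_leb_bound: "1 < \<sigma> \<Longrightarrow> r \<le> - real CARD('n) / (p * \<sigma>) \<Longrightarrow> w \<in> reverse_holder \<sigma> \<Longrightarrow>
      dominated fin (morrey_norm_leb r p w) F"
proof -
  let ?n = "real CARD('n)"
  define \<kappa> where "\<kappa> = 1 / p + r / ?n"
  define \<tau> where "\<tau> = p * \<kappa>"
  have n: "0 < ?n" by (simp add: zero_less_card_finite)
  have \<tau>: "\<tau> = 1 + p * r / ?n" using p by (simp add: \<tau>_def \<kappa>_def distrib_left)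
  have pw: "pos_weight w" using w by (simp add: muckenhoupt_iff)
  have w0: "0 \<le> w x" for x using pw by (simp add: pos_weight_def)
  show "dominated fin (morrey_norm r p w) F"
    if r: "- ?n / p \<le> r" "r < 0"
  proof -
    have \<tau>01: "0 \<le> \<tau>" "\<tau> < 1"
      using r p n by (auto simp: \<tau> field_simps mult_pos_neg)
    \<comment> \<open>The midpoint between \<tau> and 1: below 1 the coefficients form a layer
      sequence, above \<tau> the exponent \<tau> - \<theta> of w(dilate) is negative and the series
      decays. The interval is nonempty because r < 0.\<close>
    define \<theta> where "\<theta> = (1 + \<tau>) / 2"
    have \<theta>: "0 < \<theta>" "\<theta> < 1 / 1" "\<tau> < \<theta>" using \<tau>01 by (auto simp: \<theta>_def)
    have w1: "(\<lambda>x. w x powr 1) = w" using w0 by auto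
    have "reverse_holder_const 1 w 1" unfolding reverse_holder_const_def w1 by simp
    then obtain D C \<gamma> where D: "1 \<le> D" "0 < C" "0 < \<gamma>" "\<gamma> < 1"
      and seq: "\<And>x h. 0 < h \<Longrightarrow> layer_seq D C w x h (layer_coeff 1 \<theta> w x h)"
      and grow: "\<And>x h j. 0 < h \<Longrightarrow> mass w (dil x h j) \<le> \<gamma> * mass w (dil x h (Suc j))"
      using layer_coeff_layer_seq[OF p w order_refl _ zero_less_one \<theta>(1,2)] unfolding w1 by metis
    define g where "g = \<gamma> powr (\<theta> - \<tau>)"
    have g: "0 < g" "g < 1" using D(3,4) \<theta> powr_less_mono2[of "\<theta> - \<tau>" \<gamma> 1] by (auto simp: g_def)
    have dec: "layer_coeff 1 \<theta> w x h (Suc j) * mass w (dil x h (Suc j)) powr \<tau>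
      \<le> g * (layer_coeff 1 \<theta> w x h j * mass w (dil x h j) powr \<tau>)" if h: "0 < h" for x h j
    proof -
      let ?U = "\<lambda>j. mass w (dil x h j)"
      have U: "0 < ?U j" for j by (rule weight_of_mass(2)[OF pw dil_in_cubes[OF h]])
      have m: "0 < measure lebesgue (dil x h j)" for j by (rule measure_cube(2)[OF dil_in_cubes[OF h]])
      have a: "layer_coeff 1 \<theta> w x h j * ?U j powr \<tau> = ?U 0 powr \<theta> * ?U j powr (\<tau> - \<theta>)" for j
        using m[of 0] m[of j] U[of 0] U[of j] unfolding layer_coeff_def w1 by (simp add: powr_divide powr_diff)
      have "?U (Suc j) powr (\<tau> - \<theta>) \<le> (?U j / \<gamma>) powr (\<tau> - \<theta>)"
        using grow[OF h, of x j] U[of j] D \<theta> by (intro powr_mono2') (auto simp: field_simps)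
      also have "\<dots> = g * ?U j powr (\<tau> - \<theta>)"
      proof -
        have "\<gamma> powr (\<theta> - \<tau>) * \<gamma> powr (\<tau> - \<theta>) = 1" using D by (simp flip: powr_add)
        then show ?thesis using U[of j] D by (simp add: g_def powr_divide field_simps)
      qed
      finally have "?U 0 powr \<theta> * ?U (Suc j) powr (\<tau> - \<theta>) \<le> ?U 0 powr \<theta> * (g * ?U j powr (\<tau> - \<theta>))"
        by (intro mult_left_mono) auto
      then show ?thesis unfolding a by (simp add: mult_ac)
    qed
    show ?thesis unfolding morrey_norm_eq \<kappa>_def[symmetric]
      by (rule morrey_transfer[OF F p bd w D(1,2) g seq, where N = "mass w"])
         (use weight_of_mass[OF pw] dec in \<open>auto simp: \<tau>_def\<close>)
  qed
  show "dominated fin (morrey_norm_leb r p w) F"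
    if \<sigma>: "1 < \<sigma>" and r: "r \<le> - ?n / (p * \<sigma>)" and rh: "w \<in> reverse_holder \<sigma>"
  proof -
    define \<alpha> where "\<alpha> = 1 - 1 / \<sigma>"
    have \<tau>\<alpha>: "\<tau> \<le> \<alpha>"
    proof -
      have "p * r \<le> p * (- ?n / (p * \<sigma>))" using r p by (intro mult_left_mono) auto
      also have "\<dots> = - ?n / \<sigma>" using p by simp
      finally have "p * r / ?n \<le> - ?n / \<sigma> / ?n" by (intro divide_right_mono) auto
      also have "\<dots> = - 1 / \<sigma>" using n by simp
      finally show ?thesis by (simp add: \<tau> \<alpha>_def)
    qed
    \<comment> \<open>The choice within (0, 1/\<sigma>) is independent of r. Since \<tau> \<le>
      \<alpha>, the volume factor already compensates the power \<tau>, and the decay comes from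
      W^\<theta> alone; this covers the endpoint \<tau> = \<alpha>.\<close>
    define \<theta> where "\<theta> = 1 / (2 * \<sigma>)"
    have \<theta>: "0 < \<theta>" "\<theta> < 1 / \<sigma>" using \<sigma> by (auto simp: \<theta>_def field_simps)
    have \<sigma>1: "1 \<le> \<sigma>" using \<sigma> by simp
    let ?W = "\<lambda>x. w x powr \<sigma>"
    obtain c0 where c0: "\<And>Q. Q \<in> cubes \<Longrightarrow> ennreal_power (cube_average ?W Q) (1 / \<sigma>) \<le> ennreal c0 * cube_average w Q"
      using rh by (auto simp: reverse_holder_def)
    \<comment> \<open>The given constant is a real without sign; enlarging it makes it
      positive.\<close>
    define c where "c = max c0 1"
    have c: "0 < c" by (simp add: c_def)
    have rhc: "reverse_holder_const \<sigma> w c"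
      unfolding reverse_holder_const_def
    proof
      fix Q :: "(real ^ 'n) set" assume "Q \<in> cubes"
      then have "ennreal_power (cube_average ?W Q) (1 / \<sigma>) \<le> ennreal c0 * cube_average w Q" by (rule c0)
      also have "\<dots> \<le> ennreal c * cube_average w Q" by (intro mult_right_mono ennreal_leI) (auto simp: c_def)
      finally show "ennreal_power (cube_average ?W Q) (1 / \<sigma>) \<le> ennreal c * cube_average w Q" .
    qed
    have pW: "pos_weight ?W" by (rule reverse_holder_pos_weight(1)[OF pw \<sigma>1 rhc c])
    obtain D C \<gamma> where D: "1 \<le> D" "0 < C" "0 < \<gamma>" "\<gamma> < 1"
      and seq: "\<And>x h. 0 < h \<Longrightarrow> layer_seq D C w x h (layer_coeff \<sigma> \<theta> w x h)"
      and grow: "\<And>x h j. 0 < h \<Longrightarrow> mass ?W (dil x h j) \<le> \<gamma> * mass ?W (dil x h (Suc j))"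
      using layer_coeff_layer_seq[OF p w \<sigma>1 rhc c \<theta>] by metis
    define g where "g = \<gamma> powr \<theta>"
    have g: "0 < g" "g < 1" using D(3,4) \<theta> powr_less_mono2[of "\<theta>" \<gamma> 1] by (auto simp: g_def)
    have dec: "layer_coeff \<sigma> \<theta> w x h (Suc j) * measure lebesgue (dil x h (Suc j)) powr \<tau>
      \<le> g * (layer_coeff \<sigma> \<theta> w x h j * measure lebesgue (dil x h j) powr \<tau>)" if h: "0 < h" for x h j
    proof -
      let ?U = "\<lambda>j. mass ?W (dil x h j)" and ?m = "\<lambda>j. measure lebesgue (dil x h j)"
      let ?a = "layer_coeff \<sigma> \<theta> w x h j"
      have U: "0 < ?U j" for j by (rule weight_of_mass(2)[OF pW dil_in_cubes[OF h]])
      have m: "0 < ?m j" for j by (rule measure_cube(2)[OF dil_in_cubes[OF h]])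
      have mle: "?m j \<le> ?m (Suc j)"
        using m[of j] unfolding measure_dil_Suc[OF h] by (simp add: mult_le_cancel_right1)
      have a0: "0 \<le> ?a" unfolding layer_coeff_def by simp
      have "?U j / ?U (Suc j) \<le> \<gamma>" using grow[OF h, of x j] U[of "Suc j"] by (simp add: field_simps)
      then have 1: "(?U j / ?U (Suc j)) powr \<theta> \<le> g"
        unfolding g_def using U \<theta> by (intro powr_mono2) (auto simp: less_imp_le)
      have "?m (Suc j) powr (\<tau> - \<alpha>) \<le> ?m j powr (\<tau> - \<alpha>)"
        using m[of j] mle \<tau>\<alpha> by (intro powr_mono2') auto
      then have "?m j powr \<alpha> * ?m (Suc j) powr (\<tau> - \<alpha>) \<le> ?m j powr \<alpha> * ?m j powr (\<tau> - \<alpha>)"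
        by (intro mult_left_mono) auto
      then have 2: "(?m j / ?m (Suc j)) powr \<alpha> * ?m (Suc j) powr \<tau> \<le> ?m j powr \<tau>"
        using m[of j] m[of "Suc j"] by (simp add: powr_divide powr_diff)
      have "layer_coeff \<sigma> \<theta> w x h (Suc j) * ?m (Suc j) powr \<tau>
        = ?a * ((?U j / ?U (Suc j)) powr \<theta> * ((?m j / ?m (Suc j)) powr \<alpha> * ?m (Suc j) powr \<tau>))"
        unfolding layer_coeff_Suc[OF pW h] \<alpha>_def by (simp only: mult_ac)
      also have "\<dots> \<le> ?a * (g * ?m j powr \<tau>)"
        using 1 2 a0 g by (intro mult_left_mono mult_mono) auto
      finally show ?thesis by (simp add: mult_ac)
    qed
    show ?thesis unfolding morrey_norm_leb_eq \<kappa>_def[symmetric]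
      by (rule morrey_transfer[OF F p bd w D(1,2) g seq, where N = "measure lebesgue"])
         (use measure_cube dec in \<open>auto simp: \<tau>_def\<close>)
  qed
qed

lemma morrey_extrapolation:
  fixes F :: "((real ^ 'n \<Rightarrow> real) \<times> (real ^ 'n \<Rightarrow> real)) set"
  assumes q: "1 \<le> q" and F: "extrapolation_pairs F"
    and ex: "\<exists>C\<^sub>1 :: ennreal \<Rightarrow> real. (\<forall>t. 0 < C\<^sub>1 t) \<and>
        (\<forall>w\<in>muckenhoupt q. \<forall>(f, g)\<in>F. (fin \<longrightarrow> Lp_norm q w UNIV g < \<infinity>) \<longrightarrow>
           Lp_norm q w UNIV g \<le> ennreal (C\<^sub>1 (muckenhoupt_const q w)) * Lp_norm q w UNIV f)"
    and p: "1 < p \<or> p = 1 \<and> q = 1" and w: "w \<in> muckenhoupt p"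
  shows "- real CARD('n) / p \<le> r \<Longrightarrow> r < 0 \<Longrightarrow> dominated fin (morrey_norm r p w) F"
    and "1 < \<sigma> \<Longrightarrow> r \<le> - real CARD('n) / (p * \<sigma>) \<Longrightarrow> w \<in> reverse_holder \<sigma> \<Longrightarrow>
      dominated fin (morrey_norm_leb r p w) F"
proof -
  obtain C1 where C1: "\<forall>t. 0 < C1 t" "\<forall>w\<in>muckenhoupt q. \<forall>(f, g)\<in>F. (fin \<longrightarrow> Lp_norm q w UNIV g < \<infinity>) \<longrightarrow>
      Lp_norm q w UNIV g \<le> ennreal (C1 (muckenhoupt_const q w)) * Lp_norm q w UNIV f"
    using ex by (elim exE conjE)
  have "weighted_bound fin q F"
  proof (rule weighted_bound_uniform[OF F q C1(1)[rule_format]])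
    fix w f g assume "w \<in> muckenhoupt q" "(f, g) \<in> F" and fin: "fin \<Longrightarrow> Lp_norm q w UNIV g < \<infinity>"
    then have "case (f, g) of (f, g) \<Rightarrow> (fin \<longrightarrow> Lp_norm q w UNIV g < \<infinity>) \<longrightarrow>
        Lp_norm q w UNIV g \<le> ennreal (C1 (muckenhoupt_const q w)) * Lp_norm q w UNIV f"
      by (intro C1(2)[THEN bspec, THEN bspec])
    then show "Lp_norm q w UNIV g \<le> ennreal (C1 (muckenhoupt_const q w)) * Lp_norm q w UNIV f"
      using fin by simp
  qed
  \<comment> \<open>The case p = 1 occurs only for q = 1, where nothing has to be
    extrapolated.\<close>
  then have b: "weighted_bound fin p F" using p extrapolation[OF F q] by auto
  have "1 \<le> p" using p by auto
  note * = morrey_bounds[OF F this b w]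
  show "- real CARD('n) / p \<le> r \<Longrightarrow> r < 0 \<Longrightarrow> dominated fin (morrey_norm r p w) F"
    by (rule *(1))
  show "1 < \<sigma> \<Longrightarrow> r \<le> - real CARD('n) / (p * \<sigma>) \<Longrightarrow> w \<in> reverse_holder \<sigma> \<Longrightarrow>
      dominated fin (morrey_norm_leb r p w) F"
    by (rule *(2))
qed

theorem theorem4p1:
  fixes p\<^sub>0 :: real
    and F :: "((real ^ 'n \<Rightarrow> real) \<times> (real ^ 'n \<Rightarrow> real)) set"
  assumes p0: "1 \<le> p\<^sub>0"
    and F_measurable: "\<And>f g. (f, g) \<in> F \<Longrightarrow>
          f \<in> borel_measurable lebesgue \<and> g \<in> borel_measurable lebesgue"
    and F_nonneg: "\<And>f g x. (f, g) \<in> F \<Longrightarrow> 0 \<le> f x \<and> 0 \<le> g x"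
  shows
    "((\<exists>C\<^sub>1 :: ennreal \<Rightarrow> real. (\<forall>t. 0 < C\<^sub>1 t) \<and>
        (\<forall>w\<in>muckenhoupt p\<^sub>0. \<forall>(f, g)\<in>F.
           Lp_norm p\<^sub>0 w UNIV g \<le> ennreal (C\<^sub>1 (muckenhoupt_const p\<^sub>0 w)) * Lp_norm p\<^sub>0 w UNIV f))
      \<longrightarrow>
      (\<forall>p r w. (1 < p \<or> (p = 1 \<and> p\<^sub>0 = 1)) \<longrightarrow> - real CARD('n) / p \<le> r \<longrightarrow> r < 0 \<longrightarrow>
         w \<in> muckenhoupt p \<longrightarrow>
         (\<exists>c\<^sub>2::real. 0 < c\<^sub>2 \<and> (\<forall>(f, g)\<in>F.
            morrey_norm r p w g \<le> ennreal c\<^sub>2 * morrey_norm r p w f))) \<and>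
      (\<forall>p \<sigma> r w. (1 < p \<or> (p = 1 \<and> p\<^sub>0 = 1)) \<longrightarrow> 1 < \<sigma> \<longrightarrow>
         - real CARD('n) / p \<le> r \<longrightarrow> r \<le> - real CARD('n) / (p * \<sigma>) \<longrightarrow>
         w \<in> muckenhoupt p \<inter> reverse_holder \<sigma> \<longrightarrow>
         (\<exists>c\<^sub>3::real. 0 < c\<^sub>3 \<and> (\<forall>(f, g)\<in>F.
            morrey_norm_leb r p w g \<le> ennreal c\<^sub>3 * morrey_norm_leb r p w f))))
     \<and>
     ((\<exists>C\<^sub>1 :: ennreal \<Rightarrow> real. (\<forall>t. 0 < C\<^sub>1 t) \<and>
        (\<forall>w\<in>muckenhoupt p\<^sub>0. \<forall>(f, g)\<in>F. Lp_norm p\<^sub>0 w UNIV g < \<infinity> \<longrightarrow>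
           Lp_norm p\<^sub>0 w UNIV g \<le> ennreal (C\<^sub>1 (muckenhoupt_const p\<^sub>0 w)) * Lp_norm p\<^sub>0 w UNIV f))
      \<longrightarrow>
      (\<forall>p r w. (1 < p \<or> (p = 1 \<and> p\<^sub>0 = 1)) \<longrightarrow> - real CARD('n) / p \<le> r \<longrightarrow> r < 0 \<longrightarrow>
         w \<in> muckenhoupt p \<longrightarrow>
         (\<exists>c\<^sub>2::real. 0 < c\<^sub>2 \<and> (\<forall>(f, g)\<in>F. morrey_norm r p w g < \<infinity> \<longrightarrow>
            morrey_norm r p w g \<le> ennreal c\<^sub>2 * morrey_norm r p w f))) \<and>
      (\<forall>p \<sigma> r w. (1 < p \<or> (p = 1 \<and> p\<^sub>0 = 1)) \<longrightarrow> 1 < \<sigma> \<longrightarrow>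
         - real CARD('n) / p \<le> r \<longrightarrow> r \<le> - real CARD('n) / (p * \<sigma>) \<longrightarrow>
         w \<in> muckenhoupt p \<inter> reverse_holder \<sigma> \<longrightarrow>
         (\<exists>c\<^sub>3::real. 0 < c\<^sub>3 \<and> (\<forall>(f, g)\<in>F. morrey_norm_leb r p w g < \<infinity> \<longrightarrow>
            morrey_norm_leb r p w g \<le> ennreal c\<^sub>3 * morrey_norm_leb r p w f))))"
proof -
  have F: "extrapolation_pairs F"
    using F_measurable F_nonneg by (auto simp: extrapolation_pairs_def)
  \<comment> \<open>The two halves of the statement are the two values of the finiteness
    flag.\<close>
  note unconditional = morrey_extrapolation[OF p0 F, of False, unfolded dominated_def, simplified not_False_eq_True simp_thms]
  note conditional = morrey_extrapolation[OF p0 F, of True, unfolded dominated_def, simplified simp_thms]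
  show ?thesis
    by (intro conjI allI impI; (elim IntE)?;
      (rule unconditional(1) | rule unconditional(2) | rule conditional(1) | rule conditional(2)); assumption)
qed

end
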